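(* Let $\epsilon>0$ and $C>0$. There exist constants $c=c(C,\epsilon)>0$ and $X_0=X_0(C,\epsilon)$ such that for every prime power $q$, integers $n\ge 2$ and $1\le b\le n/2$, and all $M,A\in\mathbb{F}_q[T]$ with $M\ne0$, $\gcd(A,M)=1$, satisfying \[ \deg M\le (1/2-\epsilon)b\quad\text{and}\quad P_j(M)\le C\frac{q^j}{j^{1+\epsilon}}\ \text{for all integers } j\ge1, \] we have, whenever $q^n\ge X_0$, \[ |H(n,b;A,M)|\ \ge\ c\,\frac{1}{\Phi(M)}\cdot\frac{q^n}{b^{\delta}(1+\log b)^{3/2}}. \]
   Context: $\mathbb{F}_q$ is the finite field with $q$ elements; $\mathcal{M}_k$ is the set of monic polynomials of degree $k$ in $\mathbb{F}_q[T]$. $H(n,b;A,M)=\{F\in\mathcal{M}_n: F \text{ has a divisor of degree } b,\ F\equiv A\bmod M\}$. For nonzero $M$, $\Phi(M)=\#\{A:\deg A<\deg M,\ \gcd(A,M)=1\}$ and $P_j(M)$ is the number of distinct monic irreducible divisors of $M$ of degree $j$. $\delta=1-\frac{1+\log\log 2}{\log 2}$, $\log$ natural logarithm. *)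

theory Defs
  imports Complex_Main "HOL-Algebra.Polynomial_Divisibility"
begin

text \<open>
  The constants in the theorem have to be uniform over all finite fields, so the field cannot be
  a type: it is a \<open>HOL-Algebra\<close> ring \<open>R\<close>, and its polynomial ring is \<^term>\<open>poly_ring R\<close>.
  Carriers inside \<open>nat\<close> suffice, as every finite field is isomorphic to one of these.
  There polynomials are coefficient lists with the leading coefficient first, zero is \<^term>\<open>[]\<close>,
  and \<open>Polynomials.degree []\<close> is \<open>0\<close>.
\<close>

definition monics :: "('a, 'b) ring_scheme \<Rightarrow> nat \<Rightarrow> 'a list set" where
  "monics R k =
     {F \<in> carrier (poly_ring R).
        F \<noteq> [] \<and> Polynomials.lead_coeff F = \<one>\<^bsub>R\<^esub> \<and> Polynomials.degree F = k}"

definition poly_coprime :: "('a, 'b) ring_scheme \<Rightarrow> 'a list \<Rightarrow> 'a list \<Rightarrow> bool" where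
  "poly_coprime R A M \<longleftrightarrow> \<one>\<^bsub>poly_ring R\<^esub> gcdof\<^bsub>poly_ring R\<^esub> A M"

definition poly_cong :: "('a, 'b) ring_scheme \<Rightarrow> 'a list \<Rightarrow> 'a list \<Rightarrow> 'a list \<Rightarrow> bool" where
  "poly_cong R M F A \<longleftrightarrow> M pdivides\<^bsub>R\<^esub> (F \<ominus>\<^bsub>poly_ring R\<^esub> A)"

definition H :: "('a, 'b) ring_scheme \<Rightarrow> nat \<Rightarrow> nat \<Rightarrow> 'a list \<Rightarrow> 'a list \<Rightarrow> 'a list set" where
  "H R n b A M =
     {F \<in> monics R n.
        (\<exists>D \<in> carrier (poly_ring R). Polynomials.degree D = b \<and> D pdivides\<^bsub>R\<^esub> F) \<and>
        poly_cong R M F A}"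

text \<open>
  The disjunct \<open>A = []\<close> says that the zero polynomial has degree below every \<open>deg M\<close>, including
  \<open>deg M = 0\<close>; without it \<open>Phi R M\<close> would be \<open>0\<close> instead of \<open>1\<close> for constant \<open>M\<close>.
\<close>

definition Phi :: "('a, 'b) ring_scheme \<Rightarrow> 'a list \<Rightarrow> nat" where
  "Phi R M =
     card {A \<in> carrier (poly_ring R).
             (A = [] \<or> Polynomials.degree A < Polynomials.degree M) \<and> poly_coprime R A M}"

definition num_irred_divisors :: "('a, 'b) ring_scheme \<Rightarrow> nat \<Rightarrow> 'a list \<Rightarrow> nat" where
  "num_irred_divisors R j M =
     card {P \<in> monics R j. pirreducible\<^bsub>R\<^esub> (carrier R) P \<and> P pdivides\<^bsub>R\<^esub> M}"

definition delta :: real where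
  "delta = 1 - (1 + ln (ln 2)) / ln 2"

end

theory Submission
  imports Defs "HOL-Library.FuncSet" "HOL-Library.Multiset" "HOL-Analysis.Convex"
    "HOL-Analysis.Harmonic_Numbers" "HOL-Combinatorics.Multiset_Permutations"
begin

text \<open>
  By unique factorisation the monic polynomials over \<open>GF(q)\<close> are the finite multisets of monic irreducibles.
  We count products \<open>P\<^sub>1 \<dots> P\<^sub>J p E \<equiv> A\<close> modulo \<open>M\<close>, where the irreducibles \<open>P\<^sub>i\<close> have total degree at most
  \<open>b/40\<close>, the irreducible \<open>p\<close> has degree \<open>b - s\<close> for some subset sum \<open>s\<close> of the degrees of the \<open>P\<^sub>i\<close>, and \<open>E\<close>
  has no factor of degree at most \<open>b/40\<close> (or at most \<open>b\<close>, if \<open>n\<close> is large). The congruence only restricts \<open>E\<close>,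
  and such \<open>E\<close> are counted by a lower bound sieve: the number of polynomials of degree \<open>m \<ge> deg M\<close> in a residue
  class modulo \<open>M\<close> is exactly \<open>q\<^sup>m / |M|\<close>. Both \<open>p\<close> and \<open>E\<close> cost a factor \<open>1/b\<close>, and a product arises at most
  \<open>44 J!\<close> times.

  It remains to bound from below the number of distinct subset sums, on average over \<open>P\<^sub>1, \<dots>, P\<^sub>J\<close>. Place the
  degrees in dyadic blocks, each of mass about \<open>log 2\<close>, with \<open>2\<^sup>J\<close> of order \<open>b\<close>, and let \<open>B\<^sub>h\<close> be the number of \<open>P\<^sub>i\<close> in
  the first \<open>h\<close> blocks. By Cauchy--Schwarz there are \<open>\<ge> 2\<^sup>J / (1 + 4 \<Sum>\<^sub>h 2^(B\<^sub>h - h))\<close> subset sums on average. The sum over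
  \<open>h\<close> is bounded for a proportion of order \<open>1/J\<close> of all placements: of order \<open>J\<^sup>J / J\<close> placements stay below the
  diagonal, and rotating such a path to its peak bounds the average of the sum over them.
  With Stirling's formula \<open>(2 log 2)\<^sup>J J^(J-1) / J!\<close> is of order \<open>b^(2-\<delta>) / (log b)^(3/2)\<close>.

  The hypothesis on \<open>P\<^sub>j(M)\<close> bounds \<open>\<Phi>(M) / |M|\<close> from below and makes the irreducibles dividing \<open>M\<close> negligible
  in the dyadic blocks, with a summable total loss.
\<close>

section \<open>Paths below a barrier\<close>

text \<open>The barrier is forced by rare placements: the mean of \<open>2^(B_h)\<close> over all
  \<open>J^J\<close> placements is \<open>(1 + h/J)^J\<close>, which for small \<open>h\<close> is
  about \<open>e^h\<close> and overwhelms \<open>2^h\<close>. Crowded low blocks make many subset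
  sums coincide, so such placements have to be discarded before Cauchy--Schwarz is applied. What
  remains is a proportion of order \<open>1/J\<close>; this factor and the \<open>sqrt J\<close> in
  Stirling's formula make up the exponent \<open>3/2\<close> of the logarithm. With
  \<open>2^J\<close> of order \<open>b\<close> the subset sums have about as much room as they need
  to be distinct.

  Uniformity in \<open>q\<close> comes from working with densities: the number of irreducibles of
  degree \<open>j\<close>, divided by \<open>q^j\<close>, lies between \<open>1/j - 4/j^2\<close>
  and \<open>1/j\<close> for every \<open>q\<close>. Ordered tuples with repetition are used
  throughout because sums over them factor; the price is the \<open>J!\<close> in the
  multiplicity.\<close>

definition cum :: "('a \<Rightarrow> nat) \<Rightarrow> 'a set \<Rightarrow> nat \<Rightarrow> nat" where
  "cum f I l = card {x \<in> I. f x \<le> l}"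

definition below :: "'a set \<Rightarrow> nat \<Rightarrow> (nat \<Rightarrow> nat) \<Rightarrow> ('a \<Rightarrow> nat) set" where
  "below I m \<beta> = {f \<in> I \<rightarrow>\<^sub>E {1..m}. \<forall>l\<in>{1..m}. cum f I l \<le> \<beta> l}"

lemma finite_below: "finite I \<Longrightarrow> finite (below I m \<beta>)"
  unfolding below_def by (rule finite_subset[of _ "I \<rightarrow>\<^sub>E {1..m}"]) (auto intro: finite_PiE)

text \<open>Sort the paths by the set \<open>T\<close> of elements in the last cell. By
  \<open>top\<close> the barrier at \<open>Suc m\<close> excludes nothing, so what is left is a path
  of the elements outside \<open>T\<close> in \<open>m\<close> cells.\<close>

lemma card_below_Suc:
  assumes fin: "finite I" and top: "card I \<le> \<beta> (Suc m)"
  shows "card (below I (Suc m) \<beta>) = (\<Sum>T\<in>Pow I. card (below (I - T) m \<beta>))"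
proof -
  let ?F = "\<lambda>f. ({x\<in>I. f x = Suc m}, restrict f (I - {x\<in>I. f x = Suc m}))"
  let ?G = "\<lambda>(T, g) x. if x \<in> T then Suc m else g x"
  have eq: "cum g (I - T) l = cum (\<lambda>x. if x \<in> T then Suc m else g x) I l"
    if "l \<le> m" "T \<subseteq> I" for g T l
    unfolding cum_def using that by (intro arg_cong[where f=card]) auto
  have "bij_betw ?F (below I (Suc m) \<beta>) (SIGMA T:Pow I. below (I - T) m \<beta>)"
  proof (rule bij_betw_byWitness[where f' = ?G])
    show "\<forall>f\<in>below I (Suc m) \<beta>. ?G (?F f) = f"
      by (auto simp: below_def fun_eq_iff PiE_def extensional_def)
    show "\<forall>p\<in>(SIGMA T:Pow I. below (I - T) m \<beta>). ?F (?G p) = p"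
    proof
      fix p assume "p \<in> (SIGMA T:Pow I. below (I - T) m \<beta>)"
      then obtain T g where p: "p = (T, g)" and T: "T \<subseteq> I" and g: "g \<in> below (I - T) m \<beta>" by auto
      have *: "g x \<noteq> Suc m" if "x \<in> I" "x \<notin> T" for x
        using g that by (auto simp: below_def dest!: PiE_mem[of _ _ _ x])
      have "{x\<in>I. ?G (T, g) x = Suc m} = T" using T * by auto
      then show "?F (?G p) = p"
        using g unfolding p by (auto simp: below_def fun_eq_iff PiE_def extensional_def)
    qed
    show "?F ` below I (Suc m) \<beta> \<subseteq> (SIGMA T:Pow I. below (I - T) m \<beta>)"
    proof (rule image_subsetI)
      fix f assume f: "f \<in> below I (Suc m) \<beta>"
      let ?T = "{x\<in>I. f x = Suc m}"
      have 1: "restrict f (I - ?T) \<in> (I - ?T) \<rightarrow>\<^sub>E {1..m}"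
        using f by (auto simp: below_def PiE_def Pi_def le_Suc_eq)
      have "cum (restrict f (I - ?T)) (I - ?T) l \<le> \<beta> l" if "l \<in> {1..m}" for l
      proof -
        have "cum (restrict f (I - ?T)) (I - ?T) l = cum f I l"
          unfolding cum_def using that by (intro arg_cong[where f=card]) auto
        then show ?thesis using f that by (auto simp: below_def)
      qed
      with 1 have "restrict f (I - ?T) \<in> below (I - ?T) m \<beta>" by (auto simp: below_def)
      then show "?F f \<in> (SIGMA T:Pow I. below (I - T) m \<beta>)" by auto
    qed
    show "?G ` (SIGMA T:Pow I. below (I - T) m \<beta>) \<subseteq> below I (Suc m) \<beta>"
    proof clarify
      fix T g assume T: "T \<subseteq> I" and g: "g \<in> below (I - T) m \<beta>"
      have 1: "?G (T, g) \<in> I \<rightarrow>\<^sub>E {1..Suc m}"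
        using g T by (fastforce simp: below_def PiE_def Pi_def extensional_def)
      have "cum (?G (T, g)) I l \<le> \<beta> l" if "l \<in> {1..Suc m}" for l
      proof (cases "l \<le> m")
        case True
        have "cum g (I - T) l \<le> \<beta> l" using g True that by (auto simp: below_def)
        then show ?thesis using eq[OF True T, of g] by simp
      next
        case False
        then have "l = Suc m" using that by auto
        moreover have "cum (?G (T, g)) I l \<le> card I"
          unfolding cum_def by (intro card_mono fin) auto
        ultimately show ?thesis using top by simp
      qed
      with 1 show "(\<lambda>x. if x \<in> T then Suc m else g x) \<in> below I (Suc m) \<beta>"
        by (auto simp: below_def)
    qed
  qed
  then have "card (below I (Suc m) \<beta>) = card (SIGMA T:Pow I. below (I - T) m \<beta>)"
    by (rule bij_betw_same_card)
  also have "\<dots> = (\<Sum>T\<in>Pow I. card (below (I - T) m \<beta>))"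
    by (rule card_SigmaI) (use fin in \<open>auto intro!: finite_below\<close>)
  finally show ?thesis .
qed

lemma card_below_le_of_bij:
  assumes h: "bij_betw h I Y" and fin: "finite I"
  shows "card (below Y m \<beta>) \<le> card (below I m \<beta>)"
proof (rule card_inj_on_le[where f = "\<lambda>f. restrict (f \<circ> h) I"])
  have Y: "Y = h ` I" using h by (simp add: bij_betw_def)
  show "inj_on (\<lambda>f. restrict (f \<circ> h) I) (below Y m \<beta>)"
  proof (rule inj_onI)
    fix f g assume f: "f \<in> below Y m \<beta>" and g: "g \<in> below Y m \<beta>"
      and eq: "restrict (f \<circ> h) I = restrict (g \<circ> h) I"
    have "f y = g y" if y: "y \<in> Y" for y
    proof -
      obtain x where "x \<in> I" "y = h x" using y Y by auto
      then show ?thesis using fun_cong[OF eq, of x] by simp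
    qed
    then show "f = g" using f g unfolding below_def by (auto intro: PiE_ext)
  qed
  show "(\<lambda>f. restrict (f \<circ> h) I) ` below Y m \<beta> \<subseteq> below I m \<beta>"
  proof clarify
    fix f assume f: "f \<in> below Y m \<beta>"
    have "cum (restrict (f \<circ> h) I) I l = cum f Y l" for l
    proof -
      have eq: "{y \<in> Y. f y \<le> l} = h ` {x \<in> I. restrict (f \<circ> h) I x \<le> l}" using Y by auto
      have "inj_on h {x \<in> I. restrict (f \<circ> h) I x \<le> l}"
        using h by (auto simp: bij_betw_def inj_on_def)
      then show ?thesis unfolding cum_def eq by (simp only: card_image)
    qed
    then show "restrict (f \<circ> h) I \<in> below I m \<beta>"
      using f Y by (auto simp: below_def PiE_def Pi_def)
  qed
qed (rule finite_below[OF fin])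

lemma card_below_eqpoll:
  assumes "finite I" "finite Y" "card I = card Y"
  shows "card (below I m \<beta>) = card (below Y m \<beta>)"
proof -
  obtain h where h: "bij_betw h I Y" using assms finite_same_card_bij by blast
  show ?thesis
    using card_below_le_of_bij[OF h assms(1)] card_below_le_of_bij[OF bij_betw_inv_into[OF h] assms(2)]
    by (rule le_antisym[rotated])
qed

lemma sum_Pow_card:
  assumes "finite I"
  shows "(\<Sum>T\<in>Pow I. g (card T)) = (\<Sum>t\<le>card I. of_nat (card I choose t)
      * (g t :: 'b :: comm_semiring_1))"
proof -
  have "(\<Sum>T\<in>Pow I. g (card T)) = (\<Sum>t\<in>{..card I}. \<Sum>T\<in>{T\<in>Pow I. card T = t}. g (card T))"
    using assms by (intro sum.group[symmetric]) (auto intro: card_mono)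
  also have "\<dots> = (\<Sum>t\<le>card I. of_nat (card I choose t) * g t)"
  proof (rule sum.cong, simp)
    fix t
    have "{T\<in>Pow I. card T = t} = {T. T \<subseteq> I \<and> card T = t}" by auto
    then show "(\<Sum>T\<in>{T\<in>Pow I. card T = t}. g (card T)) = of_nat (card I choose t) * g t"
      using n_subsets[OF assms, of t] by simp
  qed
  finally show ?thesis .
qed

text \<open>The recursion for strict paths, \<open>t\<close> being the number of elements in the
  last cell. The sum of \<open>(k choose j) * j * x^j\<close> is
  \<open>k * x * (x + 1)^(k - 1)\<close>; the extra factor \<open>x + 1\<close> removes the exponent
  \<open>k - 1\<close>.\<close>

lemma abel_sum:
  fixes x :: real
  shows "(\<Sum>t\<le>k. of_nat (k choose t) * ((x - real (k - t)) * x ^ (k - t))) * (x + 1)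
       = x * (x + 1 - real k) * (x + 1) ^ k"
proof -
  have b: "(\<Sum>j\<le>k. real (k choose j) * x ^ j) = (x + 1) ^ k"
    using binomial_ring[of x 1 k] by simp
  have d: "(\<Sum>j\<le>k. real (k choose j) * (real j * x ^ j)) * (x + 1) = real k * x * (x + 1) ^ k"
  proof (cases k)
    case 0 then show ?thesis by simp
  next
    case (Suc n)
    have "(\<Sum>j\<le>Suc n. real (Suc n choose j) * (real j * x ^ j))
        = (\<Sum>j\<le>n. real (Suc n choose Suc j) * (real (Suc j) * x ^ Suc j))"
      by (subst sum.atMost_Suc_shift) simp
    also have "\<dots> = (\<Sum>j\<le>n. real (Suc n) * x * (real (n choose j) * x ^ j))"
    proof (rule sum.cong, simp)
      fix j
      have "real (Suc n choose Suc j) * real (Suc j) = real (Suc n) * real (n choose j)"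
        using Suc_times_binomial[of j n] by (metis mult.commute of_nat_mult)
      then show "real (Suc n choose Suc j) * (real (Suc j) * x ^ Suc j) =
         real (Suc n) * x * (real (n choose j) * x ^ j)"
        by (simp only: power_Suc mult.assoc[symmetric]) (simp add: mult_ac)
    qed
    also have "\<dots> = real (Suc n) * x * (x + 1) ^ n"
      using binomial_ring[of x 1 n] by (simp add: sum_distrib_left)
    finally show ?thesis using Suc by (simp add: mult_ac)
  qed
  have "(\<Sum>t\<le>k. of_nat (k choose t) * ((x - real (k - t)) * x ^ (k - t)))
      = (\<Sum>t\<le>k. of_nat (k choose (k - t)) * ((x - real (k - t)) * x ^ (k - t)))"
  proof (rule sum.cong, simp)
    fix t assume "t \<in> {..k}"
    then show "of_nat (k choose t) * ((x - real (k - t)) * x ^ (k - t))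
      = of_nat (k choose (k - t)) * ((x - real (k - t)) * x ^ (k - t))"
      using binomial_symmetric[of t k] by simp
  qed
  also have "\<dots> = (\<Sum>j\<le>k. of_nat (k choose j) * ((x - real j) * x ^ j))"
    by (rule sum.reindex_bij_witness[of _ "\<lambda>j. k - j" "\<lambda>j. k - j"]) auto
  also have "\<dots> = x * (x+1)^k - (\<Sum>j\<le>k. real (k choose j) * (real j * x ^ j))"
    unfolding b[symmetric] sum_distrib_left sum_subtractf[symmetric]
    by (rule sum.cong) (auto simp: algebra_simps)
  finally have S: "(\<Sum>t\<le>k. of_nat (k choose t) * ((x - real (k - t)) * x ^ (k - t)))
      = x * (x+1)^k - (\<Sum>j\<le>k. real (k choose j) * (real j * x ^ j))" .
  show ?thesis
    unfolding S by (simp only: left_diff_distrib d) (simp add: algebra_simps)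
qed

text \<open>With the cells in reverse order these are parking functions. The factor \<open>m\<close> on the left avoids
  the exponent \<open>card I - 1\<close>.\<close>

lemma card_below_strict:
  assumes "finite I"
  shows "real m * real (card (below I m (\<lambda>l. l - 1))) = real (m - card I) * real m ^ card I"
  using assms
proof (induction m arbitrary: I)
  case 0 then show ?case by (cases "card I") auto
next
  case (Suc m)
  show ?case
  proof (cases "card I \<le> m")
    \<comment> \<open>Here the top barrier \<open>m\<close> already excludes every path, and the
      truncated difference \<open>Suc m - card I\<close> is \<open>0\<close>, as it should
      be.\<close>
    case False
    have "cum f I (Suc m) = card I" if "f \<in> I \<rightarrow>\<^sub>E {1..Suc m}" for f
    proof -
      have "{x\<in>I. f x \<le> Suc m} = I" using that by auto
      then show ?thesis by (simp add: cum_def)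
    qed
    then have "f \<notin> below I (Suc m) (\<lambda>l. l - 1)" for f
      using False unfolding below_def by (metis (no_types, lifting) atLeastAtMost_iff diff_Suc_1
          le_add1 le_refl mem_Collect_eq plus_1_eq_Suc)
    then have "below I (Suc m) (\<lambda>l. l - 1) = {}" by blast
    then show ?thesis using False by simp
  next
    case True
    define k where "k = card I"
    show ?thesis
    \<comment> \<open>The induction hypothesis carries a factor \<open>m\<close>, which can be
      cancelled only if it is nonzero.\<close>
    proof (cases "m = 0")
      case True
      then have "I = {}" using \<open>card I \<le> m\<close> Suc.prems by simp
      then have "below I (Suc m) (\<lambda>l. l - 1) = {\<lambda>x. undefined}" by (auto simp: below_def cum_def)
      then show ?thesis using True \<open>I = {}\<close> by simp
    next
      case False
      have "real m * real (card (below I (Suc m) (\<lambda>l. l - 1)))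
          = (\<Sum>T\<in>Pow I. real m * real (card (below (I - T) m (\<lambda>l. l - 1))))"
        using card_below_Suc[OF Suc.prems, of "\<lambda>l. l - 1" m] True by (simp add: sum_distrib_left)
      also have "\<dots> = (\<Sum>T\<in>Pow I. (real m - real (k - card T)) * real m ^ (k - card T))"
      proof (rule sum.cong, simp)
        fix T assume T: "T \<in> Pow I"
        have "card (I - T) = k - card T" using T Suc.prems k_def
            by (auto intro!: card_Diff_subset finite_subset[of T I])
        then show "real m * real (card (below (I - T) m (\<lambda>l. l - 1)))
            = (real m - real (k - card T)) * real m ^ (k - card T)"
          using Suc.IH[of "I - T"] Suc.prems True k_def by (simp add: of_nat_diff)
      qed
      also have "\<dots> = (\<Sum>t\<le>k. of_nat (k choose t) * ((real m - real (k - t)) * real m ^ (k - t)))"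
        using sum_Pow_card[OF Suc.prems, of "\<lambda>t. (real m - real (k - t)) * real m ^ (k - t)"] k_def
            by simp
      finally have F: "real m * real (card (below I (Suc m) (\<lambda>l. l - 1)))
          = (\<Sum>t\<le>k. of_nat (k choose t) * ((real m - real (k - t)) * real m ^ (k - t)))" .
      have "real m * (real (Suc m) * real (card (below I (Suc m) (\<lambda>l. l - 1))))
          = (real m * real (card (below I (Suc m) (\<lambda>l. l - 1)))) * (real m + 1)" by simp
      also have "\<dots> = real m * ((real m + 1 - real k) * (real m + 1) ^ k)"
        unfolding F abel_sum by simp
      finally have "real m * (real (Suc m) * real (card (below I (Suc m) (\<lambda>l. l - 1))))
          = real m * ((real m + 1 - real k) * (real m + 1) ^ k)" .
      then show ?thesis using False True k_def by (simp add: of_nat_diff add_ac Suc_diff_le)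
    qed
  qed
qed

text \<open>At a cell \<open>l\<close> past \<open>a\<close>, the \<open>i\<close> elements of the
  prefix and at most \<open>l - a + j\<close> others have been placed, which is less than
  \<open>l\<close> because \<open>i + j < a\<close>. An excess \<open>j\<close> over the diagonal is
  absorbed by a prefix that lags behind it by more than \<open>j\<close>.\<close>

lemma card_below_prefix:
  assumes fin: "finite I" and T: "T \<subseteq> I" and i: "card T = i"
    and u: "u \<in> below T a (\<lambda>l. l - 1)" and g: "g \<in> below (I - T) m (\<lambda>l. l + j)"
    and a: "i + j < a"
  shows "(\<lambda>x. if x \<in> T then u x else if x \<in> I then g x + a else undefined) \<in> below I (a + m) (\<lambda>l. l
      - 1)"
proof -
  let ?f = "\<lambda>x. if x \<in> T then u x else if x \<in> I then g x + a else undefined"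
  have finT: "finite T" using T fin finite_subset by auto
  have gx: "1 \<le> g x \<and> g x \<le> m" if "x \<in> I - T" for x
    using g that by (auto simp: below_def dest!: PiE_mem[of _ _ _ x])
  have ux: "1 \<le> u x \<and> u x \<le> a" if "x \<in> T" for x
    using u that by (auto simp: below_def dest!: PiE_mem[of _ _ _ x])
  have "?f \<in> I \<rightarrow>\<^sub>E {1..a + m}"
    using gx ux T by (fastforce simp: PiE_def Pi_def extensional_def)
  moreover have "cum ?f I l \<le> l - 1" if l: "l \<in> {1..a + m}" for l
  proof (cases "l \<le> a")
    case True
    have "\<not> g x + a \<le> l" if "x \<in> I - T" for x using gx[OF that] True by auto
    then have "{x\<in>I. ?f x \<le> l} = {x\<in>T. u x \<le> l}" using T by auto
    then show ?thesis using u True l by (auto simp: below_def cum_def)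
  next
    case False
    have "{x\<in>I. ?f x \<le> l} \<subseteq> T \<union> {x\<in>I - T. g x \<le> l - a}" by auto
    then have "cum ?f I l \<le> card (T \<union> {x\<in>I - T. g x \<le> l - a})"
      unfolding cum_def using fin finT by (intro card_mono) auto
    also have "\<dots> \<le> i + cum g (I - T) (l - a)" unfolding cum_def using i card_Un_le by metis
    also have "\<dots> \<le> i + (l - a + j)"
    proof -
      have "l - a \<in> {1..m}" using False l by auto
      moreover have "\<forall>l\<in>{1..m}. cum g (I - T) l \<le> l + j" using g unfolding below_def by blast
      ultimately show ?thesis using add_left_mono bspec by blast
    qed
    finally show ?thesis using a False by linarith
  qed
  ultimately show ?thesis by (auto simp: below_def)
qed

text \<open>The split of a path is recovered from the set of elements in the first \<open>a\<close>
  cells, so distinct choices of prefix set, prefix and continuation give distinct strict paths.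
  \<open>Z\<close> and \<open>Y\<close> only stand for sets of the right cardinality.\<close>

lemma card_below_prefix_le:
  assumes fin: "finite I" "finite Y" and I: "card I = card Y + i"
      and Z: "finite Z" "card Z = i" and a: "i + j < a"
  shows "(card I choose i) * (card (below Z a (\<lambda>l. l - 1)) * card (below Y m (\<lambda>l. l + j)))
       \<le> card (below I (a + m) (\<lambda>l. l - 1))"
proof -
  let ?S = "SIGMA T:{T. T \<subseteq> I \<and> card T = i}. below T a (\<lambda>l. l - 1) \<times> below (I - T) m (\<lambda>l. l + j)"
  let ?h = "\<lambda>(T, u, g) x. if x \<in> T then u x else if x \<in> I then g x + a else undefined"
  have finT: "finite T" if "T \<subseteq> I" for T using that fin finite_subset by auto
  have "card ?S = (\<Sum>T\<in>{T. T \<subseteq> I \<and> card T = i}. card (below T a (\<lambda>l. l - 1) \<times> below (I - T) m (\<lambda>l. l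
      + j)))"
    using fin finT by (intro card_SigmaI) (auto intro!: finite_below)
  also have "\<dots> = (\<Sum>T\<in>{T. T \<subseteq> I \<and> card T = i}. card (below Z a (\<lambda>l. l - 1)) * card (below Y m (\<lambda>l. l
      + j)))"
  proof (rule sum.cong, simp)
    fix T assume T: "T \<in> {T. T \<subseteq> I \<and> card T = i}"
    have "card (I - T) = card Y" using T I finT[of T] card_Diff_subset[of T I] by auto
    then show "card (below T a (\<lambda>l. l - 1) \<times> below (I - T) m (\<lambda>l. l + j))
        = card (below Z a (\<lambda>l. l - 1)) * card (below Y m (\<lambda>l. l + j))"
      using card_below_eqpoll[of T Z a] card_below_eqpoll[of "I - T" Y m] T Z fin finT[of T]
      by (simp add: card_cartesian_product)
  qed
  also have "\<dots> = (card I choose i) * (card (below Z a (\<lambda>l. l - 1)) * card (below Y m (\<lambda>l. l + j)))"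
    using n_subsets[OF fin(1), of i] by simp
  finally have S: "card ?S = \<dots>" .
  have "card ?S \<le> card (below I (a + m) (\<lambda>l. l - 1))"
  proof (rule card_inj_on_le[where f = ?h])
    show "?h ` ?S \<subseteq> below I (a + m) (\<lambda>l. l - 1)"
    proof (rule image_subsetI)
      fix p assume "p \<in> ?S"
      then obtain T u g where "p = (T, u, g)" "T \<subseteq> I" "card T = i"
        "u \<in> below T a (\<lambda>l. l - 1)" "g \<in> below (I - T) m (\<lambda>l. l + j)" by auto
      then show "?h p \<in> below I (a + m) (\<lambda>l. l - 1)"
        using card_below_prefix[OF fin(1) _ _ _ _ a, of T u g m] by simp
    qed
    show "inj_on ?h ?S"
    proof (rule inj_onI)
      fix p p' assume "p \<in> ?S" "p' \<in> ?S" "?h p = ?h p'"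
      then obtain T u g T' u' g' where p: "p = (T, u, g)" "p' = (T', u', g')"
        and T: "T \<subseteq> I" and T': "T' \<subseteq> I"
        and u: "u \<in> below T a (\<lambda>l. l - 1)" and g: "g \<in> below (I - T) m (\<lambda>l. l + j)"
        and u': "u' \<in> below T' a (\<lambda>l. l - 1)" and g': "g' \<in> below (I - T') m (\<lambda>l. l + j)"
        and eq: "(\<lambda>x. if x \<in> T then u x else if x \<in> I then g x + a else undefined)
               = (\<lambda>x. if x \<in> T' then u' x else if x \<in> I then g' x + a else undefined)"
        by auto
      have ux: "u x \<le> a" if "x \<in> T" for x using u that
          by (auto simp: below_def dest!: PiE_mem[of _ _ _ x])
      have ux': "u' x \<le> a" if "x \<in> T'" for x using u' that
          by (auto simp: below_def dest!: PiE_mem[of _ _ _ x])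
      have gx: "1 \<le> g x" if "x \<in> I - T" for x using g that
          by (auto simp: below_def dest!: PiE_mem[of _ _ _ x])
      have gx': "1 \<le> g' x" if "x \<in> I - T'" for x using g' that
          by (auto simp: below_def dest!: PiE_mem[of _ _ _ x])
      have TT: "x \<in> T \<longleftrightarrow> x \<in> T'" if "x \<in> I" for x
        using fun_cong[OF eq, of x] ux[of x] ux'[of x] gx[of x] gx'[of x] that
            by (auto split: if_splits)
      then have TT: "T = T'" using T T' by auto
      have "u = u'" 
      proof (rule PiE_ext)
        show "u \<in> T \<rightarrow>\<^sub>E {1..a}" "u' \<in> T \<rightarrow>\<^sub>E {1..a}" using u u' TT by (auto simp: below_def)
        show "u x = u' x" if "x \<in> T" for x using fun_cong[OF eq, of x] that TT by auto
      qed
      moreover have "g = g'"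
      proof (rule PiE_ext)
        show "g \<in> (I - T) \<rightarrow>\<^sub>E {1..m}" "g' \<in> (I - T) \<rightarrow>\<^sub>E {1..m}" using g g' TT by (auto simp: below_def)
        show "g x = g' x" if "x \<in> I - T" for x using fun_cong[OF eq, of x] that TT by auto
      qed
      ultimately show "p = p'" using TT p by simp
    qed
  qed (use fin in \<open>auto intro!: finite_below\<close>)
  then show ?thesis using S by simp
qed

lemma below_cong:
  "(\<And>l. l \<in> {1..m} \<Longrightarrow> \<beta> l = \<beta>' l) \<Longrightarrow> below I m \<beta> = below I m \<beta>'"
  unfolding below_def by auto

section \<open>Factorials and Stirling's formula\<close>

lemma one_plus_inverse_powr_ge:
  assumes "n \<ge> (1::nat)"
  shows "1 \<le> (real n + 1/2) * ln (1 + 1 / real n)"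
proof -
  \<comment> \<open>With \<open>x = 1/n\<close> the claim reads
    \<open>(2 + x) * ln (1 + x) >= 2 * x\<close>, and both sides vanish at \<open>0\<close>.\<close>
  define g where "g = (\<lambda>x::real. (2 + x) * ln (1 + x) - 2 * x)"
  have "g 0 \<le> g (1 / real n)"
  proof (rule DERIV_nonneg_imp_nondecreasing[of 0 "1 / real n" g])
    show "0 \<le> 1 / real n" by simp
    fix x :: real assume x: "0 \<le> x" "x \<le> 1 / real n"
    have "(g has_real_derivative (ln (1 + x) + (2 + x) / (1 + x) - 2)) (at x)"
      unfolding g_def using x by (auto intro!: derivative_eq_intros)
    moreover have "0 \<le> ln (1 + x) + (2 + x) / (1 + x) - 2"
    proof -
      have "ln (1 / (1 + x)) \<le> 1 / (1 + x) - 1" using x by (intro ln_le_minus_one) auto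
      then have "ln (1 + x) \<ge> 1 - 1 / (1 + x)" using x by (simp add: ln_div)
      moreover have "(2 + x) / (1 + x) = 1 + 1 / (1 + x)" using x by (simp add: field_simps)
      ultimately show ?thesis by linarith
    qed
    ultimately show "\<exists>y. (g has_real_derivative y) (at x) \<and> 0 \<le> y" by blast
  qed
  then have "0 \<le> (2 + 1 / real n) * ln (1 + 1 / real n) - 2 * (1 / real n)" by (simp add: g_def)
  then have "0 \<le> real n * ((2 + 1 / real n) * ln (1 + 1 / real n) - 2 * (1 / real n))" by simp
  also have "\<dots> = 2 * ((real n + 1/2) * ln (1 + 1 / real n) - 1)" using assms by (simp add: field_simps)
  finally show ?thesis by simp
qed

text \<open>The quotient of the two sides is monotone in \<open>n\<close>; after taking logarithms
  this is \<open>one_plus_inverse_powr_ge\<close>. Equality at \<open>n = 1\<close> fixes the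
  constant \<open>e\<close>.\<close>

lemma fact_le_stirling:
  assumes "n \<ge> (1::nat)"
  shows "fact n * exp (real n) \<le> exp 1 * real n ^ n * sqrt (real n)"
  using assms
proof (induction n rule: dec_induct)
  case base then show ?case by simp
next
  case (step n)
  have n: "real n > 0" using step by simp
  have "exp 1 * (real n ^ n * sqrt (real n)) \<le> real (Suc n) ^ n * sqrt (real (Suc n))"
  proof -
    have "exp 1 * (real n ^ n * sqrt (real n)) = exp (1 + (real n + 1/2) * ln (real n))"
      using n by (simp add: exp_add distrib_right exp_of_nat_mult powr_half_sqrt[symmetric] powr_def)
    also have "\<dots> \<le> exp ((real n + 1/2) * ln (real (Suc n)))"
    proof -
      have "ln (1 + 1 / real n) = ln (real (Suc n)) - ln (real n)"
      proof -
        have "1 + 1 / real n = real (Suc n) / real n" using n by (simp add: field_simps)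
        then show ?thesis using n by (simp only: ln_div) (simp add: ln_div)
      qed
      then have e: "ln (real (Suc n)) = ln (real n) + ln (1 + 1 / real n)" by simp
      have "1 \<le> (real n + 1/2) * ln (1 + 1 / real n)" using step
          by (intro one_plus_inverse_powr_ge) auto
      then show ?thesis unfolding e exp_le_cancel_iff by (simp add: distrib_left)
    qed
    also have "\<dots> = real (Suc n) ^ n * sqrt (real (Suc n))"
      by (simp add: exp_add distrib_right exp_of_nat_mult powr_half_sqrt[symmetric] powr_def)
    finally show ?thesis .
  qed
  then have le: "real n ^ n * sqrt (real n) * exp 1 \<le> real (Suc n) ^ n * sqrt (real (Suc n))"
    by (simp add: mult_ac)
  have "fact (Suc n) * exp (real (Suc n)) = real (Suc n) * exp 1 * (fact n * exp (real n))"
    by (simp add: exp_add algebra_simps)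
  also have "\<dots> \<le> real (Suc n) * exp 1 * (exp 1 * real n ^ n * sqrt (real n))"
    using step.IH by (intro mult_left_mono) auto
  also have "\<dots> = real (Suc n) * exp 1 * (real n ^ n * sqrt (real n) * exp 1)" by simp
  also have "\<dots> \<le> real (Suc n) * exp 1 * (real (Suc n) ^ n * sqrt (real (Suc n)))"
    using le by (intro mult_left_mono) auto
  finally show ?case by (simp add: mult_ac)
qed

lemma power_le_fact_binomial: "real J ^ i \<le> fact i * real (J + i choose i)"
proof (induction i)
  case (Suc i)
  have e: "real (Suc i) * real (J + Suc i choose Suc i) = real (Suc (J + i)) * real (J + i choose i)"
    using Suc_times_binomial[of i "J + i"] by (metis add_Suc_right of_nat_mult)
  have "real J ^ Suc i \<le> real (Suc (J + i)) * (fact i * real (J + i choose i))"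
    unfolding power_Suc by (intro mult_mono Suc.IH) auto
  also have "\<dots> = fact i * (real (Suc i) * real (J + Suc i choose Suc i))" unfolding e by simp
  finally show ?case by (simp add: mult_ac)
qed simp

text \<open>Compares \<open>i!\<close> with \<open>((2 * i + 1) / (2 * e))^i\<close>, so that the
  power of \<open>2 * i + 1\<close> produced by a prefix of \<open>2 * i + 1\<close> cells cancels.
  The crude factor \<open>i + 1\<close> in place of \<open>sqrt i\<close> also covers
  \<open>i = 0\<close>.\<close>

lemma fact_le_half_power:
  "fact i * exp (real i) * 2 ^ i \<le> exp 1 * (real i + 1) * real (2 * i + 1) ^ i"
proof (cases "i = 0")
  case True then show ?thesis by simp
next
  case False
  have "fact i * exp (real i) \<le> exp 1 * real i ^ i * sqrt (real i)"
    using False by (intro fact_le_stirling) auto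
  also have "\<dots> \<le> exp 1 * real i ^ i * (real i + 1)"
  proof -
    have "sqrt (real i) \<le> real i + 1"
      by (rule real_le_lsqrt) (auto simp: power2_eq_square algebra_simps)
    then show ?thesis by (intro mult_left_mono) auto
  qed
  finally have "fact i * exp (real i) * 2 ^ i \<le> exp 1 * real i ^ i * (real i + 1) * 2 ^ i"
    by (intro mult_right_mono) auto
  also have "\<dots> = exp 1 * (real i + 1) * (2 * real i) ^ i" by (simp add: power_mult_distrib)
  also have "\<dots> \<le> exp 1 * (real i + 1) * real (2 * i + 1) ^ i"
    by (intro mult_left_mono power_mono) auto
  finally show ?thesis .
qed

text \<open>A path with barrier \<open>l + i\<close>, preceded by a strict path of \<open>2 i + 1\<close> cells holding \<open>i\<close> elements, is a
  strict path, and those are counted exactly. An empty prefix would lose a factor \<open>exp i\<close>, and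
  \<open>exp i / 2 ^ i\<close> is not summable.\<close>

lemma card_below_shift_le:
  assumes J: "J \<ge> 1"
  shows "real (card (below {..<J} J (\<lambda>l. l + i))) / 2 ^ i
           \<le> real J ^ (J - 1) * (54 * (real i + 1)\<^sup>2 * (5/6) ^ i)"
proof (cases "20 * i \<le> J")
  case False
  have "card (below {..<J} J (\<lambda>l. l + i)) \<le> card ({..<J} \<rightarrow>\<^sub>E {1..J})"
    unfolding below_def by (intro card_mono) (auto intro: finite_PiE)
  then have "card (below {..<J} J (\<lambda>l. l + i)) \<le> J ^ J" by (simp add: card_PiE)
  then have "real (card (below {..<J} J (\<lambda>l. l + i))) \<le> real J ^ J"
      by (metis of_nat_le_iff of_nat_power)
  also have "\<dots> = real J ^ (J - 1) * real J" using J by (cases J) auto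
  also have "\<dots> \<le> real J ^ (J - 1) * (20 * real i)" using False by (intro mult_left_mono) auto
  finally have "real (card (below {..<J} J (\<lambda>l. l + i))) / 2 ^ i
      \<le> real J ^ (J - 1) * (20 * real i) / 2 ^ i"
    by (intro divide_right_mono) auto
  also have "\<dots> = real J ^ (J - 1) * (20 * real i * (1/2) ^ i)" by (simp add: power_divide)
  also have "\<dots> \<le> real J ^ (J - 1) * (54 * (real i + 1)\<^sup>2 * (5/6) ^ i)"
  proof -
    have a: "20 * real i \<le> 54 * (real i + 1)\<^sup>2" by (simp add: power2_eq_square algebra_simps)
    have b: "(1/2 :: real) ^ i \<le> (5/6) ^ i" by (intro power_mono) auto
    have "20 * real i * (1/2) ^ i \<le> 54 * (real i + 1)\<^sup>2 * (5/6) ^ i"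
      by (rule mult_mono[OF a b]) auto
    then show ?thesis by (intro mult_left_mono) auto
  qed
  finally show ?thesis .
next
  case True
  define A where "A = real (card (below {..<J} J (\<lambda>l. l + i)))"
  define T where "T = real J + 2 * real i + 1"
  define m where "m = 2 * i + 1"
  have Jp: "real J > 0" and Tp: "T > 0" and mp: "real m > 0" using J by (auto simp: T_def m_def)
  define b1 where "b1 = real (card (below {..<i} m (\<lambda>l. l - 1)))"
  define b2 where "b2 = real (card (below {..<J+i} (m + J) (\<lambda>l. l - 1)))"
  have b1: "real m * b1 = (real i + 1) * real m ^ i"
    using card_below_strict[of "{..<i}" m] unfolding b1_def m_def by (simp add: add_ac)
  have b2: "T * b2 = (real i + 1) * T ^ (J + i)"
  proof -
    have "real (m + J) = T" "real (m + J - (J + i)) = real i + 1" by (simp_all add: m_def T_def)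
    then show ?thesis using card_below_strict[of "{..<J+i}" "m + J"] unfolding b2_def by simp
  qed
  have "real (J + i choose i) * (b1 * A) \<le> b2"
  proof -
    have "(card {..<J+i} choose i) * (card (below {..<i} m (\<lambda>l. l - 1)) * card (below {..<J} J (\<lambda>l. l
        + i)))
      \<le> card (below {..<J+i} (m + J) (\<lambda>l. l - 1))"
      by (rule card_below_prefix_le) (auto simp: m_def)
    then show ?thesis unfolding A_def b1_def b2_def by (simp flip: of_nat_mult)
  qed
  then have "T * real m * (real (J + i choose i) * (b1 * A)) \<le> T * real m * b2"
    using Tp mp by (intro mult_left_mono) auto
  then have "(real m * b1) * (real (J + i choose i) * A * T) \<le> real m * (T * b2)" by (simp add: mult_ac)
  then have "(real i + 1) * (real m ^ i * (real (J + i choose i) * A * T))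
      \<le> (real i + 1) * (real m * T ^ (J + i))"
    unfolding b1 b2 by (simp add: mult_ac)
  then have 1: "real m ^ i * (real (J + i choose i) * A * T) \<le> real m * T ^ (J + i)"
    by (simp add: mult_le_cancel_left)
  have Ap: "A \<ge> 0" by (simp add: A_def)
  have "real J ^ i * (real m ^ i * A * T) \<le> fact i * real (J + i choose i) * (real m ^ i * A * T)"
    using power_le_fact_binomial[of J i] Ap Tp by (intro mult_right_mono) auto
  also have "\<dots> \<le> fact i * (real m * T ^ (J + i))" using 1 by (simp add: mult_ac)
  also have "\<dots> = T * (fact i * real m * T ^ (J + i - 1))"
    using J by (cases "J + i") (auto simp: mult_ac)
  finally have "real J ^ i * real m ^ i * A \<le> fact i * real m * T ^ (J + i - 1)"
    using Tp by (simp add: mult_ac mult_le_cancel_left_pos)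
  \<comment> \<open>Here \<open>T = J * (1 + (2 * i + 1) / J)\<close>, and
    \<open>J + i - 1 <= J * (1 + 1/20)\<close> by the case assumption.\<close>
  moreover have "T ^ (J + i - 1) \<le> real J ^ (J - 1) * real J ^ i * exp (2 * real i + 1 + (2 * real i
      + 1) / 20)"
  proof -
    have "T ^ (J + i - 1) = real J ^ (J + i - 1) * (1 + (2 * real i + 1) / real J) ^ (J + i - 1)"
    proof -
      have "T = real J * (1 + (2 * real i + 1) / real J)" unfolding T_def using Jp
          by (simp add: field_simps)
      then show ?thesis by (metis power_mult_distrib)
    qed
    also have "\<dots> \<le> real J ^ (J + i - 1) * exp ((2 * real i + 1) / real J) ^ (J + i - 1)"
      by (intro mult_left_mono power_mono exp_ge_add_one_self) (auto)
    also have "\<dots> \<le> real J ^ (J + i - 1) * exp (2 * real i + 1 + (2 * real i + 1) / 20)"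
    proof -
    have "exp ((2 * real i + 1) / real J) ^ (J + i - 1)
        = exp (real (J + i - 1) * ((2 * real i + 1) / real J))"
      by (simp only: exp_of_nat_mult)
    also have "\<dots> \<le> exp (2 * real i + 1 + (2 * real i + 1) / 20)"
    proof -
      have "real (J + i - 1) * ((2 * real i + 1) / real J)
          \<le> (real J + real J / 20) * ((2 * real i + 1) / real J)"
        using True by (intro mult_right_mono) auto
      also have "\<dots> = 2 * real i + 1 + (2 * real i + 1) / 20" using Jp by (simp add: field_simps)
      finally show ?thesis by simp
    qed
    finally show ?thesis by (intro mult_left_mono) auto
    qed
    also have "real J ^ (J + i - 1) = real J ^ (J - 1) * real J ^ i"
      using J by (simp flip: power_add)
    finally show ?thesis by simp
  qed
  ultimately have "real J ^ i * real m ^ i * A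
      \<le> fact i * real m * (real J ^ (J - 1) * real J ^ i * exp (2 * real i + 1 + (2 * real i
      + 1) / 20))"
    by (smt (verit) fact_ge_zero mult_left_mono of_nat_0_le_iff zero_le_mult_iff)
  then have "real J ^ i * (real m ^ i * A)
      \<le> real J ^ i * (fact i * real m * real J ^ (J - 1) * exp (2 * real i + 1 + (2 * real i
      + 1) / 20))"
    by (simp add: mult_ac)
  then have "real m ^ i * A \<le> fact i * real m * real J ^ (J - 1) * exp (2 * real i + 1 + (2 * real i
      + 1) / 20)"
    using Jp by (simp add: mult_le_cancel_left_pos)
  then have "exp (real i) * 2 ^ i * (real m ^ i * A)
      \<le> exp (real i) * 2 ^ i * (fact i * real m * real J ^ (J - 1) * exp (2 * real i + 1 + (2
      * real i + 1) / 20))"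
    by (intro mult_left_mono) auto
  also have "\<dots> = (fact i * exp (real i) * 2 ^ i) * (real m * real J ^ (J - 1) * exp (2 * real i + 1
      + (2 * real i + 1) / 20))"
    by (simp add: mult_ac)
  also have "\<dots> \<le> (exp 1 * (real i + 1) * real m ^ i) * (real m * real J ^ (J - 1) * exp (2 * real i
      + 1 + (2 * real i + 1) / 20))"
    using fact_le_half_power[of i] unfolding m_def by (intro mult_right_mono) auto
  finally have "real m ^ i * (exp (real i) * 2 ^ i * A) \<le>
     real m ^ i * (exp 1 * (real i + 1) * (real m * real J ^ (J - 1) * exp (2 * real i + 1 + (2
         * real i + 1) / 20)))"
    by (simp add: mult_ac)
  then have "exp (real i) * 2 ^ i * A \<le> exp 1 * (real i + 1) * (real m * real J ^ (J - 1) * exp (2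
      * real i + 1 + (2 * real i + 1) / 20))"
    using mp by (simp add: mult_le_cancel_left_pos)
  \<comment> \<open>One \<open>exp i\<close> cancels against the one gained from
    \<open>fact_le_half_power\<close>, so of the exponent \<open>2 * i + i / 10\<close> there
    remains \<open>i * 11/10\<close>. Since \<open>exp (11/10) <= 10/3 < 4\<close>, the final ratio
    \<open>5/6 = (10/3) / 4\<close> is less than \<open>1\<close>.\<close>
  also have "\<dots> = (real i + 1) * real m * real J ^ (J - 1) * (exp 1 * exp (2 * real i + 1 + (2
      * real i + 1) / 20))"
    by (simp add: mult_ac)
  also have "exp 1 * exp (2 * real i + 1 + (2 * real i + 1) / 20)
      = exp (real i) * (exp (41/20) * exp (real i * (11/10)))"
    by (simp flip: exp_add) (simp add: field_simps)
  finally have "exp (real i) * (2 ^ i * A)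
      \<le> exp (real i) * ((real i + 1) * real m * real J ^ (J - 1) * (exp (41/20) * exp (real i
      * (11/10))))"
    by (simp add: mult_ac)
  then have "2 ^ i * A \<le> (real i + 1) * real m * real J ^ (J - 1) * (exp (41/20) * exp (real i
      * (11/10)))"
    by simp
  also have "\<dots> \<le> (real i + 1) * (2 * (real i + 1)) * real J ^ (J - 1) * (27 * (10/3) ^ i)"
  proof (intro mult_mono)
    have "exp (41/20) \<le> exp (real 3 * 1)" by simp
    also have "\<dots> \<le> (3::real) ^ 3" unfolding exp_of_nat_mult by (intro power_mono exp_le) auto
    finally show "exp (41/20) \<le> (27::real)" by simp
    have "exp (1/10) \<le> (10/9::real)"
    proof -
      have "1 + (-1/10) \<le> exp (-1/10::real)" by (rule exp_ge_add_one_self)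
      then have "9/10 \<le> inverse (exp (1/10::real))" by (simp add: exp_minus)
      then show ?thesis by (simp add: field_simps)
    qed
    then have "exp 1 * exp (1/10) \<le> 3 * (10/9::real)" using exp_le by (intro mult_mono) auto
    then have "exp (11/10) \<le> (10/3::real)" by (simp flip: exp_add)
    then show "exp (real i * (11/10)) \<le> (10/3) ^ i" unfolding exp_of_nat_mult by (intro power_mono) auto
  qed (auto simp: m_def)
  finally have "2 ^ i * A \<le> real J ^ (J - 1) * (54 * (real i + 1)\<^sup>2 * (10/3) ^ i)"
    by (simp add: power2_eq_square algebra_simps)
  then have "2 ^ i * A / 4 ^ i \<le> real J ^ (J - 1) * (54 * (real i + 1)\<^sup>2 * (10/3) ^ i) / 4 ^ i"
    by (intro divide_right_mono) auto
  moreover have "2 ^ i * A / 4 ^ i = A / 2 ^ i"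
  proof -
    have "(4::real) ^ i = 2 ^ i * 2 ^ i" by (simp flip: power_mult_distrib)
    then show ?thesis by simp
  qed
  moreover have "(10/3::real) ^ i / 4 ^ i = (5/6) ^ i" by (simp flip: power_divide)
  ultimately show ?thesis unfolding A_def[symmetric]
      by (metis (no_types, lifting) times_divide_eq_right)
qed

lemma sum_card_below_shift_le:
  "\<exists>K>0. \<forall>J\<ge>1. (\<Sum>i\<le>J. real (card (below {..<J} J (\<lambda>l. l + i))) / 2 ^ i) \<le> K * real J ^ (J - 1)"
proof -
  define u where "u = (\<lambda>i::nat. 54 * (real i + 1)\<^sup>2 * (5/6) ^ i :: real)"
  have pos: "u i > 0" for i by (simp add: u_def)
  have sm: "summable u"
  proof (rule summable_ratio_test[where c = "14/15" and N = 20])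
    fix n :: nat assume n: "n \<ge> 20"
    have "20 * (real n + 2) \<le> 21 * (real n + 1)" using n by simp
    then have "(20 * (real n + 2))\<^sup>2 \<le> (21 * (real n + 1))\<^sup>2" by (intro power_mono) auto
    then have "400 * (real n + 2)\<^sup>2 \<le> 441 * (real n + 1)\<^sup>2" unfolding power_mult_distrib by simp
    then have "5/6 * (real n + 2)\<^sup>2 \<le> 14/15 * (real n + 1)\<^sup>2" 
      using zero_le_power2[of "real n + 1"] by linarith
    then have "54 * (5/6) ^ n * (5/6 * (real n + 2)\<^sup>2) \<le> 54 * (5/6) ^ n * (14/15 * (real n + 1)\<^sup>2)"
      by (intro mult_left_mono) auto
    then have "u (Suc n) \<le> 14/15 * u n" unfolding u_def by (simp add: mult_ac add_ac)
    then show "norm (u (Suc n)) \<le> 14/15 * norm (u n)" using pos[of n] pos[of "Suc n"] by simp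
  qed simp
  show ?thesis
  proof (intro exI[of _ "suminf u"] conjI allI impI)
    show "suminf u > 0" using sm pos by (rule suminf_pos)
    fix J :: nat assume J: "J \<ge> 1"
    have "(\<Sum>i\<le>J. real (card (below {..<J} J (\<lambda>l. l + i))) / 2 ^ i) \<le> (\<Sum>i\<le>J. real J ^ (J - 1) * u i)"
      unfolding u_def using card_below_shift_le[OF J] by (intro sum_mono) auto
    also have "\<dots> = real J ^ (J - 1) * (\<Sum>i\<le>J. u i)" by (simp add: sum_distrib_left)
    also have "\<dots> \<le> real J ^ (J - 1) * suminf u"
      using sum_le_suminf[OF sm, of "{..J}"] pos by (intro mult_left_mono) (auto intro: less_imp_le)
    finally show "(\<Sum>i\<le>J. real (card (below {..<J} J (\<lambda>l. l + i))) / 2 ^ i)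
        \<le> suminf u * real J ^ (J - 1)"
      by (simp add: mult_ac)
  qed
qed

text \<open>The value \<open>J\<close> at the last cell removes the barrier there: all
  \<open>J\<close> elements lie in \<open>J\<close> cells, so strictness can be required only before
  the end. A bridge is on the diagonal at both ends and strictly below it in between.\<close>

definition bridges :: "nat \<Rightarrow> (nat \<Rightarrow> nat) set" where
  "bridges J = below {..<J} J (\<lambda>l. if l < J then l - 1 else J)"

lemma finite_bridges: "finite (bridges J)"
  unfolding bridges_def by (rule finite_below) simp

lemma bridges_range: "f \<in> bridges J \<Longrightarrow> x < J \<Longrightarrow> 1 \<le> f x \<and> f x \<le> J"
  unfolding bridges_def below_def by (auto dest!: PiE_mem[of _ _ _ x])

lemma bridges_cum_less: "f \<in> bridges J \<Longrightarrow> 1 \<le> l \<Longrightarrow> l < J \<Longrightarrow> cum f {..<J} l < l"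
proof -
  assume f: "f \<in> bridges J" and l: "1 \<le> l" "l < J"
  have "\<forall>l\<in>{1..J}. cum f {..<J} l \<le> (if l < J then l - 1 else J)"
    using f unfolding bridges_def below_def by blast
  from this[THEN bspec, of l] l show ?thesis by auto
qed

lemma bridges_cum_top:
  assumes "f \<in> bridges J" "J \<le> l"
  shows "cum f {..<J} l = J"
proof -
  have "{x \<in> {..<J}. f x \<le> l} = {..<J}" using bridges_range[OF assms(1)] assms(2) by fastforce
  then show ?thesis by (simp add: cum_def)
qed

lemma bridges_cum_le: "f \<in> bridges J \<Longrightarrow> cum f {..<J} l \<le> l"
proof -
  assume f: "f \<in> bridges J"
  consider "l = 0" | "1 \<le> l" "l < J" | "J \<le> l" by linarith
  then show ?thesis
  proof cases
    case 1
    have "{x \<in> {..<J}. f x \<le> 0} = {}" using bridges_range[OF f] by fastforce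
    then show ?thesis using 1 by (simp add: cum_def)
  next
    case 2 then show ?thesis using bridges_cum_less[OF f] by (simp add: less_imp_le)
  next
    case 3 then show ?thesis using bridges_cum_top[OF f] by simp
  qed
qed

text \<open>At most \<open>J - 2\<close> elements lie in the first \<open>J - 1\<close> cells, so
  the last cell holds at least two. Those bridges with exactly two there leave strict paths of
  \<open>J - 2\<close> elements in \<open>m = J - 1\<close> cells, which are counted exactly; the
  result \<open>J * m^(J - 2) / 2\<close> is within a factor \<open>e <= 3\<close> of
  \<open>J^(J - 1) / 2\<close>.\<close>

lemma card_bridges_ge:
  assumes J: "J \<ge> 2"
  shows "real J ^ (J - 1) \<le> 6 * real (card (bridges J))"
proof -
  define I where "I = {..<J}"
  have I: "finite I" "card I = J" by (auto simp: I_def)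
  obtain m where m: "J = Suc m" "m \<ge> 1" using J by (cases J) auto
  define N where "N = real (card (below {..<J-2} m (\<lambda>l. l - 1)))"
  have N: "real m * N = real m ^ (J - 2)"
    using card_below_strict[of "{..<J-2}" m] m unfolding N_def by simp
  have "bridges J = below I (Suc m) (\<lambda>l. if l < J then l - 1 else J)"
    unfolding bridges_def I_def m(1)[symmetric] ..
  then have "card (bridges J) = (\<Sum>T\<in>Pow I. card (below (I - T) m (\<lambda>l. if l < J then l - 1 else J)))"
    using card_below_Suc[OF I(1), of "\<lambda>l. if l < J then l - 1 else J" m] I m by simp
  also have "\<dots> \<ge> (\<Sum>T\<in>{T. T \<subseteq> I \<and> card T = 2}. card (below (I - T) m (\<lambda>l. if l < J then l - 1 else J)))"
    using I by (intro sum_mono2) auto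
  also have "(\<Sum>T\<in>{T. T \<subseteq> I \<and> card T = 2}. card (below (I - T) m (\<lambda>l. if l < J then l - 1 else J)))
      = (\<Sum>T\<in>{T. T \<subseteq> I \<and> card T = 2}. card (below {..<J-2} m (\<lambda>l. l - 1)))"
  proof (rule sum.cong, simp)
    fix T assume T: "T \<in> {T. T \<subseteq> I \<and> card T = 2}"
    then have "card (I - T) = J - 2" using I finite_subset[of T I] by (auto simp: card_Diff_subset)
    moreover have "below (I - T) m (\<lambda>l. if l < J then l - 1 else J) = below (I - T) m (\<lambda>l. l - 1)"
      using m by (intro below_cong) auto
    ultimately show "card (below (I - T) m (\<lambda>l. if l < J then l - 1 else J))
        = card (below {..<J-2} m (\<lambda>l. l - 1))"
      using I by (auto intro!: card_below_eqpoll)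
  qed
  also have "\<dots> = (J choose 2) * card (below {..<J-2} m (\<lambda>l. l - 1))"
    using n_subsets[OF I(1), of 2] I by simp
  finally have "real ((J choose 2) * card (below {..<J-2} m (\<lambda>l. l - 1))) \<le> real (card (bridges J))"
    by (simp only: of_nat_le_iff)
  then have "real (J choose 2) * N \<le> real (card (bridges J))" by (simp add: N_def)
  moreover have "real (J choose 2) * N = real J / 2 * real m ^ (J - 2)"
  proof -
    have "2 * (J choose 2) = J * m" using m by (simp add: choose_two)
    then have "2 * real (J choose 2) = real J * real m" by (metis of_nat_mult of_nat_numeral)
    then have "2 * real (J choose 2) * N = real J * (real m * N)" by (simp add: mult_ac)
    then show ?thesis unfolding N by simp
  qed
  moreover have "real J ^ (J - 2) \<le> 3 * real m ^ (J - 2)"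
  proof -
    have mp: "real m > 0" using m by simp
    have "real J ^ (J - 2) = real m ^ (J - 2) * (1 + 1 / real m) ^ (J - 2)"
    proof -
      have "real J = real m * (1 + 1 / real m)" using m by (simp add: field_simps)
      then show ?thesis by (metis power_mult_distrib)
    qed
    also have "\<dots> \<le> real m ^ (J - 2) * exp (1 / real m) ^ (J - 2)"
      by (intro mult_left_mono power_mono exp_ge_add_one_self) auto
    also have "\<dots> \<le> real m ^ (J - 2) * exp (1 / real m) ^ m"
      using m by (intro mult_left_mono power_increasing) auto
    also have "exp (1 / real m) ^ m = exp 1" using mp by (simp flip: exp_of_nat_mult)
    also have "real m ^ (J - 2) * exp 1 \<le> real m ^ (J - 2) * 3" by (intro mult_left_mono exp_le) auto
    finally show ?thesis by (simp add: mult_ac)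
  qed
  moreover have "real J ^ (J - 1) = real J * real J ^ (J - 2)"
  proof -
    have "J - 1 = Suc (J - 2)" using J by simp
    then show ?thesis by simp
  qed
  ultimately have "real J ^ (J - 1) \<le> real J * (3 * real m ^ (J - 2))" by (simp add: mult_left_mono)
  also have "\<dots> = 6 * (real J / 2 * real m ^ (J - 2))" by simp
  also have "\<dots> \<le> 6 * real (card (bridges J))"
    using \<open>real (J choose 2) * N \<le> real (card (bridges J))\<close> \<open>real (J choose 2) * N
        = real J / 2 * real m ^ (J - 2)\<close> by simp
  finally show ?thesis .
qed

text \<open>Controls the total degree, which is governed by the sum of \<open>2^(f x)\<close>.
  Deleting \<open>x\<close> from a bridge with \<open>f x = v\<close> leaves a path that is strict
  at the last cell too, and of these there are \<open>J^(J - 1) / J\<close> whatever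
  \<open>v\<close> is.\<close>

lemma sum_bridges_end:
  assumes J: "J \<ge> 1"
  shows "(\<Sum>f\<in>bridges J. \<Sum>x<J. 2 ^ f x / 2 ^ J :: real) \<le> 2 * real J ^ (J - 1)"
proof -
  define I where "I = {..<J}"
  have cnt: "real J * real (card {f \<in> bridges J. f x = v}) \<le> real J ^ (J - 1)" if x: "x < J" for x v
  proof -
    have "card {f \<in> bridges J. f x = v} \<le> card (below (I - {x}) J (\<lambda>l. l - 1))"
    proof (rule card_inj_on_le[where f = "\<lambda>f. restrict f (I - {x})"])
      show "inj_on (\<lambda>f. restrict f (I - {x})) {f \<in> bridges J. f x = v}"
      proof (rule inj_onI)
        fix f g assume f: "f \<in> {f \<in> bridges J. f x = v}" and g: "g \<in> {f \<in> bridges J. f x = v}"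
          and eq: "restrict f (I - {x}) = restrict g (I - {x})"
        have "f y = g y" if "y \<in> I" for y
          using fun_cong[OF eq, of y] f g that by (cases "y = x") auto
        then show "f = g" using f g unfolding bridges_def below_def I_def
          by (auto intro: PiE_ext)
      qed
      show "(\<lambda>f. restrict f (I - {x})) ` {f \<in> bridges J. f x = v} \<subseteq> below (I - {x}) J (\<lambda>l. l - 1)"
      proof (rule image_subsetI)
        fix f assume "f \<in> {f \<in> bridges J. f x = v}"
        then have f: "f \<in> bridges J" by simp
        have "restrict f (I - {x}) \<in> (I - {x}) \<rightarrow>\<^sub>E {1..J}"
          using bridges_range[OF f] by (auto simp: I_def)
        moreover have "cum (restrict f (I - {x})) (I - {x}) l \<le> l - 1" if l: "l \<in> {1..J}" for l
        proof (cases "l < J")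
          case True
          have "cum (restrict f (I - {x})) (I - {x}) l \<le> cum f I l"
            unfolding cum_def by (intro card_mono) (auto simp: I_def)
          then show ?thesis using bridges_cum_less[OF f _ True] l by (auto simp: I_def)
        next
          case False
          have "cum (restrict f (I - {x})) (I - {x}) l \<le> card (I - {x})"
            unfolding cum_def by (intro card_mono) (auto simp: I_def)
          also have "\<dots> = J - 1" using x by (simp add: I_def)
          finally show ?thesis using False l by auto
        qed
        ultimately show "restrict f (I - {x}) \<in> below (I - {x}) J (\<lambda>l. l - 1)"
          by (auto simp: below_def)
      qed
    qed (auto intro: finite_below simp: I_def)
    then have "real J * real (card {f \<in> bridges J. f x = v})
        \<le> real J * real (card (below (I - {x}) J (\<lambda>l. l - 1)))"
      by (intro mult_left_mono) auto
    also have "\<dots> = real J ^ (J - 1)"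
    proof -
      have "card (I - {x}) = J - 1" "finite (I - {x})" using x by (simp_all add: I_def)
      then show ?thesis using card_below_strict[of "I - {x}" J] J by simp
    qed
    finally show ?thesis .
  qed
  have "(\<Sum>f\<in>bridges J. \<Sum>x<J. 2 ^ f x / 2 ^ J :: real) = (\<Sum>x<J. \<Sum>f\<in>bridges J. 2 ^ f x / 2 ^ J)"
    by (rule sum.swap)
  also have "\<dots> = (\<Sum>x<J. \<Sum>v\<in>{1..J}. \<Sum>f\<in>{f\<in>bridges J. f x = v}. 2 ^ f x / 2 ^ J)"
    using bridges_range finite_bridges by (intro sum.cong refl sum.group[symmetric]) (auto)
  also have "\<dots> = (\<Sum>x<J. \<Sum>v\<in>{1..J}. real (card {f\<in>bridges J. f x = v}) * (2 ^ v / 2 ^ J))"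
    by (intro sum.cong refl) simp
  also have "\<dots> \<le> (\<Sum>x<J. \<Sum>v\<in>{1..J}. real J ^ (J - 1) / real J * (2 ^ v / 2 ^ J))"
    using cnt J by (intro sum_mono mult_right_mono) (auto simp: field_simps)
  also have "\<dots> = real J ^ (J - 1) * (\<Sum>v\<in>{1..J}. 2 ^ v / 2 ^ J)"
    using J by (simp add: sum_distrib_left)
  also have "(\<Sum>v\<in>{1..J}. 2 ^ v / 2 ^ J :: real) \<le> 2"
  proof -
    have "(\<Sum>v\<in>{1..J}. 2 ^ v :: real) = 2 * 2 ^ J - 2" by (induction J) (auto simp: algebra_simps)
    then show ?thesis by (simp flip: sum_divide_distrib add: field_simps)
  qed
  then have "real J ^ (J - 1) * (\<Sum>v\<in>{1..J}. 2 ^ v / 2 ^ J) \<le> real J ^ (J - 1) * 2"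
    by (intro mult_left_mono) auto
  finally show ?thesis by simp
qed

text \<open>Rotating a bridge by \<open>h\<close> cells puts its peak at the cut. The barrier of \<^term>\<open>bridges\<close> is strict, so the
  peak is unique and \<open>h\<close> can be recovered.\<close>

definition rotate_cells :: "nat \<Rightarrow> nat \<Rightarrow> (nat \<Rightarrow> nat) \<Rightarrow> nat \<Rightarrow> nat" where
  "rotate_cells J h f = restrict (\<lambda>x. if f x > h then f x - h else f x + J - h) {..<J}"

lemma cum_rotate_cells:
  assumes f: "f \<in> bridges J" and h: "h \<in> {1..J}" and l: "l \<in> {1..J}"
  shows "cum (rotate_cells J h f) {..<J} l
       = (if h + l \<le> J then cum f {..<J} (h + l) - cum f {..<J} h
          else J - cum f {..<J} h + cum f {..<J} (h + l - J))"
proof -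
  let ?I = "{..<J}"
  note rg = bridges_range[OF f]
  show ?thesis
  proof (cases "h + l \<le> J")
    case True
    have "{x\<in>?I. rotate_cells J h f x \<le> l} = {x\<in>?I. f x \<le> h + l} - {x\<in>?I. f x \<le> h}"
    proof (rule Set.set_eqI)
      fix x
      show "x \<in> {x\<in>?I. rotate_cells J h f x \<le> l} \<longleftrightarrow> x \<in> {x\<in>?I. f x \<le> h + l} - {x\<in>?I. f x \<le> h}"
        using True l h rg[of x] by (auto simp: rotate_cells_def)
    qed
    moreover have "{x\<in>?I. f x \<le> h} \<subseteq> {x\<in>?I. f x \<le> h + l}" by auto
    ultimately show ?thesis using True unfolding cum_def by (simp add: card_Diff_subset)
  next
    case False
    have "{x\<in>?I. rotate_cells J h f x \<le> l} = (?I - {x\<in>?I. f x \<le> h}) \<union> {x\<in>?I. f x \<le> h + l - J}"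
    proof (intro Set.set_eqI iffI)
      fix x assume "x \<in> {x\<in>?I. rotate_cells J h f x \<le> l}"
      then show "x \<in> (?I - {x\<in>?I. f x \<le> h}) \<union> {x\<in>?I. f x \<le> h + l - J}"
        using False h by (auto simp: rotate_cells_def split: if_splits)
    next
      fix x assume "x \<in> (?I - {x\<in>?I. f x \<le> h}) \<union> {x\<in>?I. f x \<le> h + l - J}"
      then show "x \<in> {x\<in>?I. rotate_cells J h f x \<le> l}"
        using False h l rg[of x] by (auto simp: rotate_cells_def)
    qed
    moreover have "(?I - {x\<in>?I. f x \<le> h}) \<inter> {x\<in>?I. f x \<le> h + l - J} = {}" using l by auto
    moreover have "card (?I - {x\<in>?I. f x \<le> h}) = J - cum f ?I h"
      unfolding cum_def by (subst card_Diff_subset) auto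
    ultimately show ?thesis using False unfolding cum_def by (simp add: card_Un_disjoint)
  qed
qed

text \<open>The term for \<open>h\<close> is \<open>2^(-i)\<close>, where \<open>i\<close> is the
  depth of \<open>f\<close> below the diagonal at \<open>h\<close>. Rotation sends the pairs of
  depth \<open>i\<close> injectively to paths with barrier \<open>l + i\<close>, so the double sum
  is dominated by the one in \<open>sum_card_below_shift_le\<close>.\<close>

lemma sum_bridges_cum:
  "\<exists>K>0. \<forall>J\<ge>1. (\<Sum>f\<in>bridges J. \<Sum>h\<in>{1..J}. 2 ^ cum f {..<J} h / 2 ^ h :: real) \<le> K * real J ^ (J - 1)"
proof -
  obtain K where K: "K > 0" and KJ: "\<And>J. J \<ge> 1 \<Longrightarrow>
      (\<Sum>i\<le>J. real (card (below {..<J} J (\<lambda>l. l + i))) / 2 ^ i) \<le> K * real J ^ (J - 1)"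
    using sum_card_below_shift_le by blast
  have "(\<Sum>f\<in>bridges J. \<Sum>h\<in>{1..J}. 2 ^ cum f {..<J} h / 2 ^ h :: real) \<le> K * real J ^ (J - 1)"
    if J: "J \<ge> 1" for J
  proof -
    define B where "B f = cum f {..<J}" for f
    define S where "S = (\<lambda>i. {p \<in> bridges J \<times> {1..J}. snd p - B (fst p) (snd p) = i})"
    note Ble = bridges_cum_le[of _ J, folded B_def]
    note Bless = bridges_cum_less[of _ J, folded B_def]
    note Btop = bridges_cum_top[of _ J, folded B_def]
    have rot: "rotate_cells J h f \<in> below {..<J} J (\<lambda>l. l + (h - B f h))"
      if f: "f \<in> bridges J" and h: "h \<in> {1..J}" for f h
    proof -
      have "rotate_cells J h f \<in> {..<J} \<rightarrow>\<^sub>E {1..J}"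
        unfolding rotate_cells_def restrict_PiE_iff
      proof
        fix x assume "x \<in> {..<J}"
        then show "(if h < f x then f x - h else f x + J - h) \<in> {1..J}"
          using bridges_range[OF f, of x] h by auto
      qed
      moreover have "cum (rotate_cells J h f) {..<J} l \<le> l + (h - B f h)" if "l \<in> {1..J}" for l
        using cum_rotate_cells[OF f h that] Ble[OF f, of "h + l"] Ble[OF f, of h] Ble[OF f, of "h + l
            - J"] h
        by (auto simp: B_def split: if_splits)
      ultimately show ?thesis by (auto simp: below_def)
    qed
    \<comment> \<open>The rotated path meets its barrier only at the original end of the bridge.
      With \<open>l\<close> in \<open>{1..J}\<close> this is \<open>h + l = J\<close>, or
      \<open>h + l = 2 * J\<close> if \<open>h = J\<close>, where the rotation is trivial.\<close>
    have top: "cum (rotate_cells J h f) {..<J} l = l + (h - B f h) \<longleftrightarrow> h + l = J \<or> h + l = 2 * J"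
      if f: "f \<in> bridges J" and h: "h \<in> {1..J}" and l: "l \<in> {1..J}" for f h l
    proof (cases "h + l \<le> J")
      case True
      have "B f (h + l) = J" if "h + l = J" using Btop[OF f] that by simp
      moreover have "B f (h + l) - B f h < l + (h - B f h)" if "h + l \<noteq> J"
      proof -
        have "B f (h + l) < h + l" using Bless[OF f, of "h + l"] True that h by auto
        then show ?thesis using Ble[OF f, of h] l by auto
      qed
      ultimately show ?thesis
        using cum_rotate_cells[OF f h l] True Ble[OF f, of h] h l
        by (cases "h + l = J") (auto simp: B_def[symmetric])
    next
      case False
      have "B f (h + l - J) = J" if "h + l = 2 * J" using Btop[OF f] that by simp
      moreover have "J - B f h + B f (h + l - J) < l + (h - B f h)" if "h + l \<noteq> 2 * J"
      proof -
        have "1 \<le> h + l - J" "h + l - J < J" using False that h l by auto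
        then have "B f (h + l - J) < h + l - J" by (rule Bless[OF f])
        then show ?thesis using Ble[OF f, of h] False h by auto
      qed
      ultimately show ?thesis
        using cum_rotate_cells[OF f h l] False Ble[OF f, of h] h l
        by (cases "h + l = 2 * J") (auto simp: B_def[symmetric])
    qed
    have inj: "card (S i) \<le> card (below {..<J} J (\<lambda>l. l + i))" for i
    proof (rule card_inj_on_le[where f = "\<lambda>p. rotate_cells J (snd p) (fst p)"])
      show "(\<lambda>p. rotate_cells J (snd p) (fst p)) ` S i \<subseteq> below {..<J} J (\<lambda>l. l + i)"
        using rot by (auto simp: S_def)
      show "inj_on (\<lambda>p. rotate_cells J (snd p) (fst p)) (S i)"
      proof (rule inj_onI)
        fix p p' assume p: "p \<in> S i" and p': "p' \<in> S i"
          and eq: "rotate_cells J (snd p) (fst p) = rotate_cells J (snd p') (fst p')"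
        obtain f h where ph: "p = (f, h)" by (cases p)
        obtain f' h' where ph': "p' = (f', h')" by (cases p')
        have f: "f \<in> bridges J" "h \<in> {1..J}" "h - B f h = i" using p ph by (auto simp: S_def)
        have f': "f' \<in> bridges J" "h' \<in> {1..J}" "h' - B f' h' = i" using p' ph' by (auto simp: S_def)
        define l where "l = (if h = J then J else J - h)"
        have l: "l \<in> {1..J}" "h + l = J \<or> h + l = 2 * J" using f by (auto simp: l_def)
        have "h' + l = J \<or> h' + l = 2 * J"
          using top[OF f(1,2) l(1)] top[OF f'(1,2) l(1)] l(2) f(3) f'(3) eq ph ph' by simp
        then have hh: "h = h'" using l f f' by auto
        have "f x = f' x" if x: "x < J" for x
        proof -
          have "rotate_cells J h f x = rotate_cells J h f' x" using fun_cong[OF eq, of x] ph ph' hh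
              by simp
          then have "(if f x > h then f x - h else f x + J - h)
              = (if f' x > h then f' x - h else f' x + J - h)"
            using x by (simp add: rotate_cells_def split del: if_split)
          then show ?thesis using bridges_range[OF f(1) x] bridges_range[OF f'(1) x] f(2)
            by (auto split: if_splits)
        qed
        then have "f = f'" using f f' unfolding bridges_def below_def by (auto intro: PiE_ext)
        then show "p = p'" using hh ph ph' by simp
      qed
    qed (auto intro: finite_below)
    have "(\<Sum>f\<in>bridges J. \<Sum>h\<in>{1..J}. 2 ^ cum f {..<J} h / 2 ^ h :: real)
        = (\<Sum>p\<in>bridges J \<times> {1..J}. 1 / 2 ^ (snd p - B (fst p) (snd p)))"
    proof -
      have "2 ^ B f h / 2 ^ h = (1 :: real) / 2 ^ (h - B f h)" if "f \<in> bridges J" for f h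
        using Ble[OF that, of h] by (simp add: field_simps flip: power_add)
      then have "(\<Sum>f\<in>bridges J. \<Sum>h\<in>{1..J}. 2 ^ B f h / 2 ^ h :: real)
          = (\<Sum>f\<in>bridges J. \<Sum>h\<in>{1..J}. 1 / 2 ^ (h - B f h))" by (intro sum.cong refl) auto
      also have "\<dots> = (\<Sum>(f, h)\<in>bridges J \<times> {1..J}. 1 / 2 ^ (h - B f h))" by (rule sum.cartesian_product)
      finally show ?thesis by (simp add: case_prod_beta B_def)
    qed
    also have "\<dots> = (\<Sum>i\<in>{..J}. \<Sum>p\<in>S i. 1 / 2 ^ (snd p - B (fst p) (snd p)))"
      unfolding S_def using finite_bridges by (intro sum.group[symmetric]) auto
    also have "\<dots> = (\<Sum>i\<le>J. real (card (S i)) / 2 ^ i)"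
    proof (rule sum.cong, simp)
      fix i
      have "(\<Sum>p\<in>S i. 1 / 2 ^ (snd p - B (fst p) (snd p))) = (\<Sum>p\<in>S i. 1 / 2 ^ i :: real)"
        by (rule sum.cong) (auto simp: S_def)
      then show "(\<Sum>p\<in>S i. 1 / 2 ^ (snd p - B (fst p) (snd p))) = real (card (S i)) / 2 ^ i" by simp
    qed
    also have "\<dots> \<le> (\<Sum>i\<le>J. real (card (below {..<J} J (\<lambda>l. l + i))) / 2 ^ i)"
      using inj by (intro sum_mono divide_right_mono) auto
    also have "\<dots> \<le> K * real J ^ (J - 1)" by (rule KJ[OF J])
    finally show ?thesis .
  qed
  then show ?thesis using K by blast
qed

text \<open>Markov's inequality: with the bound \<open>12 * (K + 2)\<close> on the sum of both
  quantities at most \<open>J^(J - 1) / 12\<close> bridges are lost, half of the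
  \<open>J^(J - 1) / 6\<close> guaranteed by \<open>card_bridges_ge\<close>.\<close>

lemma many_good_bridges:
  "\<exists>K>0. \<forall>J\<ge>2. \<exists>G \<subseteq> bridges J. real J ^ (J - 1) \<le> 12 * real (card G) \<and>
     (\<forall>f\<in>G. (\<Sum>h\<in>{1..J}. 2 ^ cum f {..<J} h / 2 ^ h) \<le> K \<and> (\<Sum>x<J. 2 ^ f x) \<le> K * (2 ^ J :: real))"
proof -
  obtain K where K: "K > 0" and KJ: "\<And>J. J \<ge> 1 \<Longrightarrow>
      (\<Sum>f\<in>bridges J. \<Sum>h\<in>{1..J}. 2 ^ cum f {..<J} h / 2 ^ h :: real) \<le> K * real J ^ (J - 1)"
    using sum_bridges_cum by blast
  define L where "L = 12 * (K + 2)"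
  have Lp: "L > 0" using K by (simp add: L_def)
  have "\<exists>G \<subseteq> bridges J. real J ^ (J - 1) \<le> 12 * real (card G) \<and>
     (\<forall>f\<in>G. (\<Sum>h\<in>{1..J}. 2 ^ cum f {..<J} h / 2 ^ h) \<le> L \<and> (\<Sum>x<J. 2 ^ f x) \<le> L * 2 ^ J)"
    if J: "J \<ge> 2" for J
  proof -
    define Z where "Z = (\<lambda>f. (\<Sum>h\<in>{1..J}. 2 ^ cum f {..<J} h / 2 ^ h) + (\<Sum>x<J. 2 ^ f x / 2 ^ J) :: real)"
    define G where "G = {f \<in> bridges J. Z f \<le> L}"
    have "(\<Sum>f\<in>bridges J. Z f) \<le> K * real J ^ (J - 1) + 2 * real J ^ (J - 1)"
      unfolding Z_def sum.distrib using KJ[of J] sum_bridges_end[of J] J by (intro add_mono) auto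
    then have tot: "(\<Sum>f\<in>bridges J. Z f) \<le> (K + 2) * real J ^ (J - 1)" by (simp add: algebra_simps)
    have Z0: "Z f \<ge> 0" for f unfolding Z_def by (intro add_nonneg_nonneg sum_nonneg) auto
    have fin: "finite (bridges J - G)" "finite G" using finite_bridges by (auto simp: G_def)
    have "L * real (card (bridges J - G)) = (\<Sum>f\<in>bridges J - G. L)" by simp
    also have "\<dots> \<le> (\<Sum>f\<in>bridges J - G. Z f)" by (intro sum_mono) (auto simp: G_def)
    also have "\<dots> \<le> (\<Sum>f\<in>bridges J. Z f)" using Z0 finite_bridges by (intro sum_mono2) auto
    finally have "12 * (K + 2) * real (card (bridges J - G)) \<le> (K + 2) * real J ^ (J - 1)"
      using tot by (simp add: L_def)
    then have "(K + 2) * (12 * real (card (bridges J - G))) \<le> (K + 2) * real J ^ (J - 1)"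
        by (simp only: mult_ac)
    then have 1: "12 * real (card (bridges J - G)) \<le> real J ^ (J - 1)" using K by simp
    have "card (bridges J) = card (bridges J - G) + card G"
      using fin finite_bridges by (simp add: card_Diff_subset G_def card_mono)
    then have "real (card (bridges J)) = real (card (bridges J - G)) + real (card G)" by simp
    then have "real J ^ (J - 1) \<le> 12 * real (card G)" using 1 card_bridges_ge[OF J] by linarith
    moreover have "(\<Sum>h\<in>{1..J}. 2 ^ cum f {..<J} h / 2 ^ h) \<le> L \<and> (\<Sum>x<J. 2 ^ f x) \<le> L * 2 ^ J"
      if f: "f \<in> G" for f
    proof -
      have "(\<Sum>h\<in>{1..J}. 2 ^ cum f {..<J} h / 2 ^ h :: real) \<ge> 0" "(\<Sum>x<J. 2 ^ f x / 2 ^ J :: real) \<ge> 0"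
        by (intro sum_nonneg; simp)+
      moreover have "Z f \<le> L" using f by (simp add: G_def)
      ultimately have "(\<Sum>h\<in>{1..J}. 2 ^ cum f {..<J} h / 2 ^ h) \<le> L" "(\<Sum>x<J. 2 ^ f x / 2 ^ J) \<le> L"
        by (auto simp: Z_def)
      then show ?thesis by (simp flip: sum_divide_distrib add: field_simps)
    qed
    ultimately show ?thesis by (intro exI[of _ G]) (auto simp: G_def)
  qed
  then show ?thesis using Lp by blast
qed

section \<open>Distinct subset sums\<close>

definition subset_sums :: "'a set \<Rightarrow> ('a \<Rightarrow> nat) \<Rightarrow> nat set" where
  "subset_sums I d = (\<lambda>Y. \<Sum>x\<in>Y. d x) ` Pow I"

text \<open>\<open>\<rho> j\<close> stands for the number of admissible irreducibles of degree
  \<open>j\<close> divided by \<open>q^j\<close>, so this is a sum over ordered tuples of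
  irreducibles, each weighted by \<open>q^(- degree)\<close> and by its number of subset sums. The
  \<open>40\<close> leaves enough degree to the cofactor for sieving it.\<close>

definition degree_sum :: "(nat \<Rightarrow> real) \<Rightarrow> nat \<Rightarrow> nat \<Rightarrow> real" where
  "degree_sum \<rho> J b = (\<Sum>d\<in>{d \<in> {..<J} \<rightarrow>\<^sub>E {1..b}. 40 * (\<Sum>x<J. d x) \<le> b}.
     (\<Prod>x<J. \<rho> (d x)) * real (card (subset_sums {..<J} d)))"

text \<open>Cauchy--Schwarz for the fibre sizes \<open>c v\<close>: they add up to
  \<open>card S\<close>, their squares to the number of ordered pairs with equal image.\<close>

lemma card_squared_le_collisions:
  assumes fin: "finite S"
  shows "(real (card S))\<^sup>2 \<le> real (card (\<sigma> ` S)) * (\<Sum>p\<in>S \<times> S. of_bool (\<sigma> (fst p) = \<sigma> (snd p)))"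
proof -
  define c where "c v = (\<Sum>y\<in>S. of_bool (\<sigma> y = v) :: real)" for v
  have 1: "real (card S) = (\<Sum>v\<in>\<sigma> ` S. c v)"
  proof -
    have "(\<Sum>v\<in>\<sigma> ` S. c v) = (\<Sum>y\<in>S. \<Sum>v\<in>\<sigma> ` S. of_bool (\<sigma> y = v))"
      unfolding c_def by (rule sum.swap)
    also have "\<dots> = (\<Sum>y\<in>S. 1)" using fin by (intro sum.cong refl) (simp add: of_bool_def)
    finally show ?thesis by simp
  qed
  have 2: "(\<Sum>p\<in>S \<times> S. of_bool (\<sigma> (fst p) = \<sigma> (snd p))) = (\<Sum>v\<in>\<sigma> ` S. (c v)\<^sup>2)"
  proof -
    have "(\<Sum>v\<in>\<sigma> ` S. (c v)\<^sup>2) = (\<Sum>v\<in>\<sigma> ` S. \<Sum>y\<in>S. \<Sum>z\<in>S. of_bool (\<sigma> y = v) * of_bool (\<sigma> z = v))"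
      unfolding c_def power2_eq_square sum_product ..
    also have "\<dots> = (\<Sum>y\<in>S. \<Sum>v\<in>\<sigma> ` S. \<Sum>z\<in>S. of_bool (\<sigma> y = v) * of_bool (\<sigma> z = v))"
      by (rule sum.swap)
    also have "\<dots> = (\<Sum>y\<in>S. \<Sum>z\<in>S. \<Sum>v\<in>\<sigma> ` S. of_bool (\<sigma> y = v) * of_bool (\<sigma> z = v))"
      by (intro sum.cong refl sum.swap)
    also have "\<dots> = (\<Sum>y\<in>S. \<Sum>z\<in>S. of_bool (\<sigma> y = \<sigma> z))"
    proof (intro sum.cong refl)
      fix y z assume "y \<in> S" "z \<in> S"
      have "(\<Sum>v\<in>\<sigma> ` S. of_bool (\<sigma> y = v) * of_bool (\<sigma> z = v) :: real)
          = (\<Sum>v\<in>\<sigma> ` S. if v = \<sigma> y then of_bool (\<sigma> y = \<sigma> z) else 0)"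
        by (intro sum.cong) auto
      then show "(\<Sum>v\<in>\<sigma> ` S. of_bool (\<sigma> y = v) * of_bool (\<sigma> z = v) :: real) = of_bool (\<sigma> y = \<sigma> z)"
        using fin \<open>y \<in> S\<close> by simp
    qed
    finally show ?thesis by (simp add: sum.cartesian_product case_prod_beta)
  qed
  have "(real (card S))\<^sup>2 \<le> (\<Sum>v\<in>\<sigma> ` S. (c v)\<^sup>2) * real (card (\<sigma> ` S))"
    unfolding 1 by (rule sum_squared_le_sum_of_squares)
  then show ?thesis unfolding 2 by (simp add: mult.commute)
qed

text \<open>Fixing all coordinates but \<open>x0\<close>, at most one value of the remaining one gives equal sums.\<close>

lemma sum_collision_le:
  fixes \<rho> :: "nat \<Rightarrow> real"
  assumes I: "finite I" "x0 \<in> I" and D: "\<And>x. x \<in> I \<Longrightarrow> finite (D x)"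
    and \<rho>: "\<And>x v. x \<in> I \<Longrightarrow> v \<in> D x \<Longrightarrow> 0 \<le> \<rho> v" and u: "\<And>v. v \<in> D x0 \<Longrightarrow> \<rho> v \<le> u" "0 \<le> u"
    and YZ: "Y \<subseteq> I" "Z \<subseteq> I" "x0 \<in> Y" "x0 \<notin> Z"
  shows "(\<Sum>d\<in>Pi\<^sub>E I D. (\<Prod>x\<in>I. \<rho> (d x)) * of_bool (sum d Y = sum d Z))
       \<le> u * (\<Prod>x\<in>I - {x0}. \<Sum>v\<in>D x. \<rho> v)"
proof -
  define I' where "I' = I - {x0}"
  have I': "I = insert x0 I'" "x0 \<notin> I'" "finite I'" using I by (auto simp: I'_def)
  have finY: "finite Y" "finite Z" using YZ I finite_subset by auto
  have "(\<Sum>d\<in>Pi\<^sub>E I D. (\<Prod>x\<in>I. \<rho> (d x)) * of_bool (sum d Y = sum d Z))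
      = (\<Sum>(y, g)\<in>D x0 \<times> Pi\<^sub>E I' D. (\<Prod>x\<in>I. \<rho> ((g(x0 := y)) x)) * of_bool (sum (g(x0 := y)) Y
          = sum (g(x0 := y)) Z))"
    unfolding I'(1) PiE_insert_eq
    by (subst sum.reindex) (use inj_combinator[OF I'(2)] in \<open>auto simp: case_prod_beta\<close>)
  also have "\<dots> = (\<Sum>y\<in>D x0. \<Sum>g\<in>Pi\<^sub>E I' D. (\<Prod>x\<in>I. \<rho> ((g(x0 := y)) x)) * of_bool (sum (g(x0 := y)) Y
      = sum (g(x0 := y)) Z))"
    by (rule sum.cartesian_product[symmetric])
  also have "\<dots> = (\<Sum>g\<in>Pi\<^sub>E I' D. \<Sum>y\<in>D x0. (\<Prod>x\<in>I. \<rho> ((g(x0 := y)) x)) * of_bool (sum (g(x0 := y)) Y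
      = sum (g(x0 := y)) Z))"
    by (rule sum.swap)
  also have "\<dots> \<le> (\<Sum>g\<in>Pi\<^sub>E I' D. u * (\<Prod>x\<in>I'. \<rho> (g x)))"
  proof (rule sum_mono)
    fix g assume g: "g \<in> Pi\<^sub>E I' D"
    define P where "P = (\<Prod>x\<in>I'. \<rho> (g x))"
    have P0: "P \<ge> 0" unfolding P_def using g \<rho> I' by (intro prod_nonneg) (auto dest: PiE_mem)
    have pr: "(\<Prod>x\<in>I. \<rho> ((g(x0 := y)) x)) = \<rho> y * P" for y
    proof -
      have "(\<Prod>x\<in>I'. \<rho> ((g(x0 := y)) x)) = P" unfolding P_def using I' by (intro prod.cong) auto
      then show ?thesis unfolding I'(1) using I' by simp
    qed
    have sy: "sum (g(x0 := y)) Y = y + sum g (Y - {x0})" for y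
    proof -
      have "sum (g(x0 := y)) Y = (g(x0 := y)) x0 + sum (g(x0 := y)) (Y - {x0})"
        using finY YZ by (intro sum.remove) auto
      also have "sum (g(x0 := y)) (Y - {x0}) = sum g (Y - {x0})" by (intro sum.cong) auto
      finally show ?thesis by simp
    qed
    have sz: "sum (g(x0 := y)) Z = sum g Z" for y using YZ by (intro sum.cong) auto
    have "(\<Sum>y\<in>D x0. (\<Prod>x\<in>I. \<rho> ((g(x0 := y)) x)) * of_bool (sum (g(x0 := y)) Y = sum (g(x0 := y)) Z))
        = (\<Sum>y\<in>D x0. \<rho> y * P * of_bool (y + sum g (Y - {x0}) = sum g Z))"
      unfolding pr sy sz ..
    also have "\<dots> \<le> (\<Sum>y\<in>D x0. if y = sum g Z - sum g (Y - {x0}) then u * P else 0)"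
    proof (rule sum_mono)
      fix y assume y: "y \<in> D x0"
      have "\<rho> y * P \<le> u * P" using u(1)[OF y] P0 by (rule mult_right_mono)
      then show "\<rho> y * P * of_bool (y + sum g (Y - {x0}) = sum g Z)
          \<le> (if y = sum g Z - sum g (Y - {x0}) then u * P else 0)"
        using u(2) P0 by auto
    qed
    also have "\<dots> \<le> u * P" using D[OF I(2)] u(2) P0 by (simp add: sum.delta)
    finally show "(\<Sum>y\<in>D x0. (\<Prod>x\<in>I. \<rho> ((g(x0 := y)) x)) * of_bool (sum (g(x0 := y)) Y
        = sum (g(x0 := y)) Z)) \<le> u * (\<Prod>x\<in>I'. \<rho> (g x))"
      by (simp add: P_def)
  qed
  also have "\<dots> = u * (\<Prod>x\<in>I'. \<Sum>v\<in>D x. \<rho> v)"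
    unfolding sum_distrib_left[symmetric] using I' D by (subst prod_sum_PiE) auto
  finally show ?thesis by (simp add: I'_def)
qed

text \<open>Two subsets have equal sums with probability at most \<open>4 / 2^h\<close>, where
  \<open>h\<close> is the highest block in which they differ: given the other coordinates, at most
  one value of a coordinate in that block works, and by \<open>u\<close> no value has a larger
  share. At most \<open>2 ^ card I * 2 ^ cum f I h\<close> pairs differ only in the first
  \<open>h\<close> blocks, so the expected number of colliding pairs is at most
  \<open>(1 + 4 * K) * 2 ^ card I\<close>.\<close>

lemma sum_subset_sums_ge:
  fixes \<rho> :: "nat \<Rightarrow> real" and f :: "'a \<Rightarrow> nat"
  assumes I: "finite I" and D: "\<And>x. x \<in> I \<Longrightarrow> finite (D x)" and f: "\<And>x. x \<in> I \<Longrightarrow> f x \<in> {1..m}"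
    and \<rho>: "\<And>x v. x \<in> I \<Longrightarrow> v \<in> D x \<Longrightarrow> 0 \<le> \<rho> v"
    and mass: "\<And>x. x \<in> I \<Longrightarrow> mass x = (\<Sum>v\<in>D x. \<rho> v)" "\<And>x. x \<in> I \<Longrightarrow> mass x > 0"
    and u: "\<And>x v. x \<in> I \<Longrightarrow> v \<in> D x \<Longrightarrow> \<rho> v \<le> 4 * mass x / 2 ^ f x"
    and K: "(\<Sum>h\<in>{1..m}. 2 ^ cum f I h / 2 ^ h) \<le> K"
  shows "(\<Sum>d\<in>Pi\<^sub>E I D. (\<Prod>x\<in>I. \<rho> (d x)) * real (card (subset_sums I d)))
       \<ge> 2 ^ card I * (\<Prod>x\<in>I. mass x) / (1 + 4 * K)"
proof -
  define n where "n = card I"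
  define w where "w d = (\<Prod>x\<in>I. \<rho> (d x))" for d
  define Pr where "Pr = (\<Prod>x\<in>I. mass x)"
  define W where "W d = (\<Sum>p\<in>Pow I \<times> Pow I. of_bool (sum d (fst p)
      = sum d (snd p)) :: real)" for d :: "'a \<Rightarrow> nat"
  define Df where "Df p = (fst p - snd p) \<union> (snd p - fst p)" for p :: "'a set \<times> 'a set"
  define C where "C h = {x \<in> I. f x \<le> h}" for h
  have Ppos: "Pr > 0" unfolding Pr_def using mass by (intro prod_pos) auto
  have w0: "w d \<ge> 0" if "d \<in> Pi\<^sub>E I D" for d unfolding w_def using that \<rho>
      by (intro prod_nonneg) (auto dest: PiE_mem)
  have finP: "finite (Pi\<^sub>E I D)" using I D by (intro finite_PiE) auto
  have wsum: "(\<Sum>d\<in>Pi\<^sub>E I D. w d) = Pr"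
    unfolding w_def Pr_def using I D mass by (subst prod_sum_PiE[symmetric]) (auto intro: prod.cong)
  have K0: "K \<ge> 0" using K by (rule order_trans[rotated]) (intro sum_nonneg, simp)
  have pair: "(\<Sum>d\<in>Pi\<^sub>E I D. w d * of_bool (sum d (fst p) = sum d (snd p)))
      \<le> Pr * (of_bool (Df p = {}) + 4 * (\<Sum>h\<in>{1..m}. of_bool (Df p \<subseteq> C h) / 2 ^ h))"
    if p: "p \<in> Pow I \<times> Pow I" for p
  proof (cases "Df p = {}")
    case True
    have "(\<Sum>d\<in>Pi\<^sub>E I D. w d * of_bool (sum d (fst p) = sum d (snd p))) \<le> (\<Sum>d\<in>Pi\<^sub>E I D. w d)"
      by (intro sum_mono) (use w0 in auto)
    also have "\<dots> = Pr * 1" using wsum by simp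
    also have "\<dots> \<le> Pr * (of_bool (Df p = {}) + 4 * (\<Sum>h\<in>{1..m}. of_bool (Df p \<subseteq> C h) / 2 ^ h))"
      using True Ppos by (intro mult_left_mono) (auto intro!: sum_nonneg)
    finally show ?thesis .
  next
    case False
    have sub: "Df p \<subseteq> I" using p by (auto simp: Df_def)
    then have "finite (Df p)" using I finite_subset by auto
    then have "f ` Df p \<noteq> {}" "finite (f ` Df p)" using False by auto
    then have "Max (f ` Df p) \<in> f ` Df p" by (intro Max_in)
    then obtain x0 where x0: "x0 \<in> Df p" "f x0 = Max (f ` Df p)" by auto
    have max: "f x \<le> f x0" if "x \<in> Df p" for x using x0 that \<open>finite (Df p)\<close> by simp
    have x0I: "x0 \<in> I" using x0 sub by auto
    have "(\<Sum>d\<in>Pi\<^sub>E I D. w d * of_bool (sum d (fst p) = sum d (snd p)))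
        \<le> 4 * mass x0 / 2 ^ f x0 * (\<Prod>x\<in>I - {x0}. \<Sum>v\<in>D x. \<rho> v)"
    proof (cases "x0 \<in> fst p")
      case True
      then show ?thesis unfolding w_def using p x0 x0I I D \<rho> u[OF x0I] mass(2)[OF x0I]
        by (intro sum_collision_le) (auto simp: Df_def intro: less_imp_le)
    next
      case False
      have "(\<Sum>d\<in>Pi\<^sub>E I D. w d * of_bool (sum d (snd p) = sum d (fst p)))
        \<le> 4 * mass x0 / 2 ^ f x0 * (\<Prod>x\<in>I - {x0}. \<Sum>v\<in>D x. \<rho> v)"
        unfolding w_def using False p x0 x0I I D \<rho> u[OF x0I] mass(2)[OF x0I]
        by (intro sum_collision_le) (auto simp: Df_def intro: less_imp_le)
      then show ?thesis by (simp add: eq_commute)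
    qed
    also have "\<dots> = 4 / 2 ^ f x0 * (mass x0 * (\<Prod>x\<in>I - {x0}. mass x))"
      using mass(1) by simp
    also have "mass x0 * (\<Prod>x\<in>I - {x0}. mass x) = Pr"
      unfolding Pr_def using prod.remove[OF I x0I, of mass] by simp
    also have "4 / 2 ^ f x0 * Pr = Pr * (4 * (of_bool (Df p \<subseteq> C (f x0)) / 2 ^ f x0))"
    proof -
      have "Df p \<subseteq> C (f x0)" using max sub by (auto simp: C_def)
      then show ?thesis by simp
    qed
    also have "\<dots> \<le> Pr * (of_bool (Df p = {}) + 4 * (\<Sum>h\<in>{1..m}. of_bool (Df p \<subseteq> C h) / 2 ^ h))"
    proof -
      have "of_bool (Df p \<subseteq> C (f x0)) / 2 ^ f x0 \<le> (\<Sum>h\<in>{1..m}. of_bool (Df p \<subseteq> C h) / 2 ^ h :: real)"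
        using f[OF x0I] by (intro member_le_sum) auto
      then show ?thesis using Ppos by (intro mult_left_mono) auto
    qed
    finally show ?thesis .
  qed
  \<comment> \<open>A pair is determined by its first component and its symmetric
    difference.\<close>
  have cnt: "(\<Sum>p\<in>Pow I \<times> Pow I. of_bool (Df p \<subseteq> S) :: real) \<le> 2 ^ n * 2 ^ card S" if S: "S \<subseteq> I" for S
  proof -
    have finS: "finite S" using S I finite_subset by auto
    have "(\<Sum>p\<in>Pow I \<times> Pow I. of_bool (Df p \<subseteq> S) :: real) = real (card {p \<in> Pow I \<times> Pow I. Df p \<subseteq> S})"
      using I by (simp add: of_bool_def sum.If_cases Int_def)
    also have "card {p \<in> Pow I \<times> Pow I. Df p \<subseteq> S} \<le> card (Pow I \<times> Pow S)"
    proof (rule card_inj_on_le[where f = "\<lambda>p. (fst p, Df p)"])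
      show "inj_on (\<lambda>p. (fst p, Df p)) {p \<in> Pow I \<times> Pow I. Df p \<subseteq> S}"
        by (rule inj_onI) (auto simp: Df_def prod_eq_iff)
    qed (use I finS in auto)
    also have "card (Pow I \<times> Pow S) = 2 ^ n * 2 ^ card S"
      using I finS by (simp add: card_cartesian_product card_Pow n_def)
    finally show ?thesis by simp
  qed
  define \<Lambda> where "\<Lambda> = 1 + 4 * K"
  have \<Lambda>: "\<Lambda> \<ge> 1" using K0 by (simp add: \<Lambda>_def)
  have sumW: "(\<Sum>d\<in>Pi\<^sub>E I D. w d * W d) \<le> 2 ^ n * \<Lambda> * Pr"
  proof -
    have "(\<Sum>d\<in>Pi\<^sub>E I D. w d * W d)
        = (\<Sum>p\<in>Pow I \<times> Pow I. \<Sum>d\<in>Pi\<^sub>E I D. w d * of_bool (sum d (fst p) = sum d (snd p)))"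
      unfolding W_def sum_distrib_left by (rule sum.swap)
    also have "\<dots> \<le> (\<Sum>p\<in>Pow I \<times> Pow I. Pr * (of_bool (Df p \<subseteq> {}) + 4 * (\<Sum>h\<in>{1..m}. of_bool (Df p
        \<subseteq> C h) / 2 ^ h)))"
      using pair by (intro sum_mono) simp
    also have "\<dots> = Pr * ((\<Sum>p\<in>Pow I \<times> Pow I. of_bool (Df p \<subseteq> {})) + 4
        * (\<Sum>p\<in>Pow I \<times> Pow I. \<Sum>h\<in>{1..m}. of_bool (Df p \<subseteq> C h) / 2 ^ h))"
      by (simp only: sum.distrib sum_distrib_left[symmetric])
    also have "(\<Sum>p\<in>Pow I \<times> Pow I. \<Sum>h\<in>{1..m}. of_bool (Df p \<subseteq> C h) / 2 ^ h :: real)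
        = (\<Sum>h\<in>{1..m}. (\<Sum>p\<in>Pow I \<times> Pow I. of_bool (Df p \<subseteq> C h)) / 2 ^ h)"
      by (subst sum.swap) (simp add: sum_divide_distrib)
    also have "Pr * ((\<Sum>p\<in>Pow I \<times> Pow I. of_bool (Df p \<subseteq> {})) + 4
        * (\<Sum>h\<in>{1..m}. (\<Sum>p\<in>Pow I \<times> Pow I. of_bool (Df p \<subseteq> C h)) / 2 ^ h))
       \<le> Pr * (2 ^ n + 4 * (\<Sum>h\<in>{1..m}. 2 ^ n * 2 ^ card (C h) / 2 ^ h))"
    proof -
      have "(\<Sum>h\<in>{1..m}. (\<Sum>p\<in>Pow I \<times> Pow I. of_bool (Df p \<subseteq> C h)) / 2 ^ h)
          \<le> (\<Sum>h\<in>{1..m}. 2 ^ n * 2 ^ card (C h) / 2 ^ h :: real)"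
        by (intro sum_mono divide_right_mono cnt) (auto simp: C_def)
      then show ?thesis using cnt[of "{}"] Ppos by (intro mult_left_mono add_mono) auto
    qed
    also have "(\<Sum>h\<in>{1..m}. 2 ^ n * 2 ^ card (C h) / 2 ^ h :: real)
        = 2 ^ n * (\<Sum>h\<in>{1..m}. 2 ^ cum f I h / 2 ^ h)"
      by (simp add: sum_distrib_left C_def cum_def)
    also have "Pr * (2 ^ n + 4 * (2 ^ n * (\<Sum>h\<in>{1..m}. 2 ^ cum f I h / 2 ^ h)))
        \<le> Pr * (2 ^ n + 4 * (2 ^ n * K))"
      using K Ppos by (intro mult_left_mono add_left_mono) auto
    finally show ?thesis by (simp add: \<Lambda>_def algebra_simps)
  qed
  define t0 where "t0 = 2 ^ n * \<Lambda>"
  have l0: "t0 > 0" using \<Lambda> by (simp add: t0_def)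
  txt \<open>Cauchy--Schwarz gives \<open>4 ^ n / W d\<close>; the tangent of \<open>1 / W\<close> at \<open>t0\<close> makes this linear in \<open>W d\<close>.\<close>
  have ptw: "4 ^ n * (2 / t0 - W d / t0\<^sup>2) \<le> real (card (subset_sums I d))" for d
  proof -
    define L where "L = real (card (subset_sums I d))"
    have CS: "(2 ^ n)\<^sup>2 \<le> L * W d"
      using card_squared_le_collisions[of "Pow I" "sum d"] I
      by (simp add: L_def W_def subset_sums_def card_Pow n_def)
    have Wpos: "W d > 0"
    proof (rule ccontr)
      assume "\<not> W d > 0"
      then have "L * W d \<le> 0" by (simp add: L_def mult_nonneg_nonpos)
      with CS have "(2 ^ n :: real)\<^sup>2 \<le> 0" by linarith
      then show False by simp
    qed
    have four: "(2 ^ n :: real)\<^sup>2 = 4 ^ n" by (simp add: power2_eq_square flip: power_mult_distrib)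
    have "(2 / t0 - W d / t0\<^sup>2) \<le> 1 / W d"
    proof -
      have "0 \<le> (W d - t0)\<^sup>2" by simp
      then have "W d * (2 * t0 - W d) \<le> t0\<^sup>2" by (simp add: power2_eq_square algebra_simps)
      then have "(2 * t0 - W d) / t0\<^sup>2 \<le> 1 / W d"
        using Wpos l0 by (simp add: divide_simps mult_ac)
      moreover have "(2 * t0 - W d) / t0\<^sup>2 = 2 / t0 - W d / t0\<^sup>2"
        using l0 by (simp add: diff_divide_distrib power2_eq_square)
      ultimately show ?thesis by simp
    qed
    then have "4 ^ n * (2 / t0 - W d / t0\<^sup>2) \<le> 4 ^ n * (1 / W d)" by (intro mult_left_mono) auto
    also have "\<dots> \<le> L" using CS Wpos four by (simp add: field_simps)
    finally show ?thesis by (simp add: L_def)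
  qed
  have L1: "(\<Sum>d\<in>Pi\<^sub>E I D. w d * real (card (subset_sums I d))) \<ge> (\<Sum>d\<in>Pi\<^sub>E I D. w d * (4 ^ n * (2 / t0
      - W d / t0\<^sup>2)))"
    using ptw w0 by (intro sum_mono mult_left_mono) auto
  have L2: "(\<Sum>d\<in>Pi\<^sub>E I D. w d * (4 ^ n * (2 / t0 - W d / t0\<^sup>2)))
     = 4 ^ n * (2 / t0 * (\<Sum>d\<in>Pi\<^sub>E I D. w d) - (\<Sum>d\<in>Pi\<^sub>E I D. w d * W d) / t0\<^sup>2)"
    by (simp add: sum_distrib_left sum_subtractf sum_divide_distrib algebra_simps)
  have L3: "4 ^ n * (2 / t0 * Pr - t0 * Pr / t0\<^sup>2)
      \<le> 4 ^ n * (2 / t0 * (\<Sum>d\<in>Pi\<^sub>E I D. w d) - (\<Sum>d\<in>Pi\<^sub>E I D. w d * W d) / t0\<^sup>2)"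
    using sumW l0 unfolding wsum t0_def[symmetric]
    by (intro mult_left_mono diff_left_mono divide_right_mono) auto
  have "4 ^ n * (2 / t0 * Pr - t0 * Pr / t0\<^sup>2) = 4 ^ n * Pr / t0"
    using l0 by (simp add: power2_eq_square field_simps)
  also have "\<dots> = 2 ^ n * Pr / \<Lambda>"
  proof -
    have "(4::real) ^ n = 2 ^ n * 2 ^ n" by (simp flip: power_mult_distrib)
    then show ?thesis by (simp add: t0_def)
  qed
  finally have "2 ^ n * Pr / \<Lambda> \<le> (\<Sum>d\<in>Pi\<^sub>E I D. w d * real (card (subset_sums I d)))"
    using L1 L2 L3 by linarith
  then show ?thesis by (simp add: w_def n_def Pr_def \<Lambda>_def)
qed

section \<open>Degrees chosen from dyadic blocks\<close>

lemma sum_dyadic_ge_ln2: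
  assumes a: "a \<ge> (1::nat)"
  shows "ln 2 \<le> (\<Sum>j\<in>{a..<2*a}. 1 / real j)"
proof -
  have "ln (real (2 * a)) - ln (real a) = (\<Sum>j\<in>{a..<2*a}. ln (real (Suc j)) - ln (real j))"
    using sum_Suc_diff'[of a "2 * a" "\<lambda>j. ln (real j)"] by simp
  also have "\<dots> \<le> (\<Sum>j\<in>{a..<2*a}. 1 / real j)"
  proof (rule sum_mono)
    fix j assume "j \<in> {a..<2*a}"
    then have j: "real j > 0" using a by auto
    have "ln (1 + 1 / real j) \<le> 1 / real j" by (rule ln_add_one_self_le_self) simp
    moreover have "ln (real (Suc j)) - ln (real j) = ln (1 + 1 / real j)"
    proof -
      have "1 + 1 / real j = real (Suc j) / real j" using j by (simp add: field_simps)
      then show ?thesis using j by (simp only: ln_div) (simp add: ln_div)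
    qed
    ultimately show "ln (real (Suc j)) - ln (real j) \<le> 1 / real j" by simp
  qed
  finally show ?thesis using a by (simp add: ln_mult)
qed

lemma delta_le_1: "delta \<le> 1"
proof -
  have l: "ln (2::real) \<ge> 2/3" "ln (2::real) > 0" using ln2_ge_two_thirds by auto
  have "ln (1 / ln 2) \<le> 1 / ln (2::real) - 1" using l by (intro ln_le_minus_one) auto
  moreover have "1 / ln (2::real) \<le> 3/2" using l by (simp add: field_simps)
  ultimately have "1 + ln (ln (2::real)) \<ge> 0" using l by (simp add: ln_div)
  then show ?thesis using l by (simp add: delta_def)
qed

text \<open>The origin of the exponent: \<open>(2 * ln 2)^J * J^J / J!\<close> grows like
  \<open>(2 * e * ln 2)^J\<close>, where \<open>2\<close> counts subsets, \<open>ln 2\<close> is the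
  mass of a dyadic block and \<open>e\<close> comes from Stirling's formula. As \<open>2^J\<close>
  is of order \<open>b\<close>, this is a power of \<open>b\<close>.\<close>

lemma two_powr_exponent: "2 powr (2 - delta) = 2 * exp 1 * ln 2"
proof -
  have "(2 - delta) * ln 2 = ln 2 + 1 + ln (ln 2)" by (simp add: delta_def field_simps)
  then show ?thesis by (simp add: powr_def exp_add)
qed

text \<open>The extreme case has one element in each cell, where the sum is geometric; the
  comparison is summation by parts with the nonnegative weights \<open>r^h - r^(h + 1)\<close>. It
  is the reason why the product of the block masses loses only a constant factor.\<close>

lemma sum_power_le_of_cum_le:
  fixes r :: real
  assumes r: "0 \<le> r" "r < 1" and f: "\<And>x. x < J \<Longrightarrow> f x \<in> {1..J}"
    and cum: "\<And>l. cum f {..<J} l \<le> l"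
  shows "(\<Sum>x<J. r ^ f x) \<le> 1 / (1 - r)"
proof -
  have tel: "r ^ i = r ^ J + (\<Sum>h<J. of_bool (i \<le> h) * (r ^ h - r ^ Suc h))" if "i \<le> J" for i
  proof -
    have "(\<Sum>h<J. of_bool (i \<le> h) * (r ^ h - r ^ Suc h)) = (\<Sum>h\<in>{i..<J}. r ^ h - r ^ Suc h)"
      by (rule sum.mono_neutral_cong_right) auto
    also have "\<dots> = - (\<Sum>h\<in>{i..<J}. r ^ Suc h - r ^ h)" by (simp add: sum_negf[symmetric])
    also have "(\<Sum>h\<in>{i..<J}. r ^ Suc h - r ^ h) = r ^ J - r ^ i"
      using sum_Suc_diff'[of i J "\<lambda>h. r ^ h"] that by simp
    finally show ?thesis by simp
  qed
  have "(\<Sum>x<J. r ^ f x) = (\<Sum>x<J. r ^ J + (\<Sum>h<J. of_bool (f x \<le> h) * (r ^ h - r ^ Suc h)))"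
    using f by (intro sum.cong refl tel) auto
  also have "\<dots> = real J * r ^ J + (\<Sum>h<J. \<Sum>x<J. of_bool (f x \<le> h) * (r ^ h - r ^ Suc h))"
    unfolding sum.distrib by (subst sum.swap) simp
  also have "(\<Sum>h<J. \<Sum>x<J. of_bool (f x \<le> h) * (r ^ h - r ^ Suc h))
      = (\<Sum>h<J. real (cum f {..<J} h) * (r ^ h - r ^ Suc h))"
  proof (rule sum.cong, simp)
    fix h
    have "(\<Sum>x<J. of_bool (f x \<le> h) :: real) = real (cum f {..<J} h)"
      by (simp add: of_bool_def sum.If_cases Int_def cum_def)
    then show "(\<Sum>x<J. of_bool (f x \<le> h) * (r ^ h - r ^ Suc h))
        = real (cum f {..<J} h) * (r ^ h - r ^ Suc h)"
      by (simp only: sum_distrib_right[symmetric])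
  qed
  also have "(\<Sum>h<J. real (cum f {..<J} h) * (r ^ h - r ^ Suc h)) \<le> (\<Sum>h<J. real h * (r ^ h - r ^ Suc h))"
  proof (rule sum_mono)
    fix h
    have "r ^ Suc h \<le> r ^ h" using r by (intro power_decreasing) auto
    then show "real (cum f {..<J} h) * (r ^ h - r ^ Suc h) \<le> real h * (r ^ h - r ^ Suc h)"
      using cum[of h] by (intro mult_right_mono) auto
  qed
  also have "real J * r ^ J + (\<Sum>h<J. real h * (r ^ h - r ^ Suc h)) = (\<Sum>h\<in>{1..J}. r ^ h)"
    by (induction J) (auto simp: algebra_simps)
  also have "(\<Sum>h\<in>{1..J}. r ^ h) \<le> (\<Sum>h<Suc J. r ^ h)" using r by (intro sum_mono2) auto
  also have "\<dots> = (1 - r ^ Suc J) / (1 - r)" using r by (subst sum_gp_strict) auto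
  also have "\<dots> \<le> 1 / (1 - r)" using r by (intro divide_right_mono) auto
  finally show ?thesis by linarith
qed

lemma exp_minus_double_le:
  fixes y :: real
  assumes "0 \<le> y" "y \<le> 1/2"
  shows "exp (- 2 * y) \<le> 1 - y"
proof -
  have "y * 1 \<le> y * (2 * (1 - y))" using assms by (intro mult_left_mono) auto
  then have "1 \<le> (1 + 2 * y) * (1 - y)" by (simp add: algebra_simps)
  also have "\<dots> \<le> exp (2 * y) * (1 - y)"
    using assms by (intro mult_right_mono exp_ge_add_one_self) auto
  finally have "1 \<le> exp (2 * y) * (1 - y)" .
  then show ?thesis by (simp add: exp_minus divide_simps mult_ac)
qed

text \<open>The shift by \<open>j0\<close> discards the small degrees, for which
  \<open>1/j - C / j^(1 + \<epsilon>)\<close> may be negative and the lower bound on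
  \<open>\<rho> j\<close> empty. It will depend on \<open>C\<close> and \<open>\<epsilon>\<close>
  only.\<close>

definition dyadic :: "nat \<Rightarrow> nat \<Rightarrow> nat set" where
  "dyadic j0 h = {2 ^ (j0 + h - 1)..<2 ^ (j0 + h)}"

lemma dyadic_disjoint:
  assumes "v \<in> dyadic j0 h" "v \<in> dyadic j0 h'" "1 \<le> h" "1 \<le> h'"
  shows "h = h'"
proof -
  have *: "\<not> a < b" if v: "v \<in> dyadic j0 a" "v \<in> dyadic j0 b" for a b
  proof
    assume "a < b"
    then have "(2::nat) ^ (j0 + a) \<le> 2 ^ (j0 + b - 1)" by (intro power_increasing) auto
    moreover have "v < 2 ^ (j0 + a)" "2 ^ (j0 + b - 1) \<le> v" using v by (simp_all add: dyadic_def)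
    ultimately show False by linarith
  qed
  show ?thesis using *[of h h'] *[of h' h] assms by auto
qed

text \<open>A block has \<open>a = 2^(j0 + h - 1)\<close> members, all at least \<open>a\<close>, so
  the corrections add up to at most \<open>C * a^(- \<epsilon>)\<close>, which decays geometrically
  in \<open>h\<close>.\<close>

lemma dyadic_mass_ge:
  fixes \<rho> :: "nat \<Rightarrow> real"
  assumes \<rho>: "\<And>j. 1 \<le> j \<Longrightarrow> 1 / real j - C / real j powr (1 + \<epsilon>) \<le> \<rho> j"
    and C: "0 \<le> C" "0 < \<epsilon>" and j0: "1 \<le> j0"
  shows "ln 2 - C * (2 powr - \<epsilon>) ^ (j0 - 1) * (2 powr - \<epsilon>) ^ h \<le> (\<Sum>v\<in>dyadic j0 h. \<rho> v)"
proof -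
  define a where "a = (2::nat) ^ (j0 + h - 1)"
  have a: "a \<ge> 1" by (simp add: a_def)
  have D: "dyadic j0 h = {a..<2*a}"
  proof -
    have "(2::nat) ^ (j0 + h) = 2 * a" unfolding a_def using j0 by (simp flip: power_Suc)
    then show ?thesis by (simp add: dyadic_def a_def)
  qed
  have "(\<Sum>v\<in>dyadic j0 h. \<rho> v) \<ge> (\<Sum>v\<in>{a..<2*a}. 1 / real v - C / real a powr (1 + \<epsilon>))"
    unfolding D
  proof (rule sum_mono)
    fix v assume v: "v \<in> {a..<2*a}"
    have "real a powr (1 + \<epsilon>) \<le> real v powr (1 + \<epsilon>)" using v C by (intro powr_mono2) auto
    then have "C / real v powr (1 + \<epsilon>) \<le> C / real a powr (1 + \<epsilon>)"
      using C a v by (intro divide_left_mono mult_pos_pos) auto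
    then show "1 / real v - C / real a powr (1 + \<epsilon>) \<le> \<rho> v" using \<rho>[of v] v a by auto
  qed
  moreover have "(\<Sum>v\<in>{a..<2*a}. 1 / real v - C / real a powr (1 + \<epsilon>))
      = (\<Sum>v\<in>{a..<2*a}. 1 / real v) - real a * (C / real a powr (1 + \<epsilon>))"
    by (simp add: sum_subtractf)
  moreover have "real a * (C / real a powr (1 + \<epsilon>)) = C * real a powr - \<epsilon>"
    using a by (simp add: powr_add powr_minus field_simps)
  moreover have "real a powr - \<epsilon> = (2 powr - \<epsilon>) ^ (j0 - 1) * (2 powr - \<epsilon>) ^ h"
  proof -
    have "real a = 2 powr real (j0 + h - 1)" by (simp add: a_def powr_realpow)
    then have "real a powr - \<epsilon> = (2 powr - \<epsilon>) powr real (j0 + h - 1)"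
        by (simp add: powr_powr mult.commute)
    also have "\<dots> = (2 powr - \<epsilon>) ^ (j0 + h - 1)" by (simp add: powr_realpow)
    also have "j0 + h - 1 = (j0 - 1) + h" using j0 by simp
    finally show ?thesis by (simp add: power_add)
  qed
  ultimately show ?thesis using sum_dyadic_ge_ln2[OF a] by (simp add: mult_ac)
qed

text \<open>For large \<open>b\<close> every good bridge \<open>f\<close> selects the box of degree
  vectors whose entry at \<open>x\<close> lies in block \<open>f x\<close>. The boxes are disjoint,
  each contributes at least a constant times \<open>(2 * ln 2)^J\<close>, and there are at least
  \<open>J^(J - 1) / 12\<close> of them.\<close>

theorem divisor_degree_sum_ge:
  fixes \<epsilon> C :: real
  assumes \<epsilon>: "\<epsilon> > 0" and C: "C \<ge> 0"
  shows "\<exists>c>0. \<forall>b\<ge>1. \<forall>\<rho>. (\<forall>j\<ge>1. 1 / real j - C / real j powr (1 + \<epsilon>) \<le> \<rho> j \<and> 0 \<le> \<rho> j \<and> \<rho> j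
      \<le> 1 / real j) \<longrightarrow>
    (\<exists>J. degree_sum \<rho> J b
        \<ge> c * fact J * (real b powr (2 - delta) / (1 + ln (real b)) powr (3/2)))"
proof -
  define r where "r = (2::real) powr - \<epsilon>"
  have r: "0 < r" "r < 1" using \<epsilon> by (auto simp: r_def powr_less_one)
  have "(\<lambda>n. r ^ n) \<longlonglongrightarrow> 0" using r by (intro LIMSEQ_realpow_zero) auto
  then have "(\<lambda>n. C * r ^ n) \<longlonglongrightarrow> C * 0" by (intro tendsto_mult tendsto_const)
  then have "eventually (\<lambda>n. C * r ^ n < 1/3) sequentially" by (rule order_tendstoD) auto
  \<comment> \<open>The threshold \<open>1/3\<close> is at most half of \<open>ln 2\<close>; this
    yields \<open>\<theta> <= 1/2\<close> and block masses of at least \<open>1/3\<close>.\<close>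
  then obtain n0 where n0: "C * r ^ n0 < 1/3" by (auto simp: eventually_sequentially)
  define j0 where "j0 = Suc n0"
  define \<theta> where "\<theta> = C * r ^ n0 / ln 2"
  have ln2: "ln (2::real) \<ge> 2/3" "ln (2::real) > 0" using ln2_ge_two_thirds by auto
  have \<theta>: "0 \<le> \<theta>" "\<theta> \<le> 1/2"
  proof -
    show "0 \<le> \<theta>" using C r ln2 by (simp add: \<theta>_def)
    have "C * r ^ n0 \<le> ln 2 / 2" using n0 ln2 by linarith
    then show "\<theta> \<le> 1/2" using ln2 by (simp add: \<theta>_def field_simps)
  qed
  obtain K0 where K0: "K0 > 0" and good: "\<And>J. J \<ge> 2
      \<Longrightarrow> \<exists>G \<subseteq> bridges J. real J ^ (J - 1) \<le> 12 * real (card G) \<and>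
     (\<forall>f\<in>G. (\<Sum>h\<in>{1..J}. 2 ^ cum f {..<J} h / 2 ^ h) \<le> K0 \<and> (\<Sum>x<J. 2 ^ f x) \<le> K0 * (2 ^ J :: real))"
    using many_good_bridges by blast
  define K where "K = max K0 1"
  \<comment> \<open>\<open>K * 2^j0 * 2^J\<close> bounds the total degree in the box of a good
    bridge, and \<open>40\<close> times this must not exceed \<open>b\<close>; hence
    \<open>J\<close> will be the integer part of \<open>log 2 (b / M)\<close>.\<close>
  define M where "M = 40 * K * 2 ^ j0"
  have K: "K \<ge> 1" "K0 \<le> K" by (auto simp: K_def)
  have M: "M \<ge> 1"
  proof -
    have "1 * 1 \<le> (40 * K) * (2 ^ j0 :: real)" using K by (intro mult_mono) auto
    then show ?thesis by (simp add: M_def)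
  qed
  define \<kappa> where "\<kappa> = 2 - delta"
  have \<kappa>: "\<kappa> \<ge> 1" using delta_le_1 by (simp add: \<kappa>_def)
  define c1 where "c1 = exp (- 1 / (1 - r)) / (12 * (1 + 4 * K))"
  have c1: "c1 > 0" using K by (simp add: c1_def)
  define c2 where "c2 = c1 / (exp 1 * 2 powr (3/2) * (2 * M) powr \<kappa>)"
  define c3 where "c3 = 1 / (4 * M) powr \<kappa>"
  define c where "c = min c2 c3"
  have "c2 > 0" "c3 > 0" using c1 M by (auto simp: c2_def c3_def)
  then have c: "c > 0" "c \<le> c2" "c \<le> c3" by (auto simp: c_def)
  show ?thesis
  proof (intro exI[of _ c] conjI allI impI c)
    fix b :: nat and \<rho> :: "nat \<Rightarrow> real"
    assume b: "b \<ge> 1" and \<rho>: "\<forall>j\<ge>1. 1 / real j - C / real j powr (1 + \<epsilon>) \<le> \<rho> j \<and> 0 \<le> \<rho> j \<and> \<rho> j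
        \<le> 1 / real j"
    have lnb: "ln (real b) \<ge> 0" using b by simp
    have R0: "real b powr \<kappa> / (1 + ln (real b)) powr (3/2) \<ge> 0" by simp
    define S where "S J = degree_sum \<rho> J b" for J
    have "\<exists>J. S J \<ge> c * fact J * (real b powr \<kappa> / (1 + ln (real b)) powr (3/2))"
    \<comment> \<open>For bounded \<open>b\<close> the choice \<open>J = 0\<close> suffices: the
      empty vector has weight \<open>1\<close> and the single subset sum \<open>0\<close>. Otherwise
      \<open>J >= 2\<close>, as \<open>many_good_bridges\<close> requires.\<close>
    proof (cases "real b < 4 * M")
      case True
      have "c * fact 0 * (real b powr \<kappa> / (1 + ln (real b)) powr (3/2))
          \<le> c3 * (real b powr \<kappa> / (1 + ln (real b)) powr (3/2))"
        using c R0 by (simp only: fact_0 mult_1_right) (intro mult_right_mono, auto)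
      also have "\<dots> \<le> c3 * (real b powr \<kappa> / 1)"
        using \<open>c3 > 0\<close> lnb by (intro mult_left_mono divide_left_mono ge_one_powr_ge_zero) auto
      also have "\<dots> \<le> c3 * ((4 * M) powr \<kappa>)"
        using \<open>c3 > 0\<close> True b \<kappa> by (intro mult_left_mono) (auto intro!: powr_mono2)
      also have "\<dots> = 1" using M by (simp add: c3_def)
      also have "1 \<le> S 0" by (simp add: S_def degree_sum_def subset_sums_def)
      finally show ?thesis by blast
    next
      case False
      define J where "J = nat \<lfloor>log 2 (real b / M)\<rfloor>"
      have bM: "real b / M \<ge> 4" using False M by (simp add: field_simps)
      then have log0: "log 2 (real b / M) \<ge> 2" by (simp add: le_log_iff)
      have Jle: "real J \<le> log 2 (real b / M)" "log 2 (real b / M) < real J + 1"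
        using log0 by (auto simp: J_def)
      have J2: "J \<ge> 2" using log0 by (simp add: J_def le_nat_iff le_floor_iff)
      have pw: "M * 2 ^ J \<le> real b" "real b < 2 * M * 2 ^ J"
      proof -
        have "2 powr real J \<le> 2 powr log 2 (real b / M)" using Jle by simp
        then have "2 ^ J \<le> real b / M" using bM M by (simp add: powr_realpow)
        then show "M * 2 ^ J \<le> real b" using M by (simp add: field_simps)
        have "2 powr log 2 (real b / M) < 2 powr (real J + 1)" using Jle by simp
        then have "real b / M < 2 * 2 ^ J" using bM M by (simp add: powr_add powr_realpow)
        then show "real b < 2 * M * 2 ^ J" using M by (simp add: field_simps)
      qed
      define I where "I = {..<J}"
      define D where "D f x = dyadic j0 (f x)" for f :: "nat \<Rightarrow> nat" and x :: nat
      define w where "w d = (\<Prod>x\<in>I. \<rho> (d x)) * real (card (subset_sums I d))" for d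
      obtain G where G: "G \<subseteq> bridges J" "real J ^ (J - 1) \<le> 12 * real (card G)"
        and G1: "\<And>f. f \<in> G \<Longrightarrow> (\<Sum>h\<in>{1..J}. 2 ^ cum f I h / 2 ^ h) \<le> K0"
        and G2: "\<And>f. f \<in> G \<Longrightarrow> (\<Sum>x\<in>I. 2 ^ f x) \<le> K0 * (2 ^ J :: real)"
        using good[OF J2] unfolding I_def by blast
      have finG: "finite G" using G(1) finite_bridges finite_subset by blast
      have rng: "f x \<in> {1..J}" if "f \<in> G" "x \<in> I" for f x
        using bridges_range[of f J x] that G(1) by (auto simp: I_def)
      define mass where "mass h = (\<Sum>v\<in>dyadic j0 h. \<rho> v)" for h
      have mass: "mass h \<ge> ln 2 * (1 - \<theta> * r ^ h)" "mass h \<ge> 1/3" for h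
      proof -
        have "ln 2 - C * r ^ (j0 - 1) * r ^ h \<le> mass h"
          unfolding mass_def r_def by (rule dyadic_mass_ge) (use \<rho> C \<epsilon> in \<open>auto simp: j0_def\<close>)
        moreover have "ln 2 * (1 - \<theta> * r ^ h) = ln 2 - C * r ^ (j0 - 1) * r ^ h"
          using ln2 by (simp add: \<theta>_def j0_def field_simps)
        ultimately show 1: "mass h \<ge> ln 2 * (1 - \<theta> * r ^ h)" by simp
        have "\<theta> * r ^ h \<le> 1/2 * 1" using \<theta> r by (intro mult_mono power_le_one) auto
        then have "2/3 * (1/2) \<le> ln 2 * (1 - \<theta> * r ^ h)" using ln2 by (intro mult_mono) auto
        with 1 show "mass h \<ge> 1/3" by simp
      qed
      have pos: "v \<ge> 1" if "v \<in> dyadic j0 h" for v h using that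
          by (auto simp: dyadic_def Suc_le_eq intro: order.strict_trans2[of 0 "2 ^ _"])
      have perf: "(\<Sum>d\<in>Pi\<^sub>E I (D f). w d) \<ge> (2 * ln 2) ^ J * exp (- 1 / (1 - r)) / (1 + 4
          * K)" if f: "f \<in> G" for f
      proof -
        have A: "(\<Sum>d\<in>Pi\<^sub>E I (D f). w d) \<ge> 2 ^ card I * (\<Prod>x\<in>I. mass (f x)) / (1 + 4 * K0)"
          unfolding w_def
        proof (rule sum_subset_sums_ge[where m = J and f = f])
          \<comment> \<open>Uses \<open>v >= 2^(f x)\<close>, which holds because
            \<open>j0 >= 1\<close>, and \<open>4 * mass (f x) >= 4/3 >= 1\<close>.\<close>
          show "\<rho> v \<le> 4 * mass (f x) / 2 ^ f x" if x: "x \<in> I" and v: "v \<in> D f x" for x v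
          proof -
            have "f x \<ge> 1" using rng[OF f x] by simp
            then have "(2::nat) ^ f x \<le> 2 ^ (j0 + f x - 1)"
                by (intro power_increasing) (auto simp: j0_def)
            also have "\<dots> \<le> v" using v by (simp add: D_def dyadic_def)
            finally have "real (2 ^ f x) \<le> real v" by (simp only: of_nat_le_iff)
            then have le: "2 ^ f x \<le> real v" by simp
            have "\<rho> v \<le> 1 / real v" using \<rho> pos v by (auto simp: D_def)
            also have "\<dots> \<le> 1 / 2 ^ f x" using le by (intro frac_le) auto
            also have "\<dots> \<le> 4 * mass (f x) / 2 ^ f x" using mass(2)[of "f x"]
                by (intro divide_right_mono) auto
            finally show ?thesis .
          qed
          show "mass (f x) > 0" for x using mass(2)[of "f x"] by linarith
          show "(\<Sum>h\<in>{1..J}. 2 ^ cum f I h / 2 ^ h) \<le> K0" using G1[OF f] .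
        qed (use rng f \<rho> pos in \<open>auto simp: I_def D_def mass_def dyadic_def\<close>)
        \<comment> \<open>Each block falls short of \<open>ln 2\<close> by a factor of at worst
          \<open>1 - \<theta> * r^(f x)\<close>. The terms \<open>r^(f x)\<close> have a bounded sum
          along a bridge, so the product keeps the fixed factor
          \<open>exp (- 1 / (1 - r))\<close>.\<close>
        have B: "(\<Prod>x\<in>I. mass (f x)) \<ge> ln 2 ^ J * exp (- 1 / (1 - r))"
        proof -
          have cu: "cum f {..<J} l \<le> l" for l using bridges_cum_le G(1) f by blast
          have "(\<Sum>x<J. r ^ f x) \<le> 1 / (1 - r)"
            by (rule sum_power_le_of_cum_le) (use r rng f cu in \<open>auto simp: I_def\<close>)
          moreover have "\<theta> * (\<Sum>x<J. r ^ f x) \<le> 1/2 * (\<Sum>x<J. r ^ f x)"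
            using \<theta> r by (intro mult_right_mono sum_nonneg) auto
          ultimately have "- 1 / (1 - r) \<le> - 2 * (\<theta> * (\<Sum>x<J. r ^ f x))" by simp
          also have "\<dots> = (\<Sum>x\<in>I. - 2 * (\<theta> * r ^ f x))" by (simp add: sum_distrib_left I_def)
          finally have "exp (- 1 / (1 - r)) \<le> exp (\<Sum>x\<in>I. - 2 * (\<theta> * r ^ f x))" by simp
          also have "\<dots> = (\<Prod>x\<in>I. exp (- 2 * (\<theta> * r ^ f x)))" by (simp add: exp_sum I_def)
          finally have "ln 2 ^ J * exp (- 1 / (1 - r)) \<le> ln 2 ^ J * (\<Prod>x\<in>I. exp (- 2 * (\<theta> * r ^ f x)))"
            using ln2 by (intro mult_left_mono) auto
          also have "\<dots> = (\<Prod>x\<in>I. ln 2 * exp (- 2 * (\<theta> * r ^ f x)))" by (simp add: prod.distrib I_def)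
          also have "\<dots> \<le> (\<Prod>x\<in>I. mass (f x))"
          proof (rule prod_mono, intro conjI)
            fix x
            show "0 \<le> ln 2 * exp (- 2 * (\<theta> * r ^ f x))" using ln2 by simp
            have "\<theta> * r ^ f x \<le> 1/2 * 1" using \<theta> r by (intro mult_mono power_le_one) auto
            then have "exp (- 2 * (\<theta> * r ^ f x)) \<le> 1 - \<theta> * r ^ f x"
              using \<theta> r by (intro exp_minus_double_le) auto
            then have "ln 2 * exp (- 2 * (\<theta> * r ^ f x)) \<le> ln 2 * (1 - \<theta> * r ^ f x)"
              using ln2 by (intro mult_left_mono) auto
            then show "ln 2 * exp (- 2 * (\<theta> * r ^ f x)) \<le> mass (f x)" using mass(1)[of "f x"]
                by linarith
          qed
          finally show ?thesis .
        qed
        have "(2 * ln 2) ^ J * exp (- 1 / (1 - r)) / (1 + 4 * K)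
            \<le> (2 * ln 2) ^ J * exp (- 1 / (1 - r)) / (1 + 4 * K0)"
          using K K0 ln2 by (intro divide_left_mono) auto
        also have "\<dots> = 2 ^ card I * (ln 2 ^ J * exp (- 1 / (1 - r))) / (1 + 4 * K0)"
          by (simp add: I_def power_mult_distrib)
        also have "\<dots> \<le> 2 ^ card I * (\<Prod>x\<in>I. mass (f x)) / (1 + 4 * K0)"
          using B K0 by (intro divide_right_mono mult_left_mono) auto
        finally show ?thesis using A by linarith
      qed
      define U where "U = {d \<in> I \<rightarrow>\<^sub>E {1..b}. 40 * (\<Sum>x\<in>I. d x) \<le> b}"
      have finU: "finite U" unfolding U_def I_def
          by (rule finite_subset[OF _ finite_PiE[of "{..<J}" "\<lambda>_. {1..b}"]]) auto
      have w0: "w d \<ge> 0" if "d \<in> U" for d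
        unfolding w_def using that \<rho> by (intro mult_nonneg_nonneg prod_nonneg) (auto simp: U_def dest:
            PiE_mem)
      have sub: "Pi\<^sub>E I (D f) \<subseteq> U" if f: "f \<in> G" for f
      proof
        fix d assume d: "d \<in> Pi\<^sub>E I (D f)"
        have dx: "d x \<ge> 1 \<and> d x \<le> 2 ^ (j0 + f x)" if "x \<in> I" for x
          using PiE_mem[OF d that] pos by (auto simp: D_def dyadic_def)
        have "real (\<Sum>x\<in>I. d x) \<le> (\<Sum>x\<in>I. 2 ^ j0 * 2 ^ f x)"
          unfolding of_nat_sum
        proof (rule sum_mono)
          fix x assume "x \<in> I"
          then have "real (d x) \<le> real (2 ^ (j0 + f x))" using dx by (simp only: of_nat_le_iff)
          then show "real (d x) \<le> 2 ^ j0 * 2 ^ f x" by (simp add: power_add)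
        qed
        also have "\<dots> = 2 ^ j0 * (\<Sum>x\<in>I. 2 ^ f x)" by (simp add: sum_distrib_left)
        also have "\<dots> \<le> 2 ^ j0 * (K * 2 ^ J)"
          using G2[OF f] K by (intro mult_left_mono) (auto intro: order_trans[OF _ mult_right_mono[of
              K0 K]])
        finally have "40 * real (\<Sum>x\<in>I. d x) \<le> M * 2 ^ J" by (simp add: M_def mult_ac)
        then have "real (40 * (\<Sum>x\<in>I. d x)) \<le> real b" using pw(1) by simp
        then have s: "40 * (\<Sum>x\<in>I. d x) \<le> b" by (simp only: of_nat_le_iff)
        have "d x \<le> b" if "x \<in> I" for x
        proof -
          have "d x \<le> (\<Sum>x\<in>I. d x)" using that by (intro member_le_sum) (auto simp: I_def)
          then show ?thesis using s by linarith
        qed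
        then show "d \<in> U" using d dx s by (auto simp: U_def PiE_iff)
      qed
      have disj: "Pi\<^sub>E I (D f) \<inter> Pi\<^sub>E I (D g) = {}" if fg: "f \<in> G" "g \<in> G" "f \<noteq> g" for f g
      proof (rule ccontr)
        assume "Pi\<^sub>E I (D f) \<inter> Pi\<^sub>E I (D g) \<noteq> {}"
        then obtain d where d: "d \<in> Pi\<^sub>E I (D f)" "d \<in> Pi\<^sub>E I (D g)" by blast
        have "f x = g x" if x: "x \<in> I" for x
          using dyadic_disjoint[of "d x" j0 "f x" "g x"] PiE_mem[OF d(1) x] PiE_mem[OF d(2) x] rng[OF
              fg(1) x] rng[OF fg(2) x]
          by (simp add: D_def)
        moreover have "f \<in> I \<rightarrow>\<^sub>E {1..J}" "g \<in> I \<rightarrow>\<^sub>E {1..J}"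
          using fg G(1) by (auto simp: bridges_def below_def I_def)
        ultimately show False using fg(3) PiE_ext by metis
      qed
      have "real (card G) * ((2 * ln 2) ^ J * exp (- 1 / (1 - r)) / (1 + 4 * K))
          = (\<Sum>f\<in>G. (2 * ln 2) ^ J * exp (- 1 / (1 - r)) / (1 + 4 * K))"
        by simp
      also have "\<dots> \<le> (\<Sum>f\<in>G. \<Sum>d\<in>Pi\<^sub>E I (D f). w d)" by (rule sum_mono) (rule perf)
      also have "\<dots> = (\<Sum>d\<in>(\<Union>f\<in>G. Pi\<^sub>E I (D f)). w d)"
        using finG sub finU disj by (subst sum.UNION_disjoint) (auto intro: finite_subset)
      also have "\<dots> \<le> (\<Sum>d\<in>U. w d)" using finU sub w0 by (intro sum_mono2) auto
      also have "\<dots> = S J" by (simp add: S_def degree_sum_def U_def w_def I_def)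
      finally have SJ: "real (card G) * ((2 * ln 2) ^ J * exp (- 1 / (1 - r)) / (1 + 4 * K)) \<le> S J" .
      have "c1 * (real J ^ (J - 1) * (2 * ln 2) ^ J)
          = real J ^ (J - 1) / 12 * ((2 * ln 2) ^ J * exp (- 1 / (1 - r)) / (1 + 4 * K))"
        by (simp add: c1_def)
      also have "\<dots> \<le> real (card G) * ((2 * ln 2) ^ J * exp (- 1 / (1 - r)) / (1 + 4 * K))"
        using G(2) K ln2 by (intro mult_right_mono) auto
      finally have S1: "c1 * (real J ^ (J - 1) * (2 * ln 2) ^ J) \<le> S J" using SJ by linarith
      have Jp: "real J > 0" using J2 by simp
      have st: "fact J * exp 1 ^ J / (exp 1 * real J powr (3/2)) \<le> real J ^ (J - 1)"
      proof -
        have "fact J * exp (real J) \<le> exp 1 * real J ^ J * sqrt (real J)" using J2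
            by (intro fact_le_stirling) auto
        also have "\<dots> = real J ^ (J - 1) * (exp 1 * (real J * sqrt (real J)))"
          using J2 by (cases J) auto
        also have "real J * sqrt (real J) = real J powr (3/2)"
        proof -
          have "real J powr (3/2) = real J powr (1 + 1/2)" by simp
          also have "\<dots> = real J * sqrt (real J)" using Jp by (simp only: powr_add powr_half_sqrt) simp
          finally show ?thesis by simp
        qed
        finally show ?thesis using Jp by (simp add: divide_simps exp_of_nat_mult[symmetric] mult_ac)
      qed
      have J32: "real J powr (3/2) \<le> 2 powr (3/2) * (1 + ln (real b)) powr (3/2)"
      proof -
        have "ln (2 ^ J) \<le> ln (real b)"
        proof -
          have "1 * 2 ^ J \<le> M * 2 ^ J" using M by (intro mult_right_mono) auto
          then have "2 ^ J \<le> real b" using pw(1) by linarith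
          then show ?thesis using b by (subst ln_le_cancel_iff) auto
        qed
        then have "real J * ln 2 \<le> ln (real b)" by (simp add: ln_realpow)
        moreover have "real J * (1/2) \<le> real J * ln 2" using ln2 by (intro mult_left_mono) auto
        ultimately have "real J * (1/2) \<le> ln (real b)" by (rule order_trans[rotated])
        then have "real J \<le> 2 * (1 + ln (real b))" by simp
        then have "real J powr (3/2) \<le> (2 * (1 + ln (real b))) powr (3/2)" by (intro powr_mono2) auto
        also have "\<dots> = 2 powr (3/2) * (1 + ln (real b)) powr (3/2)" by (rule powr_mult)
        finally show ?thesis .
      qed
      have pk: "(2 * exp 1 * ln 2) ^ J \<ge> real b powr \<kappa> / (2 * M) powr \<kappa>"
      proof -
        have "real b powr \<kappa> \<le> (2 * M * 2 ^ J) powr \<kappa>" using pw(2) \<kappa> by (intro powr_mono2) auto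
        also have "\<dots> = (2 * M) powr \<kappa> * (2 ^ J) powr \<kappa>" using M by (simp add: powr_mult)
        also have "((2::real) ^ J) powr \<kappa> = (2 powr \<kappa>) ^ J"
          by (simp add: powr_realpow[symmetric] powr_powr mult.commute)
        also have "2 powr \<kappa> = 2 * exp 1 * ln 2" unfolding \<kappa>_def by (rule two_powr_exponent)
        finally show ?thesis using M by (simp add: field_simps)
      qed
      define Q where "Q = (1 + ln (real b)) powr (3/2)"
      have Q: "Q > 0" using lnb by (simp add: Q_def)
      have "c * fact J * (real b powr \<kappa> / Q) \<le> c2 * fact J * (real b powr \<kappa> / Q)"
        using c Q by (intro mult_right_mono) auto
      also have "\<dots> = c1 * (fact J * (real b powr \<kappa> / (2 * M) powr \<kappa>) / (exp 1 * (2 powr (3/2) * Q)))"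
        by (simp add: c2_def field_simps)
      also have "\<dots> \<le> c1 * (fact J * (2 * exp 1 * ln 2) ^ J / (exp 1 * real J powr (3/2)))"
        using c1 pk J32 Jp ln2 unfolding Q_def[symmetric]
        by (intro mult_left_mono frac_le) auto
      also have "\<dots> = c1 * (fact J * exp 1 ^ J / (exp 1 * real J powr (3/2)) * (2 * ln 2) ^ J)"
        by (simp add: power_mult_distrib)
      also have "\<dots> \<le> c1 * (real J ^ (J - 1) * (2 * ln 2) ^ J)"
        using st c1 ln2 by (intro mult_left_mono mult_right_mono) auto
      also have "\<dots> \<le> S J" by (rule S1)
      finally show ?thesis unfolding Q_def by blast
    qed
    then show "\<exists>J. degree_sum \<rho> J b
        \<ge> c * fact J * (real b powr (2 - delta) / (1 + ln (real b)) powr (3/2))"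
      by (simp add: S_def \<kappa>_def)
  qed
qed

section \<open>Multisets of primes\<close>

text \<open>The free commutative monoid on \<open>P\<close> with \<open>q^k\<close> elements of each
  degree \<open>k\<close>, that is, with zeta function \<open>1 / (1 - q * T)\<close>. The counting
  of primes needs nothing else about polynomials, and products become sums of multisets.\<close>

locale prime_system =
  fixes P :: "'p set" and dg :: "'p \<Rightarrow> nat" and q :: nat
  assumes q_ge_2: "2 \<le> q"
    and dg_ge_1: "p \<in> P \<Longrightarrow> 1 \<le> dg p"
    and card_mset_deg: "card {F. set_mset F \<subseteq> P \<and> (\<Sum>p\<in>#F. dg p) = k} = q ^ k"
begin

definition deg :: "'p multiset \<Rightarrow> nat" where
  "deg F = (\<Sum>p\<in>#F. dg p)"

definition elems :: "nat \<Rightarrow> 'p multiset set" where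
  "elems k = {F. set_mset F \<subseteq> P \<and> deg F = k}"

lemma deg_simps [simp]: "deg {#} = 0" "deg {#p#} = dg p" "deg (F + Y)
    = deg F + deg Y" "deg (add_mset p F) = dg p + deg F"
  by (simp_all add: deg_def)

lemma deg_diff: "D \<subseteq># F \<Longrightarrow> deg (F - D) = deg F - deg D"
  by (metis add_diff_cancel_left' deg_simps(3) subset_mset.add_diff_inverse)

lemma deg_mono: "D \<subseteq># F \<Longrightarrow> deg D \<le> deg F"
  by (metis deg_simps(3) le_add1 subset_mset.add_diff_inverse)

lemma deg_replicate_mset [simp]: "deg (replicate_mset i p) = i * dg p"
  by (induction i) auto

lemma deg_eq_sum_count: "finite A \<Longrightarrow> set_mset F \<subseteq> A \<Longrightarrow> deg F = (\<Sum>p\<in>A. count F p * dg p)"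
proof (induction F)
  case (add x F)
  have "(\<Sum>p\<in>A. count (add_mset x F) p * dg p) = (\<Sum>p\<in>A. count F p * dg p + (if p = x then dg x else 0))"
    by (intro sum.cong) (auto simp: algebra_simps)
  then show ?case using add by (simp add: sum.distrib sum.delta)
qed simp

lemma card_elems: "card (elems k) = q ^ k"
  using card_mset_deg[of k] by (simp add: elems_def deg_def)

lemma finite_elems: "finite (elems k)"
  using card_elems[of k] q_ge_2 by (metis card.infinite power_not_zero not_numeral_le_zero)

lemma dg_le_deg: "p \<in># F \<Longrightarrow> dg p \<le> deg F"
  using deg_mono[of "{#p#}" F] by simp

lemma finite_primes_deg: "finite {p \<in> P. dg p = j}"
proof (rule finite_imageD[where f = "\<lambda>p. {#p#}"])
  show "finite ((\<lambda>p. {#p#}) ` {p \<in> P. dg p = j})"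
    by (rule finite_subset[OF _ finite_elems[of j]]) (auto simp: elems_def)
qed (auto simp: inj_on_def)

lemma finite_primes_deg_le: "finite {p \<in> P. dg p \<le> j}"
proof -
  have "{p \<in> P. dg p \<le> j} = (\<Union>i\<in>{..j}. {p \<in> P. dg p = i})" by auto
  then show ?thesis using finite_primes_deg by simp
qed

lemma card_elems_superset:
  assumes "set_mset D \<subseteq> P"
  shows "card {F \<in> elems k. D \<subseteq># F} = (if deg D \<le> k then q ^ (k - deg D) else 0)"
proof (cases "deg D \<le> k")
  case True
  have "bij_betw (\<lambda>Y. D + Y) (elems (k - deg D)) {F \<in> elems k. D \<subseteq># F}"
  proof (rule bij_betw_byWitness[where f' = "\<lambda>F. F - D"])
    show "(\<lambda>F. F - D) ` {F \<in> elems k. D \<subseteq># F} \<subseteq> elems (k - deg D)"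
      by (auto simp: elems_def deg_diff dest: in_diffD)
  qed (use True assms in \<open>auto simp: elems_def\<close>)
  then show ?thesis using True bij_betw_same_card card_elems by metis
next
  case False
  then have "{F \<in> elems k. D \<subseteq># F} = {}" using deg_mono by (auto simp: elems_def)
  then show ?thesis using False by (simp only: if_False card.empty)
qed

text \<open>Both sides are the total degree of all elements of degree \<open>k\<close>.\<close>

lemma total_degree:
  assumes N: "k \<le> N"
  shows "k * q ^ k = (\<Sum>p\<in>{p\<in>P. dg p \<le> N}. \<Sum>i\<in>{1..N}. dg p * (if i * dg p
      \<le> k then q ^ (k - i * dg p) else 0))"
proof -
  let ?A = "{p\<in>P. dg p \<le> N}"
  have cnt: "count F p = (\<Sum>i\<in>{1..N}. of_bool (replicate_mset i p \<subseteq># F))" if F: "F \<in> elems k"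
      and p: "p \<in> ?A" for F p
  proof -
    have "count F p * 1 \<le> count F p * dg p" using dg_ge_1 p by (intro mult_left_mono) auto
    also have "\<dots> = deg (replicate_mset (count F p) p)" by simp
    also have "\<dots> \<le> deg F" by (intro deg_mono) (simp flip: count_le_replicate_mset_subset_eq)
    finally have le: "count F p \<le> N" using F N by (simp add: elems_def)
    have "(\<Sum>i\<in>{1..N}. of_bool (replicate_mset i p \<subseteq># F)) = card {i\<in>{1..N}. i \<le> count F p}"
      by (simp add: of_bool_def sum.If_cases Int_def count_le_replicate_mset_subset_eq)
    also have "{i\<in>{1..N}. i \<le> count F p} = {1..count F p}" using le by auto
    finally show ?thesis by simp
  qed
  have "k * q ^ k = (\<Sum>F\<in>elems k. deg F)"
  proof -
    have "(\<Sum>F\<in>elems k. deg F) = (\<Sum>F\<in>elems k. k)" by (intro sum.cong) (auto simp: elems_def)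
    then show ?thesis by (simp add: card_elems)
  qed
  also have "\<dots> = (\<Sum>F\<in>elems k. \<Sum>p\<in>?A. count F p * dg p)"
  proof (intro sum.cong refl deg_eq_sum_count)
    fix F assume "F \<in> elems k"
    then show "set_mset F \<subseteq> ?A" using dg_le_deg N by (fastforce simp: elems_def)
  qed (rule finite_primes_deg_le)
  also have "\<dots> = (\<Sum>F\<in>elems k. \<Sum>p\<in>?A. \<Sum>i\<in>{1..N}. dg p * of_bool (replicate_mset i p \<subseteq># F))"
    using cnt by (intro sum.cong refl) (simp add: sum_distrib_left mult.commute)
  also have "\<dots> = (\<Sum>p\<in>?A. \<Sum>F\<in>elems k. \<Sum>i\<in>{1..N}. dg p * of_bool (replicate_mset i p \<subseteq># F))"
    by (rule sum.swap)
  also have "\<dots> = (\<Sum>p\<in>?A. \<Sum>i\<in>{1..N}. \<Sum>F\<in>elems k. dg p * of_bool (replicate_mset i p \<subseteq># F))"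
    by (intro sum.cong refl sum.swap)
  also have "\<dots> = (\<Sum>p\<in>?A. \<Sum>i\<in>{1..N}. dg p * card {F\<in>elems k. replicate_mset i p \<subseteq># F})"
    using finite_elems by (simp add: sum_distrib_left[symmetric] of_bool_def sum.If_cases Int_def)
  also have "\<dots> = (\<Sum>p\<in>?A. \<Sum>i\<in>{1..N}. dg p * (if i * dg p \<le> k then q ^ (k - i * dg p) else 0))"
  proof (intro sum.cong refl)
    fix p i assume "p \<in> ?A"
    then have "set_mset (replicate_mset i p) \<subseteq> P" by (auto split: if_splits)
    then show "dg p * card {F\<in>elems k. replicate_mset i p \<subseteq># F} = dg p * (if i * dg p
        \<le> k then q ^ (k - i * dg p) else 0)"
      by (simp add: card_elems_superset)
  qed
  finally show ?thesis .
qed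

text \<open>Subtract \<open>q\<close> times \<open>total_degree\<close> for \<open>k\<close> from
  \<open>total_degree\<close> for \<open>Suc k\<close>: only the prime powers of degree exactly
  \<open>Suc k\<close> survive. The freedom in \<open>N\<close> lets both sums run over the same
  primes and exponents.\<close>

lemma von_mangoldt:
  "q ^ Suc k = (\<Sum>p\<in>{p\<in>P. dg p \<le> Suc k}. \<Sum>i\<in>{1..Suc k}. dg p * of_bool (i * dg p = Suc k))"
proof -
  let ?A = "{p\<in>P. dg p \<le> Suc k}"
  have "Suc k * q ^ Suc k = (\<Sum>p\<in>?A. \<Sum>i\<in>{1..Suc k}. dg p * (if i * dg p
      \<le> Suc k then q ^ (Suc k - i * dg p) else 0))"
    by (rule total_degree) simp
  also have "\<dots> = (\<Sum>p\<in>?A. \<Sum>i\<in>{1..Suc k}. q * (dg p * (if i * dg p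
      \<le> k then q ^ (k - i * dg p) else 0)) + dg p * of_bool (i * dg p = Suc k))"
    by (intro sum.cong refl) (auto simp: Suc_diff_le le_Suc_eq)
  also have "\<dots> = q * (\<Sum>p\<in>?A. \<Sum>i\<in>{1..Suc k}. dg p * (if i * dg p \<le> k then q ^ (k - i * dg p) else 0))
      + (\<Sum>p\<in>?A. \<Sum>i\<in>{1..Suc k}. dg p * of_bool (i * dg p = Suc k))"
    by (simp only: sum.distrib sum_distrib_left)
  also have "(\<Sum>p\<in>?A. \<Sum>i\<in>{1..Suc k}. dg p * (if i * dg p \<le> k then q ^ (k - i * dg p) else 0))
      = k * q ^ k"
    by (rule total_degree[symmetric]) simp
  finally show ?thesis by (simp add: algebra_simps)
qed

definition num_primes :: "nat \<Rightarrow> nat" where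
  "num_primes j = card {p \<in> P. dg p = j}"

lemma num_primes_le: "j * num_primes j \<le> q ^ j"
proof (cases j)
  case (Suc k)
  have "j * num_primes j = (\<Sum>p\<in>{p\<in>P. dg p = Suc k}. Suc k)" by (simp add: num_primes_def Suc)
  also have "\<dots> \<le> (\<Sum>p\<in>{p\<in>P. dg p = Suc k}. \<Sum>i\<in>{1..Suc k}. dg p * of_bool (i * dg p = Suc k))"
  proof (rule sum_mono)
    fix p assume p: "p \<in> {p\<in>P. dg p = Suc k}"
    have "dg p * of_bool (1 * dg p = Suc k) \<le> (\<Sum>i\<in>{1..Suc k}. dg p * of_bool (i * dg p = Suc k))"
      by (rule member_le_sum) auto
    moreover have "dg p * of_bool (1 * dg p = Suc k) = Suc k" using p by simp
    ultimately show "Suc k \<le> (\<Sum>i\<in>{1..Suc k}. dg p * of_bool (i * dg p = Suc k))" by (simp only:)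
  qed
  also have "\<dots> \<le> (\<Sum>p\<in>{p\<in>P. dg p \<le> Suc k}. \<Sum>i\<in>{1..Suc k}. dg p * of_bool (i * dg p = Suc k))"
    by (rule sum_mono2[OF finite_primes_deg_le]) auto
  also have "\<dots> = q ^ j" using von_mangoldt[of k] Suc by simp
  finally show ?thesis .
qed simp

lemma sum_power_q: "(\<Sum>d\<in>{1..h}. q ^ d) + 2 \<le> 2 * q ^ h"
proof (induction h)
  case (Suc h)
  have "2 * q ^ h \<le> q * q ^ h" using q_ge_2 by (rule mult_right_mono) simp
  moreover have "(\<Sum>d\<in>{1..Suc h}. q ^ d) = (\<Sum>d\<in>{1..h}. q ^ d) + q * q ^ h" by simp
  ultimately show ?case using Suc unfolding power_Suc by linarith
qed simp

text \<open>Proper prime powers of degree \<open>j\<close> come from primes of degree at most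
  \<open>j div 2\<close>, each contributing at most once, and \<open>sum_power_q\<close> bounds
  their total. The surplus \<open>2\<close> is kept because \<open>num_primes_ge_half\<close> needs
  it when \<open>q^j\<close> is small.\<close>

lemma num_primes_ge: "1 \<le> j \<Longrightarrow> q ^ j + 2 \<le> j * num_primes j + 2 * q ^ (j div 2)"
proof -
  assume "1 \<le> j"
  then obtain k where j: "j = Suc k" by (cases j) auto
  let ?A = "{p\<in>P. dg p \<le> j}"
  have "q ^ j = (\<Sum>p\<in>?A. \<Sum>i\<in>{1..j}. dg p * of_bool (i * dg p = j))"
    unfolding j by (rule von_mangoldt)
  also have "\<dots> \<le> (\<Sum>p\<in>?A. (if dg p = j then j else 0) + (if dg p \<le> j div 2 then dg p else 0))"
  proof (rule sum_mono)
    fix p assume p: "p \<in> ?A"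
    then have dp: "dg p \<ge> 1" using dg_ge_1 by auto
    have one: "(\<Sum>i\<in>{1..j}. dg p * of_bool (i * dg p = j)) \<le> (if \<exists>i\<in>{1..j}. i * dg p
        = j then dg p else 0)"
    proof -
      have "(\<Sum>i\<in>{1..j}. dg p * of_bool (i * dg p = j)) \<le> (\<Sum>i\<in>{1..j}. if i
          = j div dg p then (if \<exists>i\<in>{1..j}. i * dg p = j then dg p else 0) else 0)"
        using dp by (intro sum_mono) auto
      also have "\<dots> \<le> (if \<exists>i\<in>{1..j}. i * dg p = j then dg p else 0)" by (simp add: sum.delta)
      finally show ?thesis .
    qed
    have "dg p = j \<or> dg p \<le> j div 2" if i: "i \<in> {1..j}" "i * dg p = j" for i
    proof (cases "i = 1")
      case False
      then have "2 * dg p \<le> i * dg p" using i by (intro mult_right_mono) auto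
      then show ?thesis using i by auto
    qed (use i in auto)
    with one show "(\<Sum>i\<in>{1..j}. dg p * of_bool (i * dg p = j)) \<le> (if dg p
        = j then j else 0) + (if dg p \<le> j div 2 then dg p else 0)"
      by (auto split: if_splits)
  qed
  also have "\<dots> = (\<Sum>p\<in>{p\<in>P. dg p = j}. j) + (\<Sum>p\<in>{p\<in>P. dg p \<le> j div 2}. dg p)"
    unfolding sum.distrib
    by (intro arg_cong2[where f="(+)"] sum.mono_neutral_cong_right finite_primes_deg_le) auto
  also have "(\<Sum>p\<in>{p\<in>P. dg p \<le> j div 2}. dg p) = (\<Sum>d\<in>{1..j div 2}. \<Sum>p\<in>{p\<in>{p\<in>P. dg p \<le> j div 2}. dg p
      = d}. dg p)"
    using dg_ge_1 by (intro sum.group[symmetric] finite_primes_deg_le) auto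
  also have "\<dots> = (\<Sum>d\<in>{1..j div 2}. d * num_primes d)"
  proof (rule sum.cong[OF refl])
    fix d assume d: "d \<in> {1..j div 2}"
    then have "{p\<in>{p\<in>P. dg p \<le> j div 2}. dg p = d} = {p\<in>P. dg p = d}" by auto
    then show "(\<Sum>p\<in>{p\<in>{p\<in>P. dg p \<le> j div 2}. dg p = d}. dg p) = d * num_primes d"
        by (simp add: num_primes_def)
  qed
  also have "\<dots> \<le> (\<Sum>d\<in>{1..j div 2}. q ^ d)" by (intro sum_mono num_primes_le)
  finally have "q ^ j \<le> j * num_primes j + (\<Sum>d\<in>{1..j div 2}. q ^ d)"
      by (simp add: num_primes_def mult.commute)
  then show ?thesis using sum_power_q[of "j div 2"] by linarith
qed

lemma num_primes_ge_half: "1 \<le> j \<Longrightarrow> q ^ j \<le> 2 * (j * num_primes j)"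
proof -
  assume j: "1 \<le> j"
  define x where "x = real (q ^ (j div 2))"
  have "q ^ (2 * (j div 2)) \<le> q ^ j" using q_ge_2 by (intro power_increasing) auto
  then have "real ((q ^ (j div 2))\<^sup>2) \<le> real (q ^ j)"
      by (simp only: of_nat_le_iff power_mult[symmetric] mult.commute)
  then have "x\<^sup>2 \<le> real (q ^ j)" by (simp add: x_def)
  moreover have "0 \<le> (x - 2)\<^sup>2" by simp
  ultimately have "4 * x \<le> real (q ^ j) + 4" by (simp add: power2_eq_square algebra_simps)
  then have "4 * q ^ (j div 2) \<le> q ^ j + 4" unfolding x_def by linarith
  then show ?thesis using num_primes_ge[OF j] by linarith
qed

lemma num_primes_density_le: "1 \<le> j \<Longrightarrow> real (num_primes j) / real q ^ j \<le> 1 / real j"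
proof -
  assume j: "1 \<le> j"
  have "real (j * num_primes j) \<le> real (q ^ j)" using num_primes_le[of j] by (simp only: of_nat_le_iff)
  then show ?thesis using j q_ge_2 by (simp add: field_simps)
qed

text \<open>The error \<open>2 * q^(j div 2)\<close> is much smaller; it is weakened to
  \<open>4 / j^2\<close> to be merged later with the term \<open>C / j^(1 + \<epsilon>)\<close> that
  accounts for the divisors of \<open>M\<close>.\<close>

lemma num_primes_density_ge: "1 \<le> j \<Longrightarrow> 1 / real j - 4 / real j ^ 2 \<le> real (num_primes j) / real q ^ j"
proof -
  assume j: "1 \<le> j"
  define h where "h = j div 2"
  have hj: "h \<le> j" "j \<le> 2 * (j - h)" by (auto simp: h_def)
  have "real (q ^ j) \<le> real (j * num_primes j + 2 * q ^ h)"
    unfolding of_nat_le_iff h_def using num_primes_ge[OF j] by linarith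
  then have 1: "real q ^ j \<le> real j * real (num_primes j) + 2 * real q ^ h" by simp
  have "real j * real q ^ h \<le> 2 * real q ^ j"
  proof -
    have "j - h < 2 ^ (j - h)" by (rule less_exp)
    also have "(2::nat) ^ (j - h) \<le> q ^ (j - h)" using q_ge_2 by (intro power_mono) auto
    finally have "j \<le> 2 * q ^ (j - h)" using hj by linarith
    then have "j * q ^ h \<le> 2 * q ^ (j - h) * q ^ h" by (rule mult_right_mono) simp
    also have "\<dots> = 2 * q ^ j" using hj by (simp flip: power_add)
    finally have "real (j * q ^ h) \<le> real (2 * q ^ j)" by (simp only: of_nat_le_iff)
    then show ?thesis by simp
  qed
  then have "real j * real q ^ j \<le> real j * (real j * real (num_primes j)) + 4 * real q ^ j"
    using mult_left_mono[OF 1, of "real j"] by (simp add: algebra_simps)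
  then have "(real j - 4) * real q ^ j \<le> real j ^ 2 * real (num_primes j)"
      by (simp add: power2_eq_square algebra_simps)
  then have "(real j - 4) / real j ^ 2 \<le> real (num_primes j) / real q ^ j" using j q_ge_2
      by (simp add: divide_simps mult_ac)
  moreover have "(real j - 4) / real j ^ 2 = 1 / real j - 4 / real j ^ 2" using j
      by (simp add: diff_divide_distrib power2_eq_square)
  ultimately show ?thesis by simp
qed

end

lemma sum_inverse_le_ln: "1 \<le> z \<Longrightarrow> (\<Sum>j\<in>{1..z}. 1 / real j) \<le> 1 + ln (real z)"
proof (induction z rule: dec_induct)
  case (step z)
  have z: "real z > 0" using step by simp
  have "ln (real z / real (Suc z)) \<le> real z / real (Suc z) - 1" using z by (intro ln_le_minus_one) auto
  moreover have "real z / real (Suc z) - 1 = - 1 / real (Suc z)" by (simp add: field_simps)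
  ultimately have "1 / real (Suc z) \<le> ln (real (Suc z)) - ln (real z)" using z by (simp add: ln_div)
  moreover have "(\<Sum>j\<in>{1..Suc z}. 1 / real j) = (\<Sum>j\<in>{1..z}. 1 / real j) + 1 / real (Suc z)" by simp
  ultimately show ?case using step.IH by linarith
qed simp

section \<open>A lower bound sieve in arithmetic progressions\<close>

text \<open>\<open>Q F\<close> stands for \<open>F \<equiv> A\<close> modulo \<open>M\<close>,
  \<open>PM\<close> for the irreducibles dividing \<open>M\<close> and \<open>dM\<close> for its
  degree. A fixed factor \<open>D\<close> prime to \<open>M\<close> only moves the residue class, so
  \<open>card_ap\<close> is exact from degree \<open>dM\<close> on.\<close>

locale prime_system_ap = prime_system +
  fixes PM :: "'a set" and dM :: nat and Q :: "'a multiset \<Rightarrow> bool"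
  assumes PM_subset: "PM \<subseteq> P"
    and dg_PM: "p \<in> PM \<Longrightarrow> dg p \<le> dM"
    and card_ap: "set_mset D \<subseteq> P - PM \<Longrightarrow> dM \<le> m \<Longrightarrow> card {F \<in> elems m. Q (D + F)} = q ^ (m - dM)"
    and ap_coprime: "Q F \<Longrightarrow> set_mset F \<inter> PM = {}"
begin

definition dens :: "'a \<Rightarrow> real" where
  "dens p = 1 / real q ^ dg p"

lemma dens_pos: "0 < dens p" using q_ge_2 by (simp add: dens_def)

lemma dens_nonneg [simp]: "0 \<le> dens p" by (simp add: dens_def)

lemma dens_le_half: "p \<in> P \<Longrightarrow> dens p \<le> 1/2"
proof -
  assume "p \<in> P"
  then have "(2::real) ^ 1 \<le> 2 ^ dg p" using dg_ge_1 by (intro power_increasing) auto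
  also have "\<dots> \<le> real q ^ dg p" using q_ge_2 by (intro power_mono) auto
  finally show ?thesis by (simp add: dens_def divide_simps)
qed

text \<open>The prescribed divisor \<open>d\<close> is carried along because Buchstab's identity
  trades a newly sieved prime for a larger \<open>d\<close>.\<close>

definition sieved :: "'a multiset \<Rightarrow> nat \<Rightarrow> 'a multiset \<Rightarrow> 'a set \<Rightarrow> 'a multiset set" where
  "sieved D m d T = {F \<in> elems m. Q (D + F) \<and> d \<subseteq># F \<and> set_mset F \<inter> T = {}}"

lemma finite_sieved: "finite (sieved D m d T)"
  unfolding sieved_def using finite_elems by simp

lemma card_sieved_empty:
  assumes "set_mset D \<subseteq> P - PM" "set_mset d \<subseteq> P - PM" "dM + deg d \<le> m"
  shows "card (sieved D m d {}) = q ^ (m - dM - deg d)"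
proof -
  have "bij_betw (\<lambda>Y. d + Y) {Y \<in> elems (m - deg d). Q ((D + d) + Y)} (sieved D m d {})"
  proof (rule bij_betw_byWitness[where f' = "\<lambda>F. F - d"])
    show "(\<lambda>Y. d + Y) ` {Y \<in> elems (m - deg d). Q ((D + d) + Y)} \<subseteq> sieved D m d {}"
      using assms by (auto simp: sieved_def elems_def add.assoc)
    show "(\<lambda>F. F - d) ` sieved D m d {} \<subseteq> {Y \<in> elems (m - deg d). Q ((D + d) + Y)}"
      by (auto simp: sieved_def elems_def deg_diff add.assoc dest: in_diffD)
  qed (auto simp: sieved_def)
  then have "card (sieved D m d {}) = card {Y \<in> elems (m - deg d). Q ((D + d) + Y)}"
    by (metis bij_betw_same_card)
  also have "\<dots> = q ^ (m - deg d - dM)" using assms by (intro card_ap) auto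
  finally show ?thesis by (simp add: diff_commute add.commute)
qed

lemma buchstab_identity:
  assumes "p \<notin># d" "p \<notin> T"
  shows "real (card (sieved D m d (insert p T)))
      = real (card (sieved D m d T)) - real (card (sieved D m (add_mset p d) T))"
proof -
  have *: "add_mset p d \<subseteq># F \<longleftrightarrow> d \<subseteq># F \<and> p \<in># F" for F
  proof
    assume "add_mset p d \<subseteq># F"
    then show "d \<subseteq># F \<and> p \<in># F" using mset_subset_eq_insertD by (metis subset_mset.less_imp_le)
  next
    assume F: "d \<subseteq># F \<and> p \<in># F"
    show "add_mset p d \<subseteq># F"
    proof (rule mset_subset_eqI)
      fix a
      have "count d p = 0" using assms(1) by (simp add: not_in_iff)
      moreover have "1 \<le> count F p" using F by (simp add: Suc_le_eq)
      moreover have "count d a \<le> count F a" using F by (simp add: mset_subset_eq_count)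
      ultimately show "count (add_mset p d) a \<le> count F a" by auto
    qed
  qed
  have "sieved D m d T = sieved D m d (insert p T) \<union> sieved D m (add_mset p d) T"
    unfolding sieved_def * by auto
  moreover have "sieved D m d (insert p T) \<inter> sieved D m (add_mset p d) T = {}"
    unfolding sieved_def * by auto
  ultimately have "card (sieved D m d T) = card (sieved D m d (insert p T))
      + card (sieved D m (add_mset p d) T)"
    using finite_sieved by (metis card_Un_disjoint)
  then show ?thesis by simp
qed

definition sieve_prod :: "'a set \<Rightarrow> real" where
  "sieve_prod T = (\<Prod>p\<in>T. 1 - dens p)"

text \<open>\<open>w\<close> is the largest degree sieved so far and \<open>y\<close> the remaining level. The product over the primes of
  degree \<open>w\<close> absorbs one more Buchstab step at the same degree. It is at most \<open>exp (8 / w)\<close>, which the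
  exponential gains back on passing from \<open>w\<close> to \<open>w + 1\<close> as long as \<open>y \<ge> 8 (w + 1)\<close>. For \<open>y < 9 w\<close> the
  factor \<open>exp 9\<close> makes the lower bound trivial.\<close>

definition sieve_err :: "nat \<Rightarrow> 'a set \<Rightarrow> real \<Rightarrow> real" where
  "sieve_err w T y = exp 9 * sieve_prod T * (\<Prod>p\<in>{p\<in>T. dg p = w}. 1 + 8 * dens p) * exp (- y / real w)"

text \<open>The upper bound is asked for only from \<open>y >= 8 * w\<close> on. A Buchstab step
  lowers the level by \<open>w\<close>, so the lower bound for \<open>y >= 9 * w\<close> needs no
  more, and below \<open>9 * w\<close> it is trivial. All \<open>d\<close> are treated at once since
  the step changes \<open>d\<close>; \<open>y\<close> is a real difference and may be
  negative.\<close>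

definition sieve_bounds :: "'a multiset \<Rightarrow> nat \<Rightarrow> nat \<Rightarrow> 'a set \<Rightarrow> bool" where
  "sieve_bounds D m w T \<longleftrightarrow> (\<forall>d. set_mset d \<subseteq> P - PM \<longrightarrow> set_mset d \<inter> T = {} \<longrightarrow>
     (let y = real (m - dM) - real (deg d); R = real q ^ (m - dM) / real q ^ deg d; S
         = real (card (sieved D m d T))
      in R * (sieve_prod T - sieve_err w T y) \<le> S \<and> (8 * real w \<le> y
          \<longrightarrow> S \<le> R * (sieve_prod T + sieve_err w T y))))"

lemma sieve_prod_pos: "T \<subseteq> P \<Longrightarrow> 0 < sieve_prod T"
  unfolding sieve_prod_def using dens_le_half by (intro prod_pos) (force)

lemma sieve_err_trivial:
  assumes "T \<subseteq> P" "1 \<le> w" "y < 9 * real w"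
  shows "sieve_prod T \<le> sieve_err w T y"
proof -
  have "1 \<le> exp (9 - y / real w)" using assms by (simp add: field_simps)
  moreover have "1 \<le> (\<Prod>p\<in>{p\<in>T. dg p = w}. 1 + 8 * dens p)" using dens_pos
      by (intro prod_ge_1) (auto intro: less_imp_le)
  ultimately have "1 * 1 \<le> exp (9 - y / real w) * (\<Prod>p\<in>{p\<in>T. dg p = w}. 1 + 8 * dens p)"
    by (intro mult_mono) auto
  then have "sieve_prod T * 1 \<le> sieve_prod T * (exp (9 - y / real w) * (\<Prod>p\<in>{p\<in>T. dg p
      = w}. 1 + 8 * dens p))"
    using sieve_prod_pos[OF assms(1)] by (intro mult_left_mono) auto
  then show ?thesis by (simp add: sieve_err_def exp_diff exp_minus divide_inverse mult_ac)
qed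

lemma sieve_err_nonneg: "T \<subseteq> P \<Longrightarrow> 0 \<le> sieve_err w T y"
  unfolding sieve_err_def using sieve_prod_pos[of T] dens_pos
  by (intro mult_nonneg_nonneg prod_nonneg) (auto intro: less_imp_le add_nonneg_nonneg)

lemma sieve_bounds_insert:
  assumes SB: "sieve_bounds D m w T" and T: "T \<subseteq> P - PM" "finite T"
      and p: "p \<in> P - PM" "p \<notin> T" "dg p = w"
  shows "sieve_bounds D m w (insert p T)"
  unfolding sieve_bounds_def Let_def
proof (intro allI impI)
  fix d assume d: "set_mset d \<subseteq> P - PM" "set_mset d \<inter> insert p T = {}"
  define y where "y = real (m - dM) - real (deg d)"
  define R where "R = real q ^ (m - dM) / real q ^ deg d"
  define x where "x = dens p"
  define T' where "T' = insert p T"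
  define S where "S = real (card (sieved D m d T'))"
  define S0 where "S0 = real (card (sieved D m d T))"
  define S1 where "S1 = real (card (sieved D m (add_mset p d) T))"
  have w: "1 \<le> w" using p dg_ge_1 by auto
  have x: "0 < x" "x \<le> 1/2" using dens_pos dens_le_half p by (auto simp: x_def)
  have R: "R > 0" using q_ge_2 by (simp add: R_def)
  have SS: "S = S0 - S1" unfolding S_def S0_def S1_def T'_def using d p
      by (intro buchstab_identity) auto
  have R1: "real q ^ (m - dM) / real q ^ deg (add_mset p d) = R * x"
    by (simp add: R_def x_def dens_def power_add)
  have y1: "real (m - dM) - real (deg (add_mset p d)) = y - real w" using p by (simp add: y_def)
  have b0: "R * (sieve_prod T - sieve_err w T y) \<le> S0" "8 * real w \<le> y
      \<Longrightarrow> S0 \<le> R * (sieve_prod T + sieve_err w T y)"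
    using SB d unfolding sieve_bounds_def Let_def by (auto simp: y_def R_def S0_def)
  have pd: "set_mset (add_mset p d) \<subseteq> P - PM" "set_mset (add_mset p d) \<inter> T = {}" using d p by auto
  have b1: "R * x * (sieve_prod T - sieve_err w T (y - real w)) \<le> S1"
     "8 * real w \<le> y - real w \<Longrightarrow> S1 \<le> R * x * (sieve_prod T + sieve_err w T (y - real w))"
    using SB[unfolded sieve_bounds_def Let_def, rule_format, OF pd] unfolding y1 R1 S1_def by auto
  define E where "E = sieve_err w T y"
  have E0: "E \<ge> 0" unfolding E_def using T by (intro sieve_err_nonneg) auto
  have Ey: "sieve_err w T (y - real w) = exp 1 * E"
  proof -
    have "- (y - real w) / real w = 1 + (- y / real w)" using w by (simp add: field_simps)
    then have "exp (- (y - real w) / real w) = exp 1 * exp (- y / real w)" by (simp only: exp_add)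
    then show ?thesis by (simp add: E_def sieve_err_def)
  qed
  have V: "sieve_prod T' = (1 - x) * sieve_prod T" unfolding sieve_prod_def T'_def x_def using T p
      by simp
  have E': "sieve_err w T' y = (1 - x) * (1 + 8 * x) * E"
  proof -
    have "{r \<in> T'. dg r = w} = insert p {r \<in> T. dg r = w}" using p by (auto simp: T'_def)
    then show ?thesis unfolding sieve_err_def V E_def using T p by (simp add: x_def)
  qed
  \<comment> \<open>\<open>(1 - x) * (1 + 8 * x) = 1 + 7 * x - 8 * x^2\<close> is at least
    \<open>1 + 3 * x\<close> for \<open>x <= 1/2\<close>, hence at least \<open>1 + e * x\<close>.
    This is what the factor \<open>8\<close> in \<open>sieve_err\<close> is for.\<close>
  have key: "E + x * (exp 1 * E) \<le> sieve_err w T' y"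
  proof -
    have "x * exp 1 \<le> x * 3" using x exp_le by (intro mult_left_mono) auto
    moreover have "x * x \<le> x * (1/2)" using x by (intro mult_left_mono) auto
    ultimately have "1 + x * exp 1 \<le> (1 - x) * (1 + 8 * x)" by (simp add: algebra_simps)
    then have "(1 + x * exp 1) * E \<le> (1 - x) * (1 + 8 * x) * E" using E0 by (rule mult_right_mono)
    then show ?thesis unfolding E' by (simp add: algebra_simps)
  qed
  have lower: "R * (sieve_prod T' - sieve_err w T' y) \<le> S"
  proof (cases "y < 9 * real w")
    case True
    have "sieve_prod T' \<le> sieve_err w T' y" using T p w True
        by (intro sieve_err_trivial) (auto simp: T'_def)
    then have "R * (sieve_prod T' - sieve_err w T' y) \<le> 0" using R by (simp add: mult_le_0_iff)
    then show ?thesis by (simp add: S_def)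
  next
    case False
    have "R * (sieve_prod T' - sieve_err w T' y) \<le> R * (sieve_prod T' - (E + x * (exp 1 * E)))"
      using key R by (intro mult_left_mono) auto
    also have "\<dots> = R * (sieve_prod T - E) - R * x * (sieve_prod T + exp 1 * E)" unfolding V
        by (simp add: algebra_simps)
    also have "\<dots> \<le> S0 - S1" using b0(1) b1(2) False unfolding Ey E_def[symmetric]
        by (intro diff_mono) auto
    finally show ?thesis using SS by simp
  qed
  have upper: "S \<le> R * (sieve_prod T' + sieve_err w T' y)" if "8 * real w \<le> y"
  proof -
    have "S \<le> R * (sieve_prod T + E) - R * x * (sieve_prod T - exp 1 * E)"
      using b0(2)[OF that] b1(1) SS unfolding Ey E_def[symmetric] by linarith
    also have "\<dots> = R * (sieve_prod T' + (E + x * (exp 1 * E)))" unfolding V by (simp add: algebra_simps)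
    also have "\<dots> \<le> R * (sieve_prod T' + sieve_err w T' y)" using key R by (intro mult_left_mono) auto
    finally show ?thesis .
  qed
  show "real q ^ (m - dM) / real q ^ deg d * (sieve_prod (insert p T)
      - sieve_err w (insert p T) (real (m - dM) - real (deg d)))
      \<le> real (card (sieved D m d (insert p T))) \<and>
      (8 * real w \<le> real (m - dM) - real (deg d) \<longrightarrow> real (card (sieved D m d (insert p T)))
      \<le> real q ^ (m - dM) / real q ^ deg d * (sieve_prod (insert p T)
          + sieve_err w (insert p T) (real (m - dM) - real (deg d))))"
    using lower upper unfolding S_def R_def y_def T'_def by blast
qed

lemma sum_dens_eq_le:
  assumes "1 \<le> w" "T \<subseteq> {p \<in> P. dg p = w}"
  shows "(\<Sum>p\<in>T. dens p) \<le> 1 / real w"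
proof -
  have "(\<Sum>p\<in>T. dens p) \<le> (\<Sum>p\<in>{p \<in> P. dg p = w}. dens p)"
    using assms finite_primes_deg dens_pos by (intro sum_mono2) (auto intro: less_imp_le)
  also have "\<dots> = real (num_primes w) / real q ^ w" by (simp add: dens_def num_primes_def)
  also have "\<dots> \<le> 1 / real w" using assms by (intro num_primes_density_le) auto
  finally show ?thesis .
qed

lemma prod_err_le:
  assumes "1 \<le> w" "T \<subseteq> P"
  shows "(\<Prod>p\<in>{p\<in>T. dg p = w}. 1 + 8 * dens p) \<le> exp (8 / real w)"
proof -
  have "(\<Prod>p\<in>{p\<in>T. dg p = w}. 1 + 8 * dens p) \<le> (\<Prod>p\<in>{p\<in>T. dg p = w}. exp (8 * dens p))"
    using dens_pos by (intro prod_mono conjI exp_ge_add_one_self) (auto intro: less_imp_le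
        add_nonneg_nonneg)
  also have "\<dots> = exp (8 * (\<Sum>p\<in>{p\<in>T. dg p = w}. dens p))"
    using assms finite_subset[OF _ finite_primes_deg[of w], of "{p\<in>T. dg p = w}"]
    by (subst exp_sum[symmetric]) (auto simp: sum_distrib_left)
  also have "\<dots> \<le> exp (8 * (1 / real w))"
  proof -
    have "(\<Sum>p\<in>{p\<in>T. dg p = w}. dens p) \<le> 1 / real w"
      by (rule sum_dens_eq_le) (use assms in auto)
    then show ?thesis by simp
  qed
  finally show ?thesis by simp
qed

lemma sieve_bounds_next:
  assumes SB: "sieve_bounds D m w T" and T: "T \<subseteq> P - PM" "\<And>p. p \<in> T \<Longrightarrow> dg p \<le> w" and w: "1 \<le> w"
  shows "sieve_bounds D m (Suc w) T"
  unfolding sieve_bounds_def Let_def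
proof (intro allI impI)
  fix d assume d: "set_mset d \<subseteq> P - PM" "set_mset d \<inter> T = {}"
  define y where "y = real (m - dM) - real (deg d)"
  define R where "R = real q ^ (m - dM) / real q ^ deg d"
  define S where "S = real (card (sieved D m d T))"
  have TP: "T \<subseteq> P" using T by auto
  have R: "R > 0" using q_ge_2 by (simp add: R_def)
  have b0: "R * (sieve_prod T - sieve_err w T y) \<le> S" "8 * real w \<le> y
      \<Longrightarrow> S \<le> R * (sieve_prod T + sieve_err w T y)"
    using SB d unfolding sieve_bounds_def Let_def by (auto simp: y_def R_def S_def)
  have mono: "sieve_err w T y \<le> sieve_err (Suc w) T y" if y: "8 * real (Suc w) \<le> y"
  proof -
    have e: "{p\<in>T. dg p = Suc w} = {}" using T(2) by fastforce
    \<comment> \<open>Raising \<open>w\<close> by one gains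
      \<open>y / (w * (w + 1)) >= 8 / w\<close> in the exponent, which pays for the product over the
      primes of degree \<open>w\<close>; the product for \<open>w + 1\<close> is still
      empty.\<close>
    have "8 / real w - y / real w \<le> - y / real (Suc w)"
    proof -
      have "y / real w - y / real (Suc w) = y / real (Suc w) / real w" using w
          by (simp add: field_simps)
      moreover have "8 / real w \<le> y / real (Suc w) / real w"
        using y w by (intro divide_right_mono) (auto simp: pos_le_divide_eq)
      ultimately show ?thesis by simp
    qed
    then have "exp (8 / real w) * exp (- y / real w) \<le> exp (- y / real (Suc w))" by (simp flip: exp_add)
    moreover have "(\<Prod>p\<in>{p\<in>T. dg p = w}. 1 + 8 * dens p) * exp (- y / real w)
        \<le> exp (8 / real w) * exp (- y / real w)"
      using prod_err_le[OF w TP] by (intro mult_right_mono) auto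
    ultimately have "(\<Prod>p\<in>{p\<in>T. dg p = w}. 1 + 8 * dens p) * exp (- y / real w)
        \<le> exp (- y / real (Suc w))" by linarith
    then have "exp 9 * sieve_prod T * ((\<Prod>p\<in>{p\<in>T. dg p = w}. 1 + 8 * dens p) * exp (- y / real w))
        \<le> exp 9 * sieve_prod T * exp (- y / real (Suc w))"
      using sieve_prod_pos[OF TP] by (intro mult_left_mono) auto
    then show ?thesis unfolding sieve_err_def e by (simp add: mult_ac)
  qed
  have lower: "R * (sieve_prod T - sieve_err (Suc w) T y) \<le> S"
  proof (cases "y < 9 * real (Suc w)")
    case True
    have "sieve_prod T \<le> sieve_err (Suc w) T y" using TP True by (intro sieve_err_trivial) auto
    then have "R * (sieve_prod T - sieve_err (Suc w) T y) \<le> 0" using R by (simp add: mult_le_0_iff)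
    then show ?thesis by (simp add: S_def)
  next
    case False
    then have "R * (sieve_prod T - sieve_err (Suc w) T y) \<le> R * (sieve_prod T - sieve_err w T y)"
      using R by (intro mult_left_mono diff_left_mono mono) auto
    then show ?thesis using b0(1) by linarith
  qed
  have upper: "S \<le> R * (sieve_prod T + sieve_err (Suc w) T y)" if y: "8 * real (Suc w) \<le> y"
  proof -
    have "S \<le> R * (sieve_prod T + sieve_err w T y)" using y by (intro b0(2)) auto
    also have "\<dots> \<le> R * (sieve_prod T + sieve_err (Suc w) T y)" using R
        by (intro mult_left_mono add_left_mono mono y) auto
    finally show ?thesis .
  qed
  show "real q ^ (m - dM) / real q ^ deg d * (sieve_prod T - sieve_err (Suc w) T (real (m - dM)
      - real (deg d)))
      \<le> real (card (sieved D m d T)) \<and>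
      (8 * real (Suc w) \<le> real (m - dM) - real (deg d) \<longrightarrow> real (card (sieved D m d T))
      \<le> real q ^ (m - dM) / real q ^ deg d * (sieve_prod T + sieve_err (Suc w) T (real (m - dM)
          - real (deg d))))"
    using lower upper unfolding S_def R_def y_def by blast
qed

lemma sieve_bounds_add_degree:
  assumes SB: "sieve_bounds D m w T" and T: "T \<subseteq> P - PM" "finite T" "\<And>p. p \<in> T \<Longrightarrow> dg p < w"
  shows "sieve_bounds D m w (T \<union> {p \<in> P - PM. dg p = w})"
proof -
  have "finite B \<Longrightarrow> B \<subseteq> {p \<in> P - PM. dg p = w} \<Longrightarrow> sieve_bounds D m w (T \<union> B)" for B
  proof (induction B rule: finite_induct)
    case (insert p B)
    have "sieve_bounds D m w (insert p (T \<union> B))"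
      using insert T by (intro sieve_bounds_insert) auto
    then show ?case by simp
  qed (use SB in simp)
  moreover have "finite {p \<in> P - PM. dg p = w}"
      by (rule finite_subset[OF _ finite_primes_deg[of w]]) auto
  ultimately show ?thesis by blast
qed

lemma sieve_bounds_all:
  assumes D: "set_mset D \<subseteq> P - PM" and m: "dM \<le> m" and z: "1 \<le> z"
  shows "sieve_bounds D m z {p \<in> P - PM. dg p \<le> z}"
  using z
proof (induction z rule: dec_induct)
  case base
  have "sieve_bounds D m 1 {}"
    unfolding sieve_bounds_def Let_def
  proof (intro allI impI)
    fix d assume d: "set_mset d \<subseteq> P - PM"
    define y where "y = real (m - dM) - real (deg d)"
    define R where "R = real q ^ (m - dM) / real q ^ deg d"
    define S where "S = real (card (sieved D m d {}))"
    have R: "R > 0" using q_ge_2 by (simp add: R_def)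
    have V: "sieve_prod {} = 1" by (simp add: sieve_prod_def)
    have E0: "sieve_err 1 {} y \<ge> 0" by (rule sieve_err_nonneg) simp
    \<comment> \<open>Without sieving the count is exact as soon as the cofactor of \<open>d\<close>
      has degree at least \<open>dM\<close>; at lower levels the lower bound is trivial and no upper
      bound is claimed.\<close>
    have ex: "S = R" if "y \<ge> 0"
    proof -
      have le: "deg d \<le> m - dM" using that by (simp add: y_def)
      then have "S = real q ^ (m - dM - deg d)" unfolding S_def using D d m
          by (subst card_sieved_empty) auto
      also have "\<dots> = R" unfolding R_def using le q_ge_2 by (intro power_diff) auto
      finally show ?thesis .
    qed
    have lower: "R * (sieve_prod {} - sieve_err 1 {} y) \<le> S"
    proof (cases "y < 9 * real 1")
      case True
      have "sieve_prod {} \<le> sieve_err 1 {} y" using True by (intro sieve_err_trivial) auto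
      then have "R * (sieve_prod {} - sieve_err 1 {} y) \<le> 0" using R by (simp add: mult_le_0_iff)
      then show ?thesis by (simp add: S_def)
    next
      case False
      have "R * (sieve_prod {} - sieve_err 1 {} y) \<le> R * 1" using R E0 V by (intro mult_left_mono) auto
      then show ?thesis using ex False by simp
    qed
    have upper: "S \<le> R * (sieve_prod {} + sieve_err 1 {} y)" if "8 * real 1 \<le> y"
    proof -
      have "R * 1 \<le> R * (sieve_prod {} + sieve_err 1 {} y)" using R E0 V by (intro mult_left_mono) auto
      then show ?thesis using ex that by simp
    qed
    show "real q ^ (m - dM) / real q ^ deg d * (sieve_prod {} - sieve_err 1 {} (real (m - dM)
        - real (deg d)))
      \<le> real (card (sieved D m d {})) \<and>
      (8 * real 1 \<le> real (m - dM) - real (deg d) \<longrightarrow> real (card (sieved D m d {}))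
      \<le> real q ^ (m - dM) / real q ^ deg d * (sieve_prod {} + sieve_err 1 {} (real (m - dM)
          - real (deg d))))"
      using lower upper unfolding S_def R_def y_def by blast
  qed
  then have "sieve_bounds D m 1 ({} \<union> {p \<in> P - PM. dg p = 1})" by (rule sieve_bounds_add_degree) auto
  moreover have "{} \<union> {p \<in> P - PM. dg p = 1} = {p \<in> P - PM. dg p \<le> 1}" using dg_ge_1 by fastforce
  ultimately show ?case by simp
next
  case (step w)
  have fin: "finite {p \<in> P - PM. dg p \<le> w}"
      by (rule finite_subset[OF _ finite_primes_deg_le[of w]]) auto
  have "sieve_bounds D m (Suc w) {p \<in> P - PM. dg p \<le> w}"
    using step by (intro sieve_bounds_next) auto
  then have "sieve_bounds D m (Suc w) ({p \<in> P - PM. dg p \<le> w} \<union> {p \<in> P - PM. dg p = Suc w})"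
    by (rule sieve_bounds_add_degree) (use fin in auto)
  moreover have "{p \<in> P - PM. dg p \<le> w} \<union> {p \<in> P - PM. dg p = Suc w} = {p \<in> P - PM. dg p \<le> Suc w}"
      by auto
  ultimately show ?case by simp
qed

text \<open>Mertens' bound, from \<open>ln (1 - x) >= - x - 2 * x^2\<close>: the densities up to
  degree \<open>z\<close> add up to at most \<open>1 + ln z\<close> and their squares to at most
  \<open>1\<close>, whence the exponent \<open>-3\<close>.\<close>

lemma sieve_prod_ge:
  assumes z: "1 \<le> z"
  shows "sieve_prod {p \<in> P - PM. dg p \<le> z} \<ge> exp (- 3) / real z"
proof -
  let ?T = "{p \<in> P - PM. dg p \<le> z}"
  have fin: "finite ?T" by (rule finite_subset[OF _ finite_primes_deg_le[of z]]) auto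
  have grp: "(\<Sum>p\<in>?T. h p) = (\<Sum>j\<in>{1..z}. \<Sum>p\<in>{p\<in>?T. dg p = j}. h p)" for h :: "'a \<Rightarrow> real"
    using fin dg_ge_1 by (intro sum.group[symmetric]) auto
  have s1: "(\<Sum>p\<in>?T. dens p) \<le> 1 + ln (real z)"
  proof -
    have "(\<Sum>p\<in>?T. dens p) \<le> (\<Sum>j\<in>{1..z}. 1 / real j)"
      unfolding grp by (intro sum_mono sum_dens_eq_le) auto
    then show ?thesis using sum_inverse_le_ln[OF z] by linarith
  qed
  have s2: "(\<Sum>p\<in>?T. (dens p)\<^sup>2) \<le> 1"
  proof -
    have "(\<Sum>p\<in>?T. (dens p)\<^sup>2) \<le> (\<Sum>j\<in>{1..z}. (1/2) ^ j)"
      unfolding grp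
    proof (rule sum_mono)
      fix j assume j: "j \<in> {1..z}"
      have le: "dens p \<le> (1/2) ^ j" if "dg p = j" for p
      proof -
        have "(2::real) ^ j \<le> real q ^ j" using q_ge_2 by (intro power_mono) auto
        then show ?thesis using that q_ge_2 by (simp add: dens_def power_divide frac_le)
      qed
      have "(\<Sum>p\<in>{p\<in>?T. dg p = j}. (dens p)\<^sup>2) \<le> (\<Sum>p\<in>{p\<in>?T. dg p = j}. (1/2) ^ j * dens p)"
        unfolding power2_eq_square using le dens_pos
            by (intro sum_mono mult_right_mono) (auto intro: less_imp_le)
      also have "\<dots> = (1/2) ^ j * (\<Sum>p\<in>{p\<in>?T. dg p = j}. dens p)" by (simp add: sum_distrib_left)
      also have "\<dots> \<le> (1/2) ^ j * (1 / real j)" using j by (intro mult_left_mono sum_dens_eq_le) auto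
      also have "\<dots> \<le> (1/2) ^ j * 1" using j by (intro mult_left_mono) auto
      finally show "(\<Sum>p\<in>{p\<in>?T. dg p = j}. (dens p)\<^sup>2) \<le> (1/2) ^ j" by simp
    qed
    also have "\<dots> = 1 - (1/2) ^ z" by (induction z) auto
    finally have "(\<Sum>p\<in>?T. (dens p)\<^sup>2) \<le> 1 - (1/2) ^ z" .
    moreover have "(0::real) \<le> (1/2) ^ z" by simp
    ultimately show ?thesis by linarith
  qed
  have "exp (- 3) / real z = exp (- (1 + ln (real z)) - 2 * 1)" using z
      by (simp add: exp_diff exp_minus field_simps flip: exp_add)
  also have "\<dots> \<le> exp (\<Sum>p\<in>?T. - dens p - 2 * (dens p)\<^sup>2)"
    using s1 s2 by (simp add: sum_subtractf sum_negf sum_distrib_left[symmetric])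
  also have "\<dots> = (\<Prod>p\<in>?T. exp (- dens p - 2 * (dens p)\<^sup>2))" using fin by (rule exp_sum)
  also have "\<dots> \<le> sieve_prod ?T"
    unfolding sieve_prod_def
  proof (rule prod_mono, intro conjI)
    fix p assume p: "p \<in> ?T"
    have x: "0 \<le> dens p" "dens p \<le> 1/2" using dens_pos[of p] dens_le_half p by auto
    have "- dens p - 2 * (dens p)\<^sup>2 \<le> ln (1 - dens p)" by (rule ln_one_minus_pos_lower_bound[OF x])
    then have "exp (- dens p - 2 * (dens p)\<^sup>2) \<le> exp (ln (1 - dens p))" by simp
    then show "exp (- dens p - 2 * (dens p)\<^sup>2) \<le> 1 - dens p" using x by simp
  qed simp
  finally show ?thesis .
qed

text \<open>Primes in \<open>PM\<close> divide no element of the class, so it suffices to sieve by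
  the others. At level \<open>18 * z\<close> the error is at most
  \<open>exp (9 + 8 - 18) <= 1/2\<close> of the main term; \<open>54\<close> is
  \<open>2 * 27\<close> with \<open>27 >= e^3\<close>. Stating the bound with \<open>b\<close>
  includes \<open>z = 0\<close>.\<close>

lemma rough_in_ap:
  assumes D: "set_mset D \<subseteq> P - PM" and m: "dM \<le> m" "18 * z \<le> m - dM" and b: "z \<le> b" "1 \<le> b"
  shows "real (card {F \<in> elems m. Q (D + F) \<and> (\<forall>p\<in>#F. z < dg p)}) \<ge> real q ^ (m - dM) / (54 * real b)"
proof -
  have eq: "{F \<in> elems m. Q (D + F) \<and> (\<forall>p\<in>#F. z < dg p)} = sieved D m {#} {p \<in> P - PM. dg p \<le> z}"
  proof (intro Set.set_eqI iffI)
    fix F assume F: "F \<in> sieved D m {#} {p \<in> P - PM. dg p \<le> z}"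
    then have "set_mset F \<inter> PM = {}" using ap_coprime[of "D + F"] by (auto simp: sieved_def)
    then show "F \<in> {F \<in> elems m. Q (D + F) \<and> (\<forall>p\<in>#F. z < dg p)}"
      using F by (fastforce simp: sieved_def elems_def)
  qed (fastforce simp: sieved_def)
  show ?thesis
  proof (cases "z = 0")
    case True
    have e: "{p \<in> P - PM. dg p \<le> z} = {}" using True dg_ge_1 by fastforce
    have "real (card (sieved D m {#} {p \<in> P - PM. dg p \<le> z})) = real q ^ (m - dM)"
      unfolding e using card_sieved_empty[of D "{#}" m] D m by simp
    moreover have "real q ^ (m - dM) / (54 * real b) \<le> real q ^ (m - dM) / 1" using b
        by (intro divide_left_mono) auto
    ultimately show ?thesis unfolding eq by simp
  next
    case False
    then have z: "1 \<le> z" by simp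
    let ?T = "{p \<in> P - PM. dg p \<le> z}"
    define y where "y = real (m - dM)"
    have y: "18 * real z \<le> y" using m(2) unfolding y_def by linarith
    have TP: "?T \<subseteq> P" by auto
    have V: "sieve_prod ?T > 0" by (rule sieve_prod_pos[OF TP])
    have "sieve_err z ?T y \<le> exp 9 * sieve_prod ?T * exp (8 / real z) * exp (- y / real z)"
      unfolding sieve_err_def using prod_err_le[OF z TP] V
          by (intro mult_right_mono mult_left_mono) auto
    also have "\<dots> = sieve_prod ?T * exp (9 + 8 / real z - y / real z)"
        by (simp add: exp_add exp_diff exp_minus field_simps)
    also have "\<dots> \<le> sieve_prod ?T * exp (- 1)"
    proof -
      have "8 / real z \<le> 8 / 1" using z by (intro divide_left_mono) auto
      moreover have "18 \<le> y / real z" using y z by (simp add: pos_le_divide_eq)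
      ultimately show ?thesis using V by (intro mult_left_mono) auto
    qed
    also have "\<dots> \<le> sieve_prod ?T * (1/2)"
    proof -
      have "2 \<le> exp (1::real)" using exp_ge_add_one_self[of 1] by simp
      then show ?thesis using V by (intro mult_left_mono) (auto simp: exp_minus field_simps)
    qed
    finally have err: "sieve_prod ?T * (1/2) \<le> sieve_prod ?T - sieve_err z ?T y" by simp
    have "real q ^ (m - dM) * (sieve_prod ?T - sieve_err z ?T y) \<le> real (card (sieved D m {#} ?T))"
      using sieve_bounds_all[OF D m(1) z, unfolded sieve_bounds_def Let_def, rule_format, of "{#}"]
          by (simp add: y_def)
    moreover have "real q ^ (m - dM) * (sieve_prod ?T * (1/2))
        \<le> real q ^ (m - dM) * (sieve_prod ?T - sieve_err z ?T y)"
      using err by (intro mult_left_mono) auto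
    moreover have "real q ^ (m - dM) / (54 * real b) \<le> real q ^ (m - dM) * (sieve_prod ?T * (1/2))"
    proof -
      have "exp (3::real) \<le> 27"
      proof -
        have "exp (3::real) = exp 1 ^ 3" by (simp flip: exp_of_nat_mult)
        also have "\<dots> \<le> 3 ^ 3" by (intro power_mono exp_le) auto
        finally show ?thesis by simp
      qed
      then have "1/27 \<le> exp (- 3 :: real)" by (simp add: exp_minus field_simps)
      then have "(1/27) / real b \<le> exp (- 3) / real z" using b z by (intro frac_le) auto
      then have "1 / (54 * real b) \<le> sieve_prod ?T * (1/2)" using sieve_prod_ge[OF z]
          by (simp add: field_simps)
      then have "real q ^ (m - dM) * (1 / (54 * real b)) \<le> real q ^ (m - dM) * (sieve_prod ?T * (1/2))"
        by (intro mult_left_mono) auto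
      then show ?thesis by simp
    qed
    ultimately show ?thesis unfolding eq by linarith
  qed
qed

end

section \<open>Elements with a divisor of given degree\<close>

lemma card_arrangements_le:
  "card {t \<in> {..<J} \<rightarrow>\<^sub>E A. image_mset t (mset_set {..<J}) = W} \<le> fact J" (is "card ?S \<le> _")
proof (cases "?S = {}")
  case False
  then obtain t where t: "t \<in> ?S" by blast
  then have "W = image_mset t (mset_set {..<J})" by simp
  then have sz: "size W = J" by simp
  have "card ?S \<le> card (permutations_of_multiset W)"
  proof (rule card_inj_on_le[where f = "\<lambda>t. map t [0..<J]"])
    show "inj_on (\<lambda>t. map t [0..<J]) ?S"
    proof (rule inj_onI)
      fix t u assume tu: "t \<in> ?S" "u \<in> ?S" and eq: "map t [0..<J] = map u [0..<J]"
      have "t x = u x" if "x < J" for x using eq that by (auto simp: map_eq_conv)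
      then show "t = u" using tu by (auto intro: PiE_ext)
    qed
    show "(\<lambda>t. map t [0..<J]) ` ?S \<subseteq> permutations_of_multiset W"
      by (auto simp: permutations_of_multiset_def mset_upt lessThan_atLeast0)
  qed auto
  also have "\<dots> \<le> fact (size W)" by (simp add: card_permutations_of_multiset(1))
  finally show ?thesis using sz by simp
next
  case True
  then show ?thesis by (simp only: card.empty)
qed

context prime_system_ap
begin

definition density :: "nat \<Rightarrow> real" where
  "density j = real (card {p \<in> P - PM. dg p = j}) / real q ^ j"

definition with_divisor :: "nat \<Rightarrow> nat \<Rightarrow> 'a multiset set" where
  "with_divisor n b = {F \<in> elems n. Q F \<and> (\<exists>D. D \<subseteq># F \<and> deg D = b)}"

text \<open>The constant is \<open>4752 = 108 * 44\<close>: \<open>108\<close> combines the sieve constant \<open>54\<close> with the factor \<open>2\<close> lost in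
  counting the prime \<open>p\<close>, and an element has at most \<open>44 * fact J\<close> representations.\<close>

theorem card_with_divisor_ge:
  assumes b: "1 \<le> b" "2 * b \<le> n" and dM: "2 * dM \<le> b"
  shows "real q ^ (n - dM) / (4752 * (real b)\<^sup>2 * fact J) *
      degree_sum density J b
     \<le> real (card (with_divisor n b))"
proof -
  \<comment> \<open>With \<open>40 * a t <= b\<close> and \<open>2 * dM <= b\<close> the cofactor
    keeps at least \<open>19 * b / 40\<close> degrees beyond \<open>dM\<close>, and the sieve needs
    \<open>18 * z\<close>; hence the limit \<open>b/40\<close>. For \<open>n > 22 * b\<close> there
    is room to sieve up to \<open>b\<close>, so that \<open>p\<close> is the only prime factor of
    degree between \<open>b/2\<close> and \<open>b\<close>; for smaller \<open>n\<close> the total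
    degree allows at most \<open>44\<close> of them.\<close>
  define z where "z = (if n \<le> 22 * b then b div 40 else b)"
  define ms where "ms t = image_mset t (mset_set {..<J})" for t :: "nat \<Rightarrow> 'a"
  define a where "a t = (\<Sum>x<J. dg (t x))" for t :: "nat \<Rightarrow> 'a"
  define TT where "TT = {t \<in> {..<J} \<rightarrow>\<^sub>E (P - PM). 40 * a t \<le> b}"
  define SS where "SS t = subset_sums {..<J} (\<lambda>x. dg (t x))" for t :: "nat \<Rightarrow> 'a"
  define ES where "ES t s p = {E \<in> elems (n - a t - (b - s)). Q (add_mset p (ms t) + E)
      \<and> (\<forall>r\<in>#E. z < dg r)}" for t s p
  define PP where "PP s = {p \<in> P. dg p = b - s}" for s
  define W where "W = (SIGMA t:TT. SIGMA s:SS t. SIGMA p:PP s. ES t s p)"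
  define mk where "mk = (\<lambda>(t, s :: nat, p, E). add_mset p (ms t) + E)"
  have q0: "real q > 0" using q_ge_2 by simp
  have zb: "z \<le> b" by (simp add: z_def)
  have deg_ms: "deg (ms t) = a t" for t unfolding ms_def a_def deg_def
      by (simp add: sum_unfold_sum_mset multiset.map_comp comp_def)
  have set_ms: "set_mset (ms t) = t ` {..<J}" for t by (simp add: ms_def)
  have a_mem: "dg (t x) \<le> a t" if "x < J" for t x unfolding a_def using that
      by (intro member_le_sum) auto
  have TT_mem: "t x \<in> P - PM" "dg (t x) \<le> a t" if "t \<in> TT" "x < J" for t x
    using that a_mem by (auto simp: TT_def dest: PiE_mem)
  have finTT: "finite TT"
  proof (rule finite_subset)
    show "TT \<subseteq> {..<J} \<rightarrow>\<^sub>E {p \<in> P. dg p \<le> b}"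
    proof
      fix t assume t: "t \<in> TT"
      have "t x \<in> {p \<in> P. dg p \<le> b}" if "x < J" for x using TT_mem[OF t that] t by (auto simp: TT_def)
      then show "t \<in> {..<J} \<rightarrow>\<^sub>E {p \<in> P. dg p \<le> b}" using t by (auto simp: TT_def PiE_iff)
    qed
    show "finite ({..<J} \<rightarrow>\<^sub>E {p \<in> P. dg p \<le> b})" by (intro finite_PiE finite_primes_deg_le) auto
  qed
  have SS_le: "s \<le> a t" if "s \<in> SS t" for s t
    using that unfolding SS_def subset_sums_def a_def by (auto intro!: sum_mono2)
  have finSS: "finite (SS t)" for t by (simp add: SS_def subset_sums_def)
  have finPP: "finite (PP s)" for s unfolding PP_def by (rule finite_primes_deg)
  have finES: "finite (ES t s p)" for t s p unfolding ES_def using finite_elems by simp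
  \<comment> \<open>\<open>dg p = b - s\<close> exceeds \<open>dM\<close>, so \<open>p\<close> is
    not in \<open>PM\<close>, and it exceeds \<open>b/40\<close>, so \<open>p\<close> is told apart
    from the entries of \<open>t\<close>.\<close>
  have bs: "b \<le> 2 * (b - s)" "b < 40 * (b - s)" "2 * dM < 2 * (b - s)" if "t \<in> TT" "s \<in> SS t" for t s
  proof -
    have sa: "s \<le> a t" "40 * a t \<le> b" using SS_le[OF that(2)] that(1) by (simp_all add: TT_def)
    show "b \<le> 2 * (b - s)" "b < 40 * (b - s)" "2 * dM < 2 * (b - s)" using sa b(1) dM by linarith+
  qed
  have PP_mem: "p \<in> P - PM" if "t \<in> TT" "s \<in> SS t" "p \<in> PP s" for t s p
    using bs[OF that(1,2)] that(3) dg_PM[of p] by (auto simp: PP_def)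
  have ES_card: "real (card (ES t s p)) \<ge> real q ^ (n - dM) / (real q ^ a t * real q ^ (b - s)) / (54
      * real b)"
    if t: "t \<in> TT" and s: "s \<in> SS t" and p: "p \<in> PP s" for t s p
  proof -
    define m where "m = n - a t - (b - s)"
    have sa: "s \<le> a t" "40 * a t \<le> b" using SS_le[OF s] t by (auto simp: TT_def)
    have m: "dM \<le> m" "18 * z \<le> m - dM" "n - dM = (m - dM) + (a t + (b - s))"
      using sa b dM by (auto simp: m_def z_def)
    have "set_mset (add_mset p (ms t)) \<subseteq> P - PM"
      using PP_mem[OF t s p] TT_mem(1)[OF t] by (auto simp: set_ms)
    then have "real (card (ES t s p)) \<ge> real q ^ (m - dM) / (54 * real b)"
      unfolding ES_def m_def[symmetric] using m zb b by (intro rough_in_ap) auto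
    moreover have "real q ^ (n - dM) / (real q ^ a t * real q ^ (b - s)) = real q ^ (m - dM)"
      using q0 unfolding m(3) power_add by simp
    ultimately show ?thesis by simp
  qed
  have cardW: "real (card W) = (\<Sum>t\<in>TT. \<Sum>s\<in>SS t. \<Sum>p\<in>PP s. real (card (ES t s p)))"
    unfolding W_def using finTT finSS finPP finES
    by (simp add: card_SigmaI finite_SigmaI)
  have Wge: "real (card W) \<ge> real q ^ (n - dM) / (108 * (real b)\<^sup>2)
      * (\<Sum>t\<in>TT. real (card (SS t)) / real q ^ a t)"
  proof -
    have "real q ^ (n - dM) / (108 * (real b)\<^sup>2) * (\<Sum>t\<in>TT. real (card (SS t)) / real q ^ a t)
       = (\<Sum>t\<in>TT. real q ^ (n - dM) / (108 * (real b)\<^sup>2) * (real (card (SS t)) / real q ^ a t))"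
      by (rule sum_distrib_left)
    also have "\<dots> = (\<Sum>t\<in>TT. \<Sum>s\<in>SS t. real q ^ (n - dM) / (108 * (real b)\<^sup>2) / real q ^ a t)"
      by (intro sum.cong refl) simp
    also have "\<dots> \<le> real (card W)"
      unfolding cardW
    proof (intro sum_mono)
      fix t s assume t: "t \<in> TT" and s: "s \<in> SS t"
      have "b - s \<ge> 1" using bs[OF t s] b by auto
      from num_primes_ge_half[OF this] have "q ^ (b - s) \<le> 2 * ((b - s) * num_primes (b - s))" .
      also have "\<dots> \<le> 2 * (b * num_primes (b - s))" by simp
      finally have "real (q ^ (b - s)) \<le> real (2 * (b * num_primes (b - s)))"
          by (simp only: of_nat_le_iff)
      then have "real q ^ (b - s) \<le> 2 * real b * real (card (PP s))"
          by (simp add: num_primes_def PP_def)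
      then have pb: "real (card (PP s)) \<ge> real q ^ (b - s) / (2 * real b)" using b
          by (simp add: field_simps)
      have "real q ^ (n - dM) / (108 * (real b)\<^sup>2) / real q ^ a t
         = real q ^ (b - s) / (2 * real b) * (real q ^ (n - dM) / (real q ^ a t * real q ^ (b
             - s)) / (54 * real b))"
        using q0 b by (simp add: field_simps power2_eq_square)
      also have "\<dots> \<le> real (card (PP s)) * (real q ^ (n - dM) / (real q ^ a t * real q ^ (b
          - s)) / (54 * real b))"
        using pb by (intro mult_right_mono) auto
      also have "\<dots> = (\<Sum>p\<in>PP s. real q ^ (n - dM) / (real q ^ a t * real q ^ (b - s)) / (54
          * real b))" by simp
      also have "\<dots> \<le> (\<Sum>p\<in>PP s. real (card (ES t s p)))" using ES_card[OF t s] by (intro sum_mono) auto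
      finally show "real q ^ (n - dM) / (108 * (real b)\<^sup>2) / real q ^ a t
          \<le> (\<Sum>p\<in>PP s. real (card (ES t s p)))" .
    qed
    finally show ?thesis .
  qed
  define U where "U = {d \<in> {..<J} \<rightarrow>\<^sub>E {1..b}. 40 * (\<Sum>x<J. d x) \<le> b}"
  have finU: "finite U" unfolding U_def by (rule finite_subset[OF _ finite_PiE[of "{..<J}" "\<lambda>_.
      {1..b}"]]) auto
  \<comment> \<open>The tuples with a given degree vector form a product set, and
    \<open>q^(a t)\<close> factors in the same way.\<close>
  have group: "(\<Sum>t\<in>TT. real (card (SS t)) / real q ^ a t)
      = (\<Sum>d\<in>U. (\<Prod>x<J. density (d x)) * real (card (subset_sums {..<J} d)))"
  proof -
    define h where "h t = restrict (\<lambda>x. dg (t x)) {..<J}" for t :: "nat \<Rightarrow> 'a"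
    have ssr: "subset_sums {..<J} (h t) = SS t" for t
      unfolding subset_sums_def SS_def h_def by (intro image_cong refl sum.cong) auto
    have ar: "(\<Sum>x<J. h t x) = a t" for t unfolding a_def h_def by (intro sum.cong) auto
    have "h ` TT \<subseteq> U"
    proof
      fix d assume "d \<in> h ` TT"
      then obtain t where t: "t \<in> TT" "d = h t" by auto
      have "1 \<le> dg (t x) \<and> dg (t x) \<le> b" if "x < J" for x
        using TT_mem[OF t(1) that] dg_ge_1[of "t x"] t by (auto simp: TT_def)
      then have "h t \<in> {..<J} \<rightarrow>\<^sub>E {1..b}" by (auto simp: h_def)
      then show "d \<in> U" using t ar[of t] by (auto simp: U_def TT_def)
    qed
    then have "(\<Sum>t\<in>TT. real (card (SS t)) / real q ^ a t) = (\<Sum>d\<in>U. \<Sum>t\<in>{t\<in>TT. h t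
        = d}. real (card (SS t)) / real q ^ a t)"
      using finTT finU by (intro sum.group[symmetric]) auto
    also have "\<dots> = (\<Sum>d\<in>U. (\<Prod>x<J. density (d x)) * real (card (subset_sums {..<J} d)))"
    proof (rule sum.cong[OF refl])
      fix d assume d: "d \<in> U"
      have fib: "{t\<in>TT. h t = d} = (\<Pi>\<^sub>E x\<in>{..<J}. {p \<in> P - PM. dg p = d x})"
      proof (intro Set.set_eqI iffI)
        fix t assume "t \<in> {t\<in>TT. h t = d}"
        then have t: "t \<in> TT" "h t = d" by auto
        have "dg (t x) = d x" if "x < J" for x using fun_cong[OF t(2), of x] that by (simp add: h_def)
        then show "t \<in> (\<Pi>\<^sub>E x\<in>{..<J}. {p \<in> P - PM. dg p = d x})" using t by (auto simp: TT_def PiE_iff)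
      next
        fix t assume t: "t \<in> (\<Pi>\<^sub>E x\<in>{..<J}. {p \<in> P - PM. dg p = d x})"
        have "h t = d" using t d by (auto simp: h_def U_def fun_eq_iff PiE_iff extensional_def)
        then show "t \<in> {t\<in>TT. h t = d}" using t d ar[of t] by (auto simp: TT_def U_def PiE_iff)
      qed
      have fd: "finite {p \<in> P - PM. dg p = j}" for j
          by (rule finite_subset[OF _ finite_primes_deg[of j]]) auto
      have "(\<Sum>t\<in>{t\<in>TT. h t = d}. real (card (SS t)) / real q ^ a t)
          = (\<Sum>t\<in>{t\<in>TT. h t = d}. real (card (subset_sums {..<J} d)) / real q ^ (\<Sum>x<J. d x))"
        by (rule sum.cong) (use ssr ar in auto)
      also have "\<dots> = real (card {t\<in>TT. h t
          = d}) / real q ^ (\<Sum>x<J. d x) * real (card (subset_sums {..<J} d))" by simp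
      also have "real (card {t\<in>TT. h t = d}) / real q ^ (\<Sum>x<J. d x) = (\<Prod>x<J. density (d x))"
        unfolding fib density_def by (simp add: card_PiE power_sum prod_dividef)
      finally show "(\<Sum>t\<in>{t\<in>TT. h t = d}. real (card (SS t)) / real q ^ a t)
          = (\<Prod>x<J. density (d x)) * real (card (subset_sums {..<J} d))" .
    qed
    finally show ?thesis .
  qed
  have mk_mem: "mk w \<in> with_divisor n b" if w: "w \<in> W" for w
  proof -
    obtain t s p E where w': "w = (t, s, p, E)" "t \<in> TT" "s \<in> SS t" "p \<in> PP s" "E \<in> ES t s p"
      using w by (auto simp: W_def)
    have sa: "s \<le> a t" "40 * a t \<le> b" using SS_le[OF w'(3)] w'(2) by (auto simp: TT_def)
    obtain Y where Y: "Y \<subseteq> {..<J}" "s = (\<Sum>x\<in>Y. dg (t x))" using w'(3)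
        by (auto simp: SS_def subset_sums_def)
    define D where "D = add_mset p (image_mset t (mset_set Y))"
    have finY: "finite Y" using Y finite_subset by blast
    have "image_mset t (mset_set Y) \<subseteq># ms t" unfolding ms_def using Y
      by (intro image_mset_subseteq_mono) (simp add: subset_imp_msubset_mset_set)
    then have "D \<subseteq># mk w" unfolding D_def mk_def w'
        by (auto intro: subset_mset.order_trans[OF _ mset_subset_eq_add_left])
    moreover have "deg D = b"
    proof -
      have "deg (image_mset t (mset_set Y)) = s" unfolding deg_def Y(2)
        by (simp add: sum_unfold_sum_mset multiset.map_comp comp_def)
      then show ?thesis using w'(4) sa b by (simp add: D_def PP_def)
    qed
    moreover have "mk w \<in> elems n"
    proof -
      have "deg (mk w) = (b - s) + a t + (n - a t - (b - s))"
        using w'(4,5) by (simp add: mk_def w'(1) deg_ms PP_def ES_def elems_def)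
      also have "\<dots> = n" using sa b by simp
      finally have "deg (mk w) = n" .
      moreover have "set_mset (mk w) \<subseteq> P"
        using w' TT_mem(1)[OF w'(2)] by (auto simp: mk_def set_ms PP_def ES_def elems_def)
      ultimately show ?thesis by (simp add: elems_def)
    qed
    ultimately show ?thesis using w' by (auto simp: with_divisor_def mk_def ES_def)
  qed
  \<comment> \<open>Given \<open>F\<close>, the tuple \<open>t\<close> is an ordering of its prime
    factors of degree at most \<open>b/40\<close>, \<open>p\<close> is one of the at most
    \<open>44\<close> members of \<open>R\<close>, and \<open>s\<close> and \<open>E\<close> are
    then determined.\<close>
  have fibre: "card {w \<in> W. mk w = F} \<le> 44 * fact J" for F
  proof (cases "{w \<in> W. mk w = F} = {}")
    case False
    define R where "R = {p \<in> set_mset F. b \<le> 2 * dg p \<and> dg p \<le> b}"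
    define A where "A = {t \<in> {..<J} \<rightarrow>\<^sub>E (P - PM). ms t = filter_mset (\<lambda>p. 40 * dg p \<le> b) F}"
    have small: "ms t = filter_mset (\<lambda>p. 40 * dg p \<le> b) F" "p \<in> R" "s = b - dg p" "E
        = F - add_mset p (ms t)"
        "n > 22 * b \<Longrightarrow> R \<subseteq> {p}" "F \<in> elems n"
      if w: "(t, s, p, E) \<in> W" "mk (t, s, p, E) = F" for t s p E
    proof -
      have w': "t \<in> TT" "s \<in> SS t" "p \<in> PP s" "E \<in> ES t s p" using w(1) by (auto simp: W_def)
      have F: "F = add_mset p (ms t) + E" using w(2) by (simp add: mk_def)
      have dp: "dg p = b - s" using w'(3) by (simp add: PP_def)
      have sa: "s \<le> a t" "40 * a t \<le> b" using SS_le[OF w'(2)] w'(1) by (auto simp: TT_def)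
      have tsm: "40 * dg r \<le> b" if "r \<in># ms t" for r
      proof -
        obtain x where "x < J" "r = t x" using \<open>r \<in># ms t\<close> by (auto simp: set_ms)
        then show ?thesis using TT_mem(2)[OF w'(1)] sa by fastforce
      qed
      have Ebig: "z < dg r" if "r \<in># E" for r using w'(4) that by (simp add: ES_def)
      have Ebig': "\<not> 40 * dg r \<le> b" if "r \<in># E" for r
        using Ebig[OF that] b by (auto simp: z_def split: if_splits)
      have "filter_mset (\<lambda>p. 40 * dg p \<le> b) (ms t) = ms t" using tsm by (simp add: filter_mset_eq_conv)
      moreover have "filter_mset (\<lambda>p. 40 * dg p \<le> b) E = {#}"
      proof -
        have "filter_mset (\<lambda>p. 40 * dg p \<le> b) E = filter_mset (\<lambda>_. False) E"
          using Ebig' by (intro filter_mset_cong) auto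
        then show ?thesis by simp
      qed
      ultimately show "ms t = filter_mset (\<lambda>p. 40 * dg p \<le> b) F"
        using bs[OF w'(1,2)] dp unfolding F by simp
      show "p \<in> R" using bs[OF w'(1,2)] dp by (auto simp: R_def F)
      show "s = b - dg p" using dp sa b by auto
      show "E = F - add_mset p (ms t)" unfolding F by simp
      show "F \<in> elems n" using mk_mem[OF w(1)] w(2) by (simp add: with_divisor_def)
      show "R \<subseteq> {p}" if "n > 22 * b"
      proof
        fix r assume r: "r \<in> R"
        have "r \<notin># E" using Ebig[of r] r that by (auto simp: R_def z_def)
        moreover have "r \<notin># ms t" using tsm[of r] r b by (auto simp: R_def)
        ultimately show "r \<in> {p}" using r by (auto simp: R_def F)
      qed
    qed
    obtain w where w: "w \<in> W" "mk w = F" using False by blast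
    obtain t0 s0 p0 E0 where w0: "(t0, s0, p0, E0) \<in> W" "mk (t0, s0, p0, E0) = F" using w
        by (cases w) auto
    have R44: "card R \<le> 44"
    proof (cases "n > 22 * b")
      case True
      then have "card R \<le> card {p0}" using small(5)[OF w0] by (intro card_mono) auto
      then show ?thesis by simp
    next
      case False
      have "card R * b = (\<Sum>p\<in>R. b)" by simp
      also have "\<dots> \<le> (\<Sum>p\<in>R. count F p * (2 * dg p))"
      proof (rule sum_mono)
        fix p assume p: "p \<in> R"
        then have "1 \<le> count F p" by (simp add: R_def Suc_le_eq)
        then have "1 * b \<le> count F p * (2 * dg p)" using p by (intro mult_mono) (auto simp: R_def)
        then show "b \<le> count F p * (2 * dg p)" by simp
      qed
      also have "\<dots> \<le> (\<Sum>p\<in>set_mset F. count F p * (2 * dg p))"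
        by (intro sum_mono2) (auto simp: R_def)
      also have "\<dots> = 2 * deg F"
        using deg_eq_sum_count[of "set_mset F" F] by (simp add: sum_distrib_left mult_ac)
      also have "\<dots> \<le> 44 * b" using small(6)[OF w0] False by (simp add: elems_def)
      finally show ?thesis using b by simp
    qed
    have finA: "finite A" if "A \<noteq> {}"
    proof (rule finite_subset[where B = "{..<J} \<rightarrow>\<^sub>E set_mset F"])
      show "A \<subseteq> {..<J} \<rightarrow>\<^sub>E set_mset F"
      proof
        fix t assume t: "t \<in> A"
        then have "t ` {..<J} = set_mset (filter_mset (\<lambda>p. 40 * dg p \<le> b) F)"
          unfolding A_def set_ms[symmetric] by auto
        then show "t \<in> {..<J} \<rightarrow>\<^sub>E set_mset F" using t by (auto simp: A_def PiE_iff)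
      qed
    qed (intro finite_PiE, auto)
    then have finA: "finite A" by (cases "A = {}") auto
    have "card {w \<in> W. mk w = F} \<le> card (A \<times> R)"
    proof (rule card_inj_on_le[where f = "\<lambda>(t, s, p, E). (t, p)"])
      show "inj_on (\<lambda>(t, s, p, E). (t, p)) {w \<in> W. mk w = F}"
      proof (rule inj_onI)
        fix w w' assume ww: "w \<in> {w \<in> W. mk w = F}" "w' \<in> {w \<in> W. mk w = F}"
          and eq: "(case w of (t, s, p, E) \<Rightarrow> (t, p)) = (case w' of (t, s, p, E) \<Rightarrow> (t, p))"
        obtain t s p E where w: "w = (t, s, p, E)" by (cases w)
        obtain t' s' p' E' where w': "w' = (t', s', p', E')" by (cases w')
        have "t = t'" "p = p'" using eq w w' by auto
        then show "w = w'" using small(3,4)[of t s p E] small(3,4)[of t' s' p' E'] ww w w' by auto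
      qed
      show "(\<lambda>(t, s, p, E). (t, p)) ` {w \<in> W. mk w = F} \<subseteq> A \<times> R"
      proof (rule image_subsetI)
        fix w assume w: "w \<in> {w \<in> W. mk w = F}"
        obtain t s p E where ww: "w = (t, s, p, E)" by (cases w)
        have "t \<in> TT" using w ww by (auto simp: W_def)
        then show "(case w of (t, s, p, E) \<Rightarrow> (t, p)) \<in> A \<times> R"
          using small(1,2)[of t s p E] w ww by (auto simp: A_def TT_def)
      qed
    qed (use finA in \<open>auto simp: R_def\<close>)
    also have "\<dots> = card A * card R" by (rule card_cartesian_product)
    also have "\<dots> \<le> fact J * 44"
      unfolding A_def ms_def by (intro mult_mono card_arrangements_le R44) auto
    finally show ?thesis by (simp add: mult.commute)
  next
    case True
    then show ?thesis by (simp only: card.empty)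
  qed
  have finW: "finite W" unfolding W_def using finTT finSS finPP finES by (intro finite_SigmaI) auto
  have finH: "finite (with_divisor n b)" unfolding with_divisor_def using finite_elems by simp
  have "card W = (\<Sum>F\<in>with_divisor n b. card {w \<in> W. mk w = F})"
  proof -
    have "mk ` W \<subseteq> with_divisor n b" using mk_mem by blast
    from sum.group[OF finW finH this, of "\<lambda>_. 1 :: nat"] show ?thesis by simp
  qed
  also have "\<dots> \<le> (\<Sum>F\<in>with_divisor n b. 44 * fact J)" by (intro sum_mono fibre)
  finally have "card W \<le> card (with_divisor n b) * (44 * fact J)" by simp
  then have "real (card W) \<le> real (card (with_divisor n b) * (44 * fact J))"
      by (simp only: of_nat_le_iff)
  then have "real (card W) \<le> real (card (with_divisor n b)) * (44 * fact J)" by simp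
  with Wge have "real q ^ (n - dM) / (108 * (real b)\<^sup>2) * (\<Sum>d\<in>U. (\<Prod>x<J. density (d x))
      * real (card (subset_sums {..<J} d)))
      \<le> real (card (with_divisor n b)) * (44 * fact J)" unfolding group by linarith
  then have "real q ^ (n - dM) / (108 * (real b)\<^sup>2) * (\<Sum>d\<in>U. (\<Prod>x<J. density (d x))
      * real (card (subset_sums {..<J} d))) / (44 * fact J)
      \<le> real (card (with_divisor n b))"
  proof -
    have "(0::real) < 44 * fact J" by simp
    then show ?thesis
      using \<open>real q ^ (n - dM) / (108 * (real b)\<^sup>2) * _ \<le> real (card (with_divisor n b)) * (44 * fact J)\<close>
      by (simp only: pos_divide_le_eq)
  qed
  moreover have "real q ^ (n - dM) / (108 * (real b)\<^sup>2) * S / (44 * fact J)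
      = real q ^ (n - dM) / (4752 * (real b)\<^sup>2 * fact J) * S" for S
    by simp
  ultimately show ?thesis unfolding U_def degree_sum_def by simp
qed

end

section \<open>Monic polynomials as multisets of primes\<close>

context field
begin

abbreviation Px :: "'a list ring" where "Px \<equiv> poly_ring R"

abbreviation px_mult (infixl "\<boxtimes>" 70) where "(\<boxtimes>) \<equiv> mult Px"
abbreviation px_add (infixl "\<boxplus>" 65) where "(\<boxplus>) \<equiv> add Px"
abbreviation px_minus (infixl "\<boxminus>" 65) where "(\<boxminus>) \<equiv> a_minus Px"

lemma Px_principal: "principal_domain Px"
  by (rule univ_poly_is_principal[OF carrier_is_subfield])

interpretation UP: principal_domain Px
  by (rule Px_principal)

lemma Px_zero: "\<zero>\<^bsub>Px\<^esub> = []" by (rule univ_poly_zero)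

lemma Px_one: "\<one>\<^bsub>Px\<^esub> = [\<one>]" by (rule univ_poly_one)

lemma mem_Px: "p \<in> carrier Px \<longleftrightarrow> p = [] \<or> (set p \<subseteq> carrier R \<and> hd p \<noteq> \<zero>)"
  unfolding univ_poly_carrier[symmetric] polynomial_def by auto

lemma degree_mult:
  "p \<in> carrier Px \<Longrightarrow> q \<in> carrier Px \<Longrightarrow> p \<noteq> [] \<Longrightarrow> q \<noteq> [] \<Longrightarrow> degree (p \<boxtimes> q) = degree p + degree q"
  using poly_mult_degree_eq[OF carrier_is_subring, of p q]
      by (simp add: univ_poly_carrier univ_poly_mult)

lemma hd_mult:
  "p \<in> carrier Px \<Longrightarrow> q \<in> carrier Px \<Longrightarrow> p \<noteq> [] \<Longrightarrow> q \<noteq> [] \<Longrightarrow> hd (p \<boxtimes> q) = hd p \<otimes> hd q"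
  using poly_mult_lead_coeff[OF carrier_is_subring, of p q]
      by (simp add: univ_poly_carrier univ_poly_mult)

lemma mult_eq_Nil:
  "p \<in> carrier Px \<Longrightarrow> q \<in> carrier Px \<Longrightarrow> p \<boxtimes> q = [] \<longleftrightarrow> p = [] \<or> q = []"
  using UP.integral_iff[of p q] by (simp add: Px_zero)

lemma pdividesI: "q \<in> carrier Px \<Longrightarrow> r = p \<boxtimes> q \<Longrightarrow> p pdivides r"
  by (auto simp: pdivides_def factor_def)

lemma pdividesE: "p pdivides r \<Longrightarrow> (\<And>q. q \<in> carrier Px \<Longrightarrow> r = p \<boxtimes> q \<Longrightarrow> thesis) \<Longrightarrow> thesis"
  by (auto simp: pdivides_def factor_def)

lemma pdivides_trans: "p \<in> carrier Px \<Longrightarrow> p pdivides r \<Longrightarrow> r pdivides s \<Longrightarrow> p pdivides s"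
  unfolding pdivides_def by (rule UP.divides_trans)

lemma pdivides_add:
  "p \<in> carrier Px \<Longrightarrow> r \<in> carrier Px \<Longrightarrow> s \<in> carrier Px \<Longrightarrow> p pdivides r \<Longrightarrow> p pdivides s \<Longrightarrow> p pdivides (r \<boxplus> s)"
proof -
  assume c: "p \<in> carrier Px" "r \<in> carrier Px" "s \<in> carrier Px" and "p pdivides r" "p pdivides s"
  then obtain x y where xy: "x \<in> carrier Px" "r = p \<boxtimes> x" "y \<in> carrier Px" "s = p \<boxtimes> y"
    by (auto elim!: pdividesE)
  have "r \<boxplus> s = p \<boxtimes> (x \<boxplus> y)" unfolding xy(2,4) using c xy(1,3) by algebra
  then show ?thesis using xy by (intro pdividesI[of "x \<boxplus> y"]) auto
qed

lemma pdivides_minus: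
  "p \<in> carrier Px \<Longrightarrow> r \<in> carrier Px \<Longrightarrow> s \<in> carrier Px \<Longrightarrow> p pdivides r \<Longrightarrow> p pdivides s \<Longrightarrow> p pdivides (r \<boxminus> s)"
proof -
  assume c: "p \<in> carrier Px" "r \<in> carrier Px" "s \<in> carrier Px" and "p pdivides r" "p pdivides s"
  then obtain x y where xy: "x \<in> carrier Px" "r = p \<boxtimes> x" "y \<in> carrier Px" "s = p \<boxtimes> y"
    by (auto elim!: pdividesE)
  have "r \<boxminus> s = p \<boxtimes> (x \<boxminus> y)" unfolding xy(2,4) using c xy(1,3) by algebra
  then show ?thesis using xy by (intro pdividesI[of "x \<boxminus> y"]) auto
qed

lemma pdivides_mult: "p \<in> carrier Px \<Longrightarrow> r \<in> carrier Px \<Longrightarrow> s \<in> carrier Px \<Longrightarrow> p pdivides r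
    \<Longrightarrow> p pdivides (s \<boxtimes> r)"
proof -
  assume c: "p \<in> carrier Px" "r \<in> carrier Px" "s \<in> carrier Px" and "p pdivides r"
  then obtain x where x: "x \<in> carrier Px" "r = p \<boxtimes> x" by (auto elim!: pdividesE)
  have "s \<boxtimes> r = p \<boxtimes> (s \<boxtimes> x)" unfolding x(2) using c x(1) by algebra
  then show ?thesis using c x by (intro pdividesI[of "s \<boxtimes> x"]) auto
qed

lemma monics_iff: "p \<in> monics R k \<longleftrightarrow> p \<in> carrier Px \<and> length p = Suc k \<and> hd p = \<one>"
  by (auto simp: monics_def Suc_pred' length_greater_0_conv[symmetric] simp del: length_greater_0_conv)

lemma monics_carrier: "p \<in> monics R k \<Longrightarrow> p \<in> carrier Px" by (simp add: monics_iff)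

lemma monics_mult: "p \<in> monics R i \<Longrightarrow> q \<in> monics R j \<Longrightarrow> p \<boxtimes> q \<in> monics R (i + j)"
  using degree_mult[of p q] hd_mult[of p q] mult_eq_Nil[of p q] by (auto simp: monics_def)

lemma monics_0: "monics R 0 = {[\<one>]}"
  by (auto simp: monics_iff mem_Px length_Suc_conv)

lemma monics_eq: "monics R k = (\<lambda>xs. \<one> # xs) ` {xs. set xs \<subseteq> carrier R \<and> length xs = k}"
  by (auto simp: monics_iff mem_Px length_Suc_conv)

lemma card_monics: "finite (carrier R) \<Longrightarrow> card (monics R k) = card (carrier R) ^ k"
  unfolding monics_eq by (subst card_image) (auto simp: inj_on_def card_lists_length_eq)

text \<open>Measured by \<open>length\<close>, which unlike \<open>degree\<close> separates zero
  from the nonzero constants: \<open>low 0\<close> contains only zero, and \<open>low k\<close> is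
  the set of remainders modulo a polynomial of degree \<open>k\<close>.\<close>

definition low :: "nat \<Rightarrow> 'a list set" where
  "low k = {p \<in> carrier Px. length p \<le> k}"

lemma low_iff: "p \<in> low k \<longleftrightarrow> p \<in> carrier Px \<and> (p = [] \<or> degree p < k)"
  by (cases p) (auto simp: low_def)

lemma card_low:
  assumes fin: "finite (carrier R)"
  shows "finite (low k) \<and> card (low k) = card (carrier R) ^ k"
proof (induction k)
  case 0
  have "low 0 = {[]}" by (auto simp: low_def mem_Px)
  then show ?case by simp
next
  case (Suc k)
  let ?S = "{xs. set xs \<subseteq> carrier R \<and> length xs = k}"
  let ?T = "(\<lambda>(c, xs). c # xs) ` ((carrier R - {\<zero>}) \<times> ?S)"
  have eq: "low (Suc k) = low k \<union> ?T"
    by (auto simp: low_def mem_Px le_Suc_eq length_Suc_conv)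
  have dis: "low k \<inter> ?T = {}" by (auto simp: low_def)
  have finT: "finite ?T" using fin finite_lists_length_eq by auto
  have cT: "card ?T = (card (carrier R) - 1) * card (carrier R) ^ k"
    using fin by (subst card_image) (auto simp: inj_on_def card_cartesian_product card_lists_length_eq)
  have "card (carrier R) \<ge> 1" using fin zero_closed
      by (metis One_nat_def Suc_leI card_gt_0_iff empty_iff)
  then have "card (carrier R) ^ k + (card (carrier R) - 1) * card (carrier R) ^ k
      = card (carrier R) ^ Suc k"
    by (simp add: algebra_simps)
  then show ?case unfolding eq using Suc finT dis cT by (simp add: card_Un_disjoint)
qed

lemma monics_add_low:
  assumes "p \<in> monics R k" "r \<in> low k"
  shows "p \<boxplus> r \<in> monics R k"
proof -
  obtain xs where p: "p = \<one> # xs" "set xs \<subseteq> carrier R" "length xs = k" using assms(1)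
      by (auto simp: monics_eq)
  have r: "set r \<subseteq> carrier R" "length r \<le> k" using assms(2) by (auto simp: low_def mem_Px)
  define rs where "rs = replicate (length xs - length r) \<zero> @ r"
  have rs: "replicate (length p - length r) \<zero> @ r = \<zero> # rs" "length rs = k" "set rs \<subseteq> carrier R"
    using r p by (auto simp: rs_def Suc_diff_le)
  have "p \<boxplus> r = normalize (map2 (\<oplus>) p (\<zero> # rs))"
    using r p rs(1) by (simp add: univ_poly_add)
  also have "\<dots> = \<one> # map2 (\<oplus>) xs rs" using p by simp
  finally have e: "p \<boxplus> r = \<one> # map2 (\<oplus>) xs rs" .
  have "p \<boxplus> r \<in> carrier Px" using assms by (auto simp: low_def monics_carrier)
  then show ?thesis using e p rs by (simp add: monics_iff)
qed

lemma monics_diff_low: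
  assumes "p \<in> monics R k" "r \<in> monics R k"
  shows "p \<boxminus> r \<in> low k"
proof -
  obtain xs where p: "p = \<one> # xs" "set xs \<subseteq> carrier R" "length xs = k" using assms(1)
      by (auto simp: monics_eq)
  obtain ys where r: "r = \<one> # ys" "set ys \<subseteq> carrier R" "length ys = k" using assms(2)
      by (auto simp: monics_eq)
  have "\<ominus>\<^bsub>Px\<^esub> r = map (\<lambda>a. \<ominus> a) r" using assms(2) monics_carrier
      by (intro univ_poly_a_inv_def'[OF carrier_is_subring]) auto
  then have "p \<boxminus> r = normalize (map2 (\<oplus>) p (map (\<lambda>a. \<ominus> a) r))"
    using p r by (simp add: a_minus_def univ_poly_add)
  also have "\<dots> = normalize (map2 (\<oplus>) xs (map (\<lambda>a. \<ominus> a) ys))" unfolding p r by (simp add: r_neg)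
  finally have "length (p \<boxminus> r) \<le> k" using normalize_length_le[of "map2 (\<oplus>) xs (map (\<lambda>a. \<ominus> a) ys)"] p r
      by simp
  then show ?thesis using assms by (simp add: low_def monics_carrier)
qed

text \<open>The variable names matter: \<open>algebra\<close> cancels only what its term order makes adjacent.\<close>

lemma diff_diff_right_cancel:
  "a \<in> carrier Px \<Longrightarrow> b \<in> carrier Px \<Longrightarrow> c \<in> carrier Px \<Longrightarrow>
   (a \<boxminus> b) \<boxminus> (c \<boxminus> b) = a \<boxminus> c"
  by algebra

lemma add_diff_right_cancel:
  "a \<in> carrier Px \<Longrightarrow> b \<in> carrier Px \<Longrightarrow> a = b \<boxplus> (a \<boxminus> b)"
  by algebra

text \<open>Because \<open>degree M <= m\<close>, reducing \<open>B - X^m\<close> modulo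
  \<open>M\<close> and adding the remainder to \<open>X^m\<close> gives a monic \<open>E0\<close> of
  degree \<open>m\<close> in the class; its members are the \<open>E0 + M * Q\<close> with
  \<open>Q\<close> in \<open>low (m - degree M)\<close>.\<close>

lemma card_monics_residue:
  assumes fin: "finite (carrier R)" and M: "M \<in> carrier Px" "M \<noteq> []" "degree M \<le> m"
      and B: "B \<in> carrier Px"
  shows "card {E \<in> monics R m. M pdivides (E \<boxminus> B)} = card (carrier R) ^ (m - degree M)"
proof -
  let ?S = "{E \<in> monics R m. M pdivides (E \<boxminus> B)}"
  define T where "T = \<one> # replicate m \<zero>"
  have T: "T \<in> monics R m" by (auto simp: T_def monics_iff mem_Px)
  define r where "r = (B \<boxminus> T) pmod M"
  have BT: "B \<boxminus> T \<in> carrier Px" using B T monics_carrier by auto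
  have rc: "r \<in> carrier Px" "(B \<boxminus> T) pdiv M \<in> carrier Px"
    unfolding r_def using long_division_closed[OF carrier_is_subfield BT M(1)] by auto
  have rlow: "r \<in> low m"
    using pmod_degree[OF carrier_is_subfield BT M(1,2)] rc M(3) by (auto simp: low_iff r_def)
  define E0 where "E0 = T \<boxplus> r"
  have E0m: "E0 \<in> monics R m" unfolding E0_def by (rule monics_add_low[OF T rlow])
  have "E0 \<boxminus> B = M \<boxtimes> (\<ominus>\<^bsub>Px\<^esub> ((B \<boxminus> T) pdiv M))"
  proof -
    have "B \<boxminus> T = M \<boxtimes> ((B \<boxminus> T) pdiv M) \<boxplus> r"
      unfolding r_def by (rule pdiv_pmod[OF carrier_is_subfield BT M(1)])
    moreover obtain u where u: "u = (B \<boxminus> T) pdiv M" by blast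
    ultimately have e: "B \<boxminus> T = M \<boxtimes> u \<boxplus> r" by simp
    have uc: "u \<in> carrier Px" "T \<in> carrier Px" using rc u T monics_carrier by auto
    have "E0 \<boxminus> B = r \<boxminus> (B \<boxminus> T)" unfolding E0_def using uc rc B by algebra
    also have "\<dots> = M \<boxtimes> (\<ominus>\<^bsub>Px\<^esub> u)" unfolding e using uc rc M by algebra
    finally show ?thesis unfolding u .
  qed
  then have E0: "E0 \<in> ?S" using E0m rc by (auto intro: pdividesI)
  have E0c: "E0 \<in> carrier Px" using E0m monics_carrier by auto
  have "bij_betw (\<lambda>Q. E0 \<boxplus> M \<boxtimes> Q) (low (m - degree M)) ?S"
  proof (rule bij_betwI')
    fix x y assume xy: "x \<in> low (m - degree M)" "y \<in> low (m - degree M)"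
    then have c: "x \<in> carrier Px" "y \<in> carrier Px" by (auto simp: low_def)
    show "(E0 \<boxplus> M \<boxtimes> x = E0 \<boxplus> M \<boxtimes> y) = (x = y)"
      using c E0c M UP.m_lcancel[of M x y] UP.add.l_cancel[of E0 "M \<boxtimes> x" "M \<boxtimes> y"]
      by (auto simp: Px_zero)
  next
    fix x assume x: "x \<in> low (m - degree M)"
    then have xc: "x \<in> carrier Px" by (auto simp: low_def)
    have "M \<boxtimes> x \<in> low m"
    proof (cases "x = []")
      case True then show ?thesis using mult_eq_Nil[of M x] xc M by (simp add: low_def mem_Px)
    next
      case False
      then show ?thesis using degree_mult[OF M(1) xc M(2) False] x M xc by (auto simp: low_iff)
    qed
    then have "E0 \<boxplus> M \<boxtimes> x \<in> monics R m" by (rule monics_add_low[OF E0m])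
    moreover have "M pdivides ((E0 \<boxplus> M \<boxtimes> x) \<boxminus> B)"
    proof -
      have "(E0 \<boxplus> M \<boxtimes> x) \<boxminus> B = (E0 \<boxminus> B) \<boxplus> M \<boxtimes> x" using E0c M B xc by algebra
      then show ?thesis using E0 E0c B M xc by (auto intro!: pdivides_add intro: pdividesI)
    qed
    ultimately show "E0 \<boxplus> M \<boxtimes> x \<in> ?S" by simp
  next
    fix E assume E: "E \<in> ?S"
    then have Ec: "E \<in> carrier Px" using monics_carrier by auto
    have "M pdivides ((E \<boxminus> B) \<boxminus> (E0 \<boxminus> B))"
      by (rule pdivides_minus) (use E E0 Ec E0c B M in auto)
    moreover have "(E \<boxminus> B) \<boxminus> (E0 \<boxminus> B) = E \<boxminus> E0" by (rule diff_diff_right_cancel[OF Ec B E0c])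
    ultimately obtain Q where Q: "Q \<in> carrier Px" "E \<boxminus> E0 = M \<boxtimes> Q" by (auto elim: pdividesE)
    have lo: "M \<boxtimes> Q \<in> low m" using monics_diff_low[of E m E0] E E0m Q by simp
    have "Q \<in> low (m - degree M)"
    proof (cases "Q = []")
      case False
      then have "degree M + degree Q < m"
        using lo degree_mult[OF M(1) Q(1) M(2) False] mult_eq_Nil[OF M(1) Q(1)] M by (simp add: low_iff)
      then have "degree Q < m - degree M" by linarith
      then show ?thesis using Q by (simp add: low_iff)
    qed (simp add: low_def mem_Px)
    moreover have "E = E0 \<boxplus> M \<boxtimes> Q" unfolding Q(2)[symmetric] by (rule add_diff_right_cancel[OF Ec E0c])
    ultimately show "\<exists>x\<in>low (m - degree M). E = E0 \<boxplus> M \<boxtimes> x" by blast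
  qed
  from bij_betw_same_card[OF this] show ?thesis using card_low[OF fin, of "m - degree M"]
      by (simp only:)
qed

end

section \<open>Monic irreducibles, unique factorisation and inverses modulo a polynomial\<close>

context field
begin

interpretation UP: principal_domain Px
  by (rule Px_principal)

definition mprimes :: "'a list set" where
  "mprimes = {p \<in> carrier Px. p \<noteq> [] \<and> hd p = \<one> \<and> pirreducible (carrier R) p}"

lemma mprimes_carrier: "p \<in> mprimes \<Longrightarrow> p \<in> carrier Px" by (simp add: mprimes_def)

lemma mprimes_monics: "p \<in> mprimes \<Longrightarrow> p \<in> monics R (degree p)" by (simp add: mprimes_def monics_def)

lemma Units_Px: "Units Px = {[k] | k. k \<in> carrier R - {\<zero>}}" by (rule univ_poly_carrier_units)

lemma Units_Px_iff: "p \<in> Units Px \<longleftrightarrow> p \<in> carrier Px \<and> p \<noteq> [] \<and> degree p = 0"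
  unfolding Units_Px by (cases p) (auto simp: mem_Px)

lemma mprimes_degree_ge_1: "p \<in> mprimes \<Longrightarrow> 1 \<le> degree p"
proof -
  assume p: "p \<in> mprimes"
  have "p \<notin> Units Px"
    using pirreducibleE(2)[OF carrier_is_subring mprimes_carrier[OF p]] p by (simp add: mprimes_def)
  then show ?thesis using p by (auto simp: Units_Px_iff mprimes_def not_less_eq_eq)
qed

lemma mprimes_prime:
  assumes "p \<in> mprimes" "x \<in> carrier Px" "y \<in> carrier Px" "p pdivides (x \<boxtimes> y)"
  shows "p pdivides x \<or> p pdivides y"
proof -
  have "pprime (carrier R) p"
    using pprime_iff_pirreducible[OF carrier_is_subfield mprimes_carrier[OF assms(1)]] assms(1)
        by (simp add: mprimes_def)
  then show ?thesis using pprimeE(3)[OF carrier_is_subfield mprimes_carrier[OF assms(1)]] assms by blast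
qed

lemma mprimes_divides_eq:
  assumes p: "p \<in> mprimes" and y: "y \<in> mprimes" and d: "p pdivides y"
  shows "p = y"
proof -
  obtain r where r: "r \<in> carrier Px" "y = p \<boxtimes> r" using d by (rule pdividesE)
  have "p \<notin> Units Px" using mprimes_degree_ge_1[OF p] by (auto simp: Units_Px_iff)
  then have "r \<in> Units Px"
    using pirreducibleE(3)[OF carrier_is_subring mprimes_carrier[OF y] _ mprimes_carrier[OF p] r] y
        by (auto simp: mprimes_def)
  then obtain k where k: "r = [k]" "k \<in> carrier R" "k \<noteq> \<zero>" by (auto simp: Units_Px)
  have "hd y = hd p \<otimes> hd r" unfolding r(2) using p r k by (intro hd_mult) (auto simp: mprimes_def)
  then have "k = \<one>" using p y k by (simp add: mprimes_def)
  then show ?thesis using r k mprimes_carrier[OF p] UP.r_one[of p] by (simp add: Px_one)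
qed

lemma monic_associate:
  assumes "p \<in> carrier Px" "p \<noteq> []"
  obtains u v where "u \<in> carrier Px" "v \<in> carrier Px" "u \<boxtimes> p \<in> monics R (degree p)" "p = v \<boxtimes> (u \<boxtimes> p)"
proof -
  have h: "hd p \<in> carrier R" "hd p \<noteq> \<zero>" using assms by (cases p; auto simp: mem_Px)+
  then have hU: "hd p \<in> Units R" by (simp add: field_Units)
  then have i: "inv (hd p) \<in> carrier R" "inv (hd p) \<otimes> hd p = \<one>" "inv (hd p) \<noteq> \<zero>"
  proof -
    show 1: "inv (hd p) \<in> carrier R" "inv (hd p) \<otimes> hd p = \<one>" using hU by (auto simp: Units_l_inv)
    show "inv (hd p) \<noteq> \<zero>" using 1(2) h(1) by (metis l_null zero_not_one)
  qed
  have u: "[inv (hd p)] \<in> carrier Px" "[hd p] \<in> carrier Px" using h i by (auto simp: mem_Px)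
  have "[inv (hd p)] \<boxtimes> p \<in> monics R (degree p)"
    using degree_mult[OF u(1) assms(1)] hd_mult[OF u(1) assms(1)] mult_eq_Nil[OF u(1) assms(1)] assms u
        i
    by (simp add: monics_def)
  moreover have "p = [hd p] \<boxtimes> ([inv (hd p)] \<boxtimes> p)"
  proof -
    have "[hd p] \<boxtimes> [inv (hd p)] = \<one>\<^bsub>Px\<^esub>"
    proof -
      have "[hd p] \<boxtimes> [inv (hd p)] \<in> monics R 0"
        using degree_mult[OF u(2,1)] hd_mult[OF u(2,1)] mult_eq_Nil[OF u(2,1)] u i h m_comm
        by (simp add: monics_def)
      then show ?thesis by (simp add: monics_0 Px_one)
    qed
    then show ?thesis using UP.m_assoc[OF u(2,1) assms(1)] assms by simp
  qed
  ultimately show thesis using that u by blast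
qed

text \<open>A monic divisor of least positive degree is irreducible, since a proper factor of it,
  made monic, would have smaller degree.\<close>

lemma exists_mprime_divisor:
  assumes "F \<in> carrier Px" "F \<noteq> []" "1 \<le> degree F"
  shows "\<exists>p\<in>mprimes. p pdivides F"
proof -
  define S where "S = {k. 1 \<le> k \<and> (\<exists>p\<in>monics R k. p pdivides F)}"
  obtain u v where uv: "u \<in> carrier Px" "v \<in> carrier Px" "u \<boxtimes> F \<in> monics R (degree F)" "F = v \<boxtimes> (u \<boxtimes> F)"
    using monic_associate[OF assms(1,2)] .
  have "(u \<boxtimes> F) pdivides F"
    using uv assms UP.m_comm[of v "u \<boxtimes> F"] by (intro pdividesI[of v]) auto
  then have "degree F \<in> S" using uv(3) assms(3) by (auto simp: S_def)
  define k where "k = (LEAST k. k \<in> S)"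
  have kS: "k \<in> S" unfolding k_def using \<open>degree F \<in> S\<close> by (rule LeastI)
  have kmin: "k \<le> j" if "j \<in> S" for j unfolding k_def using that by (rule Least_le)
  obtain p where p: "p \<in> monics R k" "p pdivides F" "1 \<le> k" using kS by (auto simp: S_def)
  have pc: "p \<in> carrier Px" "p \<noteq> []" "degree p = k" "hd p = \<one>" using p by (auto simp: monics_def)
  have "pirreducible (carrier R) p"
  proof (rule pirreducibleI[OF carrier_is_subring pc(1,2)])
    show "p \<notin> Units Px" using pc p by (simp add: Units_Px_iff)
    fix q r assume qr: "q \<in> carrier Px" "r \<in> carrier Px" "p = q \<boxtimes> r"
    show "q \<in> Units Px \<or> r \<in> Units Px"
    proof (rule ccontr)
      assume n: "\<not> (q \<in> Units Px \<or> r \<in> Units Px)"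
      have ne: "q \<noteq> []" "r \<noteq> []" using qr pc mult_eq_Nil[OF qr(1,2)] by auto
      then have d: "1 \<le> degree q" "1 \<le> degree r" "degree q + degree r = k"
        using n qr pc degree_mult[OF qr(1,2) ne] by (auto simp: Units_Px_iff not_less_eq_eq)
      obtain u v where uv: "u \<in> carrier Px" "v \<in> carrier Px" "u \<boxtimes> q \<in> monics R (degree q)" "q
          = v \<boxtimes> (u \<boxtimes> q)"
        using monic_associate[OF qr(1) ne(1)] .
      have "(u \<boxtimes> q) pdivides p"
      proof (rule pdividesI[of "v \<boxtimes> r"])
        have "p = (v \<boxtimes> (u \<boxtimes> q)) \<boxtimes> r" using qr(3) uv(4) by simp
        also have "\<dots> = (u \<boxtimes> q) \<boxtimes> (v \<boxtimes> r)" using uv(1,2) qr(1,2) by algebra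
        finally show "p = (u \<boxtimes> q) \<boxtimes> (v \<boxtimes> r)" .
      qed (use uv qr in auto)
      then have "(u \<boxtimes> q) pdivides F" using pdivides_trans p(2) monics_carrier[OF uv(3)] by blast
      then have "degree q \<in> S" using uv(3) d by (auto simp: S_def)
      then show False using kmin[of "degree q"] d by simp
    qed
  qed
  then show ?thesis using p pc by (auto simp: mprimes_def)
qed

text \<open>The list is an arbitrary enumeration; by commutativity its order does not affect the
  product.\<close>

definition mset_prod :: "'a list multiset \<Rightarrow> 'a list" where
  "mset_prod F = foldr (\<boxtimes>) (SOME xs. mset xs = F) \<one>\<^bsub>Px\<^esub>"

lemma mset_prod_eq:
  assumes "set xs \<subseteq> carrier Px"
  shows "mset_prod (mset xs) = foldr (\<boxtimes>) xs \<one>\<^bsub>Px\<^esub>"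
proof -
  define ys where "ys = (SOME ys. mset ys = mset xs)"
  have "mset ys = mset xs" unfolding ys_def by (rule someI[of _ xs]) simp
  then have "foldr (\<boxtimes>) xs \<one>\<^bsub>Px\<^esub> = foldr (\<boxtimes>) ys \<one>\<^bsub>Px\<^esub>"
    by (intro UP.multlist_perm_cong assms) simp
  then show ?thesis by (simp add: mset_prod_def ys_def)
qed

lemma mset_prod_empty [simp]: "mset_prod {#} = [\<one>]"
  using mset_prod_eq[of "[]"] by (simp add: Px_one)

lemma mset_prod_closed: "set_mset F \<subseteq> carrier Px \<Longrightarrow> mset_prod F \<in> carrier Px"
proof -
  assume F: "set_mset F \<subseteq> carrier Px"
  obtain xs where xs: "mset xs = F" using ex_mset by blast
  then have "set xs \<subseteq> carrier Px" using F by auto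
  then show ?thesis using mset_prod_eq[of xs] xs UP.multlist_closed[of xs] by simp
qed

lemma mset_prod_add: "p \<in> carrier Px \<Longrightarrow> set_mset F \<subseteq> carrier Px
    \<Longrightarrow> mset_prod (add_mset p F) = p \<boxtimes> mset_prod F"
proof -
  assume p: "p \<in> carrier Px" and F: "set_mset F \<subseteq> carrier Px"
  obtain xs where xs: "mset xs = F" using ex_mset by blast
  then have "set xs \<subseteq> carrier Px" using F by auto
  then show ?thesis using mset_prod_eq[of xs] mset_prod_eq[of "p # xs"] xs p by auto
qed

lemma mset_prod_union:
  "set_mset F \<subseteq> carrier Px \<Longrightarrow> set_mset G \<subseteq> carrier Px \<Longrightarrow> mset_prod (F + G) = mset_prod F \<boxtimes> mset_prod G"
proof (induction F)
  case empty
  then show ?case using mset_prod_closed[of G] UP.l_one by (simp add: Px_one[symmetric])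
next
  case (add p F)
  then show ?case using mset_prod_closed by (simp add: mset_prod_add UP.m_assoc)
qed

lemma mset_prod_monics: "set_mset F \<subseteq> mprimes \<Longrightarrow> mset_prod F \<in> monics R (\<Sum>p\<in>#F. degree p)"
proof (induction F)
  case empty then show ?case by (simp add: monics_0)
next
  case (add p F)
  then have "set_mset F \<subseteq> carrier Px" using mprimes_carrier by auto
  then show ?case using add monics_mult[OF mprimes_monics[of p], of "mset_prod F"] mprimes_carrier[of p]
    by (simp add: mset_prod_add)
qed

lemma mprime_divides_mset_prod:
  assumes p: "p \<in> mprimes" and F: "set_mset F \<subseteq> mprimes"
  shows "p pdivides mset_prod F \<longleftrightarrow> p \<in># F"
  using F
proof (induction F)
  case empty
  have "\<not> p pdivides [\<one>]"
    using pdivides_imp_degree_le[OF carrier_is_subring mprimes_carrier[OF p], of "[\<one>]"]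
        mprimes_degree_ge_1[OF p]
    by (auto simp: mem_Px)
  then show ?case by simp
next
  case (add r F)
  have c: "r \<in> carrier Px" "set_mset F \<subseteq> carrier Px" "r \<in> mprimes" using add.prems mprimes_carrier
      by auto
  have mc: "mset_prod F \<in> carrier Px" using c by (intro mset_prod_closed)
  have "p pdivides (r \<boxtimes> mset_prod F) \<longleftrightarrow> p pdivides r \<or> p pdivides mset_prod F"
  proof
    show "p pdivides r \<or> p pdivides mset_prod F" if "p pdivides (r \<boxtimes> mset_prod F)"
      using mprimes_prime[OF p c(1) mc that] .
    show "p pdivides (r \<boxtimes> mset_prod F)" if "p pdivides r \<or> p pdivides mset_prod F"
      using that pdivides_mult[OF mprimes_carrier[OF p] mc c(1)] pdivides_mult[OF mprimes_carrier[OF p]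
          c(1) mc]
        UP.m_comm[OF c(1) mc] by auto
  qed
  moreover have "p pdivides r \<longleftrightarrow> p = r"
    using mprimes_divides_eq[OF p c(3)] mprimes_carrier[OF p] pdividesI[of "\<one>\<^bsub>Px\<^esub>" p p] by auto
  ultimately show ?case using add c by (simp add: mset_prod_add)
qed

lemma mset_prod_inj:
  "set_mset F \<subseteq> mprimes \<Longrightarrow> set_mset G \<subseteq> mprimes \<Longrightarrow> mset_prod F = mset_prod G \<Longrightarrow> F = G"
proof (induction F arbitrary: G)
  case empty
  have "p \<notin># G" for p
    using mprime_divides_mset_prod[of p G] mprime_divides_mset_prod[of p "{#}"] empty by auto
  then show ?case by (simp add: multiset_eqI not_in_iff)
next
  case (add p F)
  have p: "p \<in> mprimes" using add.prems by simp
  have "p \<in># G" using mprime_divides_mset_prod[OF p] add.prems by (metis union_single_eq_member)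
  then obtain G' where G': "G = add_mset p G'" by (metis mset_add)
  have s: "set_mset F \<subseteq> mprimes" "set_mset G' \<subseteq> mprimes" using add.prems(1,2) G' by simp_all
  have c: "set_mset F \<subseteq> carrier Px" "set_mset G' \<subseteq> carrier Px" using s mprimes_carrier by blast+
  have pc: "p \<in> carrier Px" "p \<noteq> []" using p by (simp_all add: mprimes_def)
  have "p \<boxtimes> mset_prod F = p \<boxtimes> mset_prod G'"
    using add.prems(3) c pc by (simp add: G' mset_prod_add)
  then have "mset_prod F = mset_prod G'"
    using UP.m_lcancel[of p "mset_prod F" "mset_prod G'"] pc mset_prod_closed[OF c(1)]
        mset_prod_closed[OF c(2)]
    by (simp add: Px_zero)
  then have "F = G'" using s by (intro add.IH)
  then show ?case using G' by simp
qed

lemma monics_factorization: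
  "F \<in> monics R k \<Longrightarrow> \<exists>G. set_mset G \<subseteq> mprimes \<and> mset_prod G = F"
proof (induction k arbitrary: F rule: less_induct)
  case (less k)
  show ?case
  proof (cases "k = 0")
    case True
    then show ?thesis using less.prems by (intro exI[of _ "{#}"]) (simp add: monics_0)
  next
    case False
    have F: "F \<in> carrier Px" "F \<noteq> []" "degree F = k" "hd F = \<one>" using less.prems
        by (auto simp: monics_def)
    obtain p where p: "p \<in> mprimes" "p pdivides F" using exists_mprime_divisor[OF F(1,2)] F False
        by auto
    obtain r where r: "r \<in> carrier Px" "F = p \<boxtimes> r" using p(2) by (rule pdividesE)
    have pc: "p \<in> carrier Px" "p \<noteq> []" "hd p = \<one>" using p by (auto simp: mprimes_def)
    have rn: "r \<noteq> []" using r F mult_eq_Nil[OF pc(1) r(1)] by auto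
    then have "hd r = \<one>" using hd_mult[OF pc(1) r(1) pc(2) rn] r F pc by (cases r) (auto simp: mem_Px)
    then have rm: "r \<in> monics R (degree r)" using r rn by (simp add: monics_def)
    have "degree r < k" using degree_mult[OF pc(1) r(1) pc(2) rn] r F mprimes_degree_ge_1[OF p(1)]
        by simp
    from less.IH[OF this rm] obtain G where G: "set_mset G \<subseteq> mprimes" "mset_prod G = r" by blast
    have "mset_prod (add_mset p G) = F" using G r pc mprimes_carrier by (subst mset_prod_add) auto
    then show ?thesis using G p by (intro exI[of _ "add_mset p G"]) auto
  qed
qed

text \<open>Unique factorisation, shaped after the counting assumption of
  \<open>prime_system\<close>.\<close>

lemma mset_prod_bij:
  "bij_betw mset_prod {F. set_mset F \<subseteq> mprimes \<and> (\<Sum>p\<in>#F. degree p) = k} (monics R k)"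
proof (rule bij_betwI')
  fix F G assume "F \<in> {F. set_mset F \<subseteq> mprimes \<and> (\<Sum>p\<in>#F. degree p)
      = k}" "G \<in> {F. set_mset F \<subseteq> mprimes \<and> (\<Sum>p\<in>#F. degree p) = k}"
  then show "(mset_prod F = mset_prod G) = (F = G)" using mset_prod_inj by auto
next
  fix F assume "F \<in> {F. set_mset F \<subseteq> mprimes \<and> (\<Sum>p\<in>#F. degree p) = k}"
  then show "mset_prod F \<in> monics R k" using mset_prod_monics by auto
next
  fix y assume y: "y \<in> monics R k"
  then obtain G where G: "set_mset G \<subseteq> mprimes" "mset_prod G = y" using monics_factorization by blast
  then have "y \<in> monics R (\<Sum>p\<in>#G. degree p)" using mset_prod_monics by blast
  then have "(\<Sum>p\<in>#G. degree p) = k" using y by (simp add: monics_def)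
  then show "\<exists>F\<in>{F. set_mset F \<subseteq> mprimes \<and> (\<Sum>p\<in>#F. degree p) = k}. y = mset_prod F" using G by auto
qed

text \<open>Bezout: the ideal generated by \<open>p\<close> and \<open>M\<close> is principal, and
  its generator \<open>g\<close> divides both. If \<open>g\<close> were associated to
  \<open>p\<close>, then \<open>p\<close> would divide \<open>M\<close>; hence \<open>g\<close> is a
  unit.\<close>

lemma mprime_invertible:
  assumes p: "p \<in> mprimes" and M: "M \<in> carrier Px" "\<not> p pdivides M"
  shows "\<exists>w\<in>carrier Px. M pdivides (w \<boxtimes> p \<boxminus> \<one>\<^bsub>Px\<^esub>)"
proof -
  have pc: "p \<in> carrier Px" by (rule mprimes_carrier[OF p])
  have "ideal (PIdl\<^bsub>Px\<^esub> p <+>\<^bsub>Px\<^esub> PIdl\<^bsub>Px\<^esub> M) Px"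
    by (intro UP.add_ideals UP.cgenideal_ideal pc M)
  then obtain g where g: "g \<in> carrier Px" "PIdl\<^bsub>Px\<^esub> p <+>\<^bsub>Px\<^esub> PIdl\<^bsub>Px\<^esub> M = PIdl\<^bsub>Px\<^esub> g"
    using UP.exists_gen by blast
  have sum: "z \<in> PIdl\<^bsub>Px\<^esub> g \<longleftrightarrow> (\<exists>x\<in>carrier Px. \<exists>y\<in>carrier Px. z = x \<boxtimes> p \<boxplus> y \<boxtimes> M)" for z
    unfolding g(2)[symmetric] by (auto simp: set_add_def' cgenideal_def)
  have dvd: "g pdivides z" if "z \<in> PIdl\<^bsub>Px\<^esub> g" for z
    using that g(1) UP.m_comm[of _ g] by (auto simp: cgenideal_def intro: pdividesI)
  have "p = \<one>\<^bsub>Px\<^esub> \<boxtimes> p \<boxplus> \<zero>\<^bsub>Px\<^esub> \<boxtimes> M" "M = \<zero>\<^bsub>Px\<^esub> \<boxtimes> p \<boxplus> \<one>\<^bsub>Px\<^esub> \<boxtimes> M"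
    using pc M by simp_all
  then have "p \<in> PIdl\<^bsub>Px\<^esub> g" "M \<in> PIdl\<^bsub>Px\<^esub> g" unfolding sum by blast+
  then have gp: "g pdivides p" and gM: "g pdivides M" by (auto intro: dvd)
  obtain r where r: "r \<in> carrier Px" "p = g \<boxtimes> r" using gp by (rule pdividesE)
  have "g \<in> Units Px \<or> r \<in> Units Px"
    using pirreducibleE(3)[OF carrier_is_subring pc _ g(1) r] p by (simp add: mprimes_def)
  moreover have "r \<notin> Units Px"
  proof
    assume rU: "r \<in> Units Px"
    have "p \<boxtimes> inv\<^bsub>Px\<^esub> r = g"
      unfolding r(2) using rU r g by (simp add: UP.m_assoc UP.Units_r_inv)
    then have "p pdivides g" using rU by (intro pdividesI[of "inv\<^bsub>Px\<^esub> r"]) auto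
    then show False using pdivides_trans[OF pc _ gM] M(2) by blast
  qed
  ultimately have gU: "g \<in> Units Px" by blast
  have "g \<in> PIdl\<^bsub>Px\<^esub> g" using g(1) by (rule UP.cgenideal_self)
  then obtain x y where xy: "x \<in> carrier Px" "y \<in> carrier Px" "g = x \<boxtimes> p \<boxplus> y \<boxtimes> M"
    unfolding sum by blast
  define i where "i = inv\<^bsub>Px\<^esub> g"
  have i: "i \<in> carrier Px" "i \<boxtimes> g = \<one>\<^bsub>Px\<^esub>" using gU by (auto simp: i_def UP.Units_l_inv)
  have "(i \<boxtimes> x) \<boxtimes> p \<boxminus> i \<boxtimes> g = M \<boxtimes> (\<ominus>\<^bsub>Px\<^esub> (i \<boxtimes> y))"
    unfolding xy(3) using i(1) xy(1,2) pc M(1) by algebra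
  then have "(i \<boxtimes> x) \<boxtimes> p \<boxminus> \<one>\<^bsub>Px\<^esub> = M \<boxtimes> (\<ominus>\<^bsub>Px\<^esub> (i \<boxtimes> y))" unfolding i(2) .
  then show ?thesis using i xy by (intro bexI[of _ "i \<boxtimes> x"] pdividesI) auto
qed

lemma mset_prod_invertible:
  assumes M: "M \<in> carrier Px" and F: "set_mset F \<subseteq> {p \<in> mprimes. \<not> p pdivides M}"
  shows "\<exists>w\<in>carrier Px. M pdivides (w \<boxtimes> mset_prod F \<boxminus> \<one>\<^bsub>Px\<^esub>)"
  using F
proof (induction F)
  case empty
  have "\<one>\<^bsub>Px\<^esub> \<boxtimes> \<one>\<^bsub>Px\<^esub> \<boxminus> \<one>\<^bsub>Px\<^esub> = M \<boxtimes> \<zero>\<^bsub>Px\<^esub>" using M by algebra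
  then show ?case by (intro bexI[of _ "\<one>\<^bsub>Px\<^esub>"] pdividesI[of "\<zero>\<^bsub>Px\<^esub>"]) (auto simp: Px_one[symmetric])
next
  case (add p F)
  have c: "p \<in> carrier Px" "p \<in> mprimes" "\<not> p pdivides M" "set_mset F \<subseteq> carrier Px"
    using add.prems mprimes_carrier by auto
  define f where "f = mset_prod F"
  have f: "f \<in> carrier Px" unfolding f_def by (rule mset_prod_closed[OF c(4)])
  obtain w where w: "w \<in> carrier Px" "M pdivides (w \<boxtimes> f \<boxminus> \<one>\<^bsub>Px\<^esub>)" using add by (auto simp: f_def)
  obtain v where v: "v \<in> carrier Px" "M pdivides (v \<boxtimes> p \<boxminus> \<one>\<^bsub>Px\<^esub>)"
      using mprime_invertible[OF c(2) M c(3)] by blast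
  have "(v \<boxtimes> w) \<boxtimes> (p \<boxtimes> f) \<boxminus> \<one>\<^bsub>Px\<^esub>
      = (v \<boxtimes> p) \<boxtimes> (w \<boxtimes> f \<boxminus> \<one>\<^bsub>Px\<^esub>) \<boxplus> (v \<boxtimes> p \<boxminus> \<one>\<^bsub>Px\<^esub>)"
    using v(1) w(1) c(1) f by algebra
  moreover have "M pdivides ((v \<boxtimes> p) \<boxtimes> (w \<boxtimes> f \<boxminus> \<one>\<^bsub>Px\<^esub>) \<boxplus> (v \<boxtimes> p \<boxminus> \<one>\<^bsub>Px\<^esub>))"
    by (rule pdivides_add[OF M _ _ pdivides_mult[OF M _ _ w(2)] v(2)]) (use v w c f M in auto)
  ultimately show ?case using v w c f_def by (intro bexI[of _ "v \<boxtimes> w"]) (auto simp: mset_prod_add)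
qed

text \<open>With \<open>w\<close> an inverse of \<open>mset_prod D\<close> modulo \<open>M\<close>,
  the condition places \<open>mset_prod F\<close> in the class of \<open>w * A\<close>, so this
  counts the monic polynomials of degree \<open>m\<close> in a single residue class.\<close>

lemma card_ap_multiples:
  assumes fin: "finite (carrier R)" and M: "M \<in> carrier Px" "M \<noteq> []" "degree M \<le> m"
      and A: "A \<in> carrier Px"
    and D: "set_mset D \<subseteq> {p \<in> mprimes. \<not> p pdivides M}"
  shows "card {F. set_mset F \<subseteq> mprimes \<and> (\<Sum>p\<in>#F. degree p) = m \<and> poly_cong R M (mset_prod (D + F)) A}
       = card (carrier R) ^ (m - degree M)"
proof -
  define d where "d = mset_prod D"
  have Dc: "set_mset D \<subseteq> carrier Px" using D mprimes_carrier by auto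
  have d: "d \<in> carrier Px" unfolding d_def by (rule mset_prod_closed[OF Dc])
  obtain w where w: "w \<in> carrier Px" "M pdivides (w \<boxtimes> d \<boxminus> \<one>\<^bsub>Px\<^esub>)"
      using mset_prod_invertible[OF M(1) D] by (auto simp: d_def)
  have equiv: "M pdivides (d \<boxtimes> E \<boxminus> A) \<longleftrightarrow> M pdivides (E \<boxminus> w \<boxtimes> A)" if E: "E \<in> carrier Px" for E
  proof
    assume a: "M pdivides (d \<boxtimes> E \<boxminus> A)"
    have "M pdivides (w \<boxtimes> (d \<boxtimes> E \<boxminus> A) \<boxminus> E \<boxtimes> (w \<boxtimes> d \<boxminus> \<one>\<^bsub>Px\<^esub>))"
      by (rule pdivides_minus[OF M(1) _ _ pdivides_mult[OF M(1) _ _ a] pdivides_mult[OF M(1) _ _ w(2)]])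
         (use w E d A M in auto)
    moreover have "w \<boxtimes> (d \<boxtimes> E \<boxminus> A) \<boxminus> E \<boxtimes> (w \<boxtimes> d \<boxminus> \<one>\<^bsub>Px\<^esub>) = E \<boxtimes> \<one>\<^bsub>Px\<^esub> \<boxminus> w \<boxtimes> A"
      using w(1) E d A by algebra
    ultimately show "M pdivides (E \<boxminus> w \<boxtimes> A)" using E by simp
  next
    assume a: "M pdivides (E \<boxminus> w \<boxtimes> A)"
    have "M pdivides (d \<boxtimes> (E \<boxminus> w \<boxtimes> A) \<boxplus> A \<boxtimes> (w \<boxtimes> d \<boxminus> \<one>\<^bsub>Px\<^esub>))"
      by (rule pdivides_add[OF M(1) _ _ pdivides_mult[OF M(1) _ _ a] pdivides_mult[OF M(1) _ _ w(2)]])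
         (use w E d A M in auto)
    moreover have "d \<boxtimes> (E \<boxminus> w \<boxtimes> A) \<boxplus> A \<boxtimes> (w \<boxtimes> d \<boxminus> \<one>\<^bsub>Px\<^esub>) = d \<boxtimes> E \<boxminus> A \<boxtimes> \<one>\<^bsub>Px\<^esub>"
      using w(1) E d A by algebra
    ultimately show "M pdivides (d \<boxtimes> E \<boxminus> A)" using A by simp
  qed
  have "bij_betw mset_prod {F. set_mset F \<subseteq> mprimes \<and> (\<Sum>p\<in>#F. degree p) = m
      \<and> poly_cong R M (mset_prod (D + F)) A}
      {E \<in> monics R m. M pdivides (E \<boxminus> w \<boxtimes> A)}"
  proof (rule bij_betw_subset[OF mset_prod_bij[of m], THEN bij_betw_cong[THEN iffD1, rotated]])
    let ?S = "{F. set_mset F \<subseteq> mprimes \<and> (\<Sum>p\<in>#F. degree p) = m}"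
    have e: "poly_cong R M (mset_prod (D + F)) A \<longleftrightarrow> M pdivides (mset_prod F \<boxminus> w \<boxtimes> A)" if F: "set_mset F
        \<subseteq> mprimes" for F
    proof -
      have Fc: "set_mset F \<subseteq> carrier Px" using F mprimes_carrier by auto
      then show ?thesis unfolding poly_cong_def mset_prod_union[OF Dc Fc] d_def[symmetric]
        by (intro equiv mset_prod_closed)
    qed
    show "{F. set_mset F \<subseteq> mprimes \<and> (\<Sum>p\<in>#F. degree p) = m
        \<and> poly_cong R M (mset_prod (D + F)) A} \<subseteq> ?S" by auto
    show "mset_prod ` {F. set_mset F \<subseteq> mprimes \<and> (\<Sum>p\<in>#F. degree p) = m
        \<and> poly_cong R M (mset_prod (D + F)) A}
        = {E \<in> monics R m. M pdivides (E \<boxminus> w \<boxtimes> A)}"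
    proof -
      have "mset_prod ` ?S = monics R m" using mset_prod_bij[of m] by (rule bij_betw_imp_surj_on)
      moreover have "{F. set_mset F \<subseteq> mprimes \<and> (\<Sum>p\<in>#F. degree p) = m
          \<and> poly_cong R M (mset_prod (D + F)) A}
         = {F \<in> ?S. M pdivides (mset_prod F \<boxminus> w \<boxtimes> A)}" using e by auto
      ultimately show ?thesis by auto
    qed
  qed simp
  then have "card {F. set_mset F \<subseteq> mprimes \<and> (\<Sum>p\<in>#F. degree p) = m
      \<and> poly_cong R M (mset_prod (D + F)) A}
     = card {E \<in> monics R m. M pdivides (E \<boxminus> w \<boxtimes> A)}" by (rule bij_betw_same_card)
  also have "\<dots> = card (carrier R) ^ (m - degree M)"
    using w A by (intro card_monics_residue fin M) auto
  finally show ?thesis .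
qed

end

section \<open>The totient and the main estimate\<close>

text \<open>Among the multisets avoiding \<open>B\<close>, those containing \<open>p\<close>
  correspond to the ones of degree \<open>m - dg p\<close>. Since \<open>m\<close> is at least the
  total degree of \<open>insert p B\<close>, the induction never runs out of degree and the product
  formula is exact.\<close>

lemma (in prime_system) card_elems_avoiding:
  "finite B \<Longrightarrow> B \<subseteq> P \<Longrightarrow> (\<Sum>p\<in>B. dg p) \<le> m \<Longrightarrow>
   real (card {F \<in> elems m. set_mset F \<inter> B = {}}) = real q ^ m * (\<Prod>p\<in>B. 1 - 1 / real q ^ dg p)"
proof (induction B arbitrary: m rule: finite_induct)
  case empty
  then show ?case by (simp add: card_elems)
next
  case (insert p B)
  define S where "S B m = {F \<in> elems m. set_mset F \<inter> B = {}}" for B m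
  have dp: "dg p \<le> m" "(\<Sum>p\<in>B. dg p) \<le> m - dg p" "(\<Sum>p\<in>B. dg p) \<le> m" using insert by auto
  have fin: "finite (S B m)" for B m unfolding S_def using finite_elems by simp
  have eq: "S B m = S (insert p B) m \<union> add_mset p ` S B (m - dg p)"
  proof (rule Set.set_eqI, rule iffI)
    fix F assume F: "F \<in> S B m"
    show "F \<in> S (insert p B) m \<union> add_mset p ` S B (m - dg p)"
    proof (cases "p \<in># F")
      case True
      then obtain G where "F = add_mset p G" by (metis mset_add)
      then show ?thesis using F by (auto simp: S_def elems_def)
    qed (use F in \<open>auto simp: S_def\<close>)
  next
    fix F assume "F \<in> S (insert p B) m \<union> add_mset p ` S B (m - dg p)"
    then show "F \<in> S B m" using insert dp by (auto simp: S_def elems_def)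
  qed
  have "S (insert p B) m \<inter> add_mset p ` S B (m - dg p) = {}" by (auto simp: S_def)
  then have "card (S B m) = card (S (insert p B) m) + card (add_mset p ` S B (m - dg p))"
    by (subst eq) (simp add: card_Un_disjoint fin)
  also have "card (add_mset p ` S B (m - dg p)) = card (S B (m - dg p))"
    by (rule card_image) (auto simp: inj_on_def)
  finally have "real (card (S (insert p B) m))
      = real (card (S B m)) - real (card (S B (m - dg p)))" by simp
  also have "\<dots> = (real q ^ m - real q ^ (m - dg p)) * (\<Prod>p\<in>B. 1 - 1 / real q ^ dg p)"
    using insert.IH[of m] insert.IH[of "m - dg p"] insert.prems dp
        by (simp add: S_def left_diff_distrib)
  also have "real q ^ (m - dg p) = real q ^ m / real q ^ dg p"
    using q_ge_2 dp by (intro power_diff) auto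
  finally show ?case using insert by (simp add: S_def algebra_simps)
qed

text \<open>An opaque copy of the degree: the simplifier rewrites inside the abbreviation
  \<open>Polynomials.degree\<close>, which would spoil it as a locale parameter.\<close>

definition pdeg :: "'a list \<Rightarrow> nat" where
  "pdeg p = Polynomials.degree p"

context field
begin

interpretation UP: principal_domain Px
  by (rule Px_principal)

lemma mset_prod_pdeg_bij:
  "bij_betw mset_prod {F. set_mset F \<subseteq> mprimes \<and> (\<Sum>p\<in>#F. pdeg p) = k} (monics R k)"
  unfolding pdeg_def by (rule mset_prod_bij)

lemma mprimes_pdeg_ge_1: "p \<in> mprimes \<Longrightarrow> 1 \<le> pdeg p"
  unfolding pdeg_def by (rule mprimes_degree_ge_1)

lemma card_carrier_ge_2: "finite (carrier R) \<Longrightarrow> 2 \<le> card (carrier R)"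
proof -
  assume "finite (carrier R)"
  then have "card {\<zero>, \<one>} \<le> card (carrier R)" by (intro card_mono) auto
  then show ?thesis by simp
qed

lemma prime_system_mprimes: "finite (carrier R) \<Longrightarrow> prime_system mprimes pdeg (card (carrier R))"
proof
  assume fin: "finite (carrier R)"
  show "2 \<le> card (carrier R)" by (rule card_carrier_ge_2[OF fin])
  show "card {F. set_mset F \<subseteq> mprimes \<and> (\<Sum>p\<in>#F. pdeg p) = k} = card (carrier R) ^ k" for k
    using bij_betw_same_card[OF mset_prod_pdeg_bij[of k]] card_monics[OF fin, of k] by simp
qed (rule mprimes_pdeg_ge_1)

lemma add_diff_cancel_right: "a \<in> carrier Px \<Longrightarrow> b \<in> carrier Px \<Longrightarrow> (a \<boxplus> b) \<boxminus> b = a"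
  by algebra

lemma diff_diff_left_cancel: "z \<in> carrier Px \<Longrightarrow> b \<in> carrier Px \<Longrightarrow> z \<boxminus> (z \<boxminus> b) = b"
  by algebra

definition prime_divisors :: "'a list \<Rightarrow> 'a list set" where
  "prime_divisors M = {p \<in> mprimes. p pdivides M}"

lemma prime_divisors_degree:
  "M \<in> carrier Px \<Longrightarrow> M \<noteq> [] \<Longrightarrow> p \<in> prime_divisors M \<Longrightarrow> pdeg p \<le> pdeg M"
  using pdivides_imp_degree_le[OF carrier_is_subring, of p M] mprimes_carrier[of p]
  by (simp add: prime_divisors_def pdeg_def)

lemma finite_prime_divisors:
  assumes "finite (carrier R)" "M \<in> carrier Px" "M \<noteq> []"
  shows "finite (prime_divisors M)"
proof -
  interpret prime_system mprimes pdeg "card (carrier R)" by (rule prime_system_mprimes[OF assms(1)])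
  show ?thesis
    by (rule finite_subset[OF _ finite_primes_deg_le[of "pdeg M"]])
       (use prime_divisors_degree[OF assms(2,3)] in \<open>auto simp: prime_divisors_def\<close>)
qed

text \<open>A common divisor of the remainder and \<open>M\<close> also divides
  \<open>mset_prod F\<close>. Were it not constant, an irreducible factor of it would be a prime
  factor of \<open>F\<close> dividing \<open>M\<close>.\<close>

lemma pmod_coprime:
  assumes M: "M \<in> carrier Px" "M \<noteq> []" and F: "set_mset F \<subseteq> mprimes" "set_mset F \<inter> prime_divisors M
      = {}"
  shows "poly_coprime R (mset_prod F pmod M) M"
proof -
  define E where "E = mset_prod F"
  define B where "B = E pmod M"
  define u where "u = E pdiv M"
  have Ec: "E \<in> carrier Px" unfolding E_def using F mprimes_carrier by (intro mset_prod_closed) auto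
  have Bc: "B \<in> carrier Px" "u \<in> carrier Px"
      unfolding B_def u_def using long_division_closed[OF carrier_is_subfield Ec M(1)] by auto
  have EB: "E = M \<boxtimes> u \<boxplus> B" unfolding B_def u_def by (rule pdiv_pmod[OF carrier_is_subfield Ec M(1)])
  have one: "\<one>\<^bsub>Px\<^esub> divides\<^bsub>Px\<^esub> x" if "x \<in> carrier Px" for x
    using that by (auto simp: factor_def intro!: bexI[of _ x])
  have "y divides\<^bsub>Px\<^esub> \<one>\<^bsub>Px\<^esub>" if y: "y \<in> carrier Px" "y divides\<^bsub>Px\<^esub> B" "y divides\<^bsub>Px\<^esub> M" for y
  proof -
    have yd: "y pdivides B" "y pdivides M" using y by (auto simp: pdivides_def)
    have "y pdivides (u \<boxtimes> M)" by (rule pdivides_mult[OF y(1) M(1) Bc(2) yd(2)])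
    then have "y pdivides (M \<boxtimes> u)" using UP.m_comm[OF M(1) Bc(2)] by simp
    then have yE: "y pdivides E" unfolding EB using y yd M Bc by (intro pdivides_add) auto
    have yn: "y \<noteq> []" using yd(2) M zero_pdivides by auto
    have "degree y = 0"
    proof (rule ccontr)
      assume "degree y \<noteq> 0"
      then have "1 \<le> degree y" by linarith
      then obtain p where p: "p \<in> mprimes" "p pdivides y" using exists_mprime_divisor[OF y(1) yn]
          by blast
      then have "p pdivides M" "p pdivides E"
          using yd yE pdivides_trans[OF mprimes_carrier[OF p(1)]] by blast+
      then have "p \<in> prime_divisors M" "p \<in># F"
        using p mprime_divides_mset_prod[OF p(1) F(1)] by (auto simp: prime_divisors_def E_def)
      then show False using F(2) by blast
    qed
    then have "y \<in> Units Px" using y yn by (simp add: Units_Px_iff)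
    then have "y \<boxtimes> inv\<^bsub>Px\<^esub> y = \<one>\<^bsub>Px\<^esub>" "inv\<^bsub>Px\<^esub> y \<in> carrier Px" by (auto simp: UP.Units_r_inv)
    then show ?thesis by (auto simp: factor_def intro!: bexI[of _ "inv\<^bsub>Px\<^esub> y"])
  qed
  then show ?thesis using one[OF Bc(1)] one[OF M(1)]
      by (simp add: poly_coprime_def isgcd_def B_def E_def)
qed

text \<open>The polynomials prime to \<open>M\<close> of one large degree \<open>m\<close> reduce to
  residues counted by \<open>Phi\<close>, and at most \<open>q^(m - pdeg M)\<close> of them share a
  residue. Taking \<open>m\<close> beyond the total degree of the prime divisors makes
  \<open>card_elems_avoiding\<close> applicable.\<close>

lemma Phi_ge:
  assumes fin: "finite (carrier R)" and M: "M \<in> carrier Px" "M \<noteq> []"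
  shows "real (Phi R M) \<ge> real (card (carrier R)) ^ pdeg M * (\<Prod>p\<in>prime_divisors M. 1
      - 1 / real (card (carrier R)) ^ pdeg p)"
proof -
  define q where "q = card (carrier R)"
  interpret prime_system mprimes pdeg q unfolding q_def by (rule prime_system_mprimes[OF fin])
  define B where "B = prime_divisors M"
  have B: "finite B" "B \<subseteq> mprimes" using finite_prime_divisors[OF fin M]
      by (auto simp: B_def prime_divisors_def)
  define m where "m = pdeg M + (\<Sum>p\<in>B. pdeg p)"
  define S where "S = {F \<in> elems m. set_mset F \<inter> B = {}}"
  define A where "A = {A \<in> carrier Px. (A = [] \<or> degree A < degree M) \<and> poly_coprime R A M}"
  have finA: "finite A"
    by (rule finite_subset[of _ "low (pdeg M)"]) (use card_low[OF fin] in \<open>auto simp: A_def low_iff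
        pdeg_def\<close>)
  have finS: "finite S" unfolding S_def using finite_elems by simp
  have prim: "set_mset F \<subseteq> mprimes" if "F \<in> S" for F using that by (auto simp: S_def elems_def)
  have Ec: "mset_prod F \<in> carrier Px" if "F \<in> S" for F
    using prim[OF that] mprimes_carrier by (intro mset_prod_closed) auto
  have im: "(\<lambda>F. mset_prod F pmod M) ` S \<subseteq> A"
  proof (rule image_subsetI)
    fix F assume F: "F \<in> S"
    have "poly_coprime R (mset_prod F pmod M) M"
      using F prim[OF F] by (intro pmod_coprime M) (auto simp: S_def B_def)
    then show "mset_prod F pmod M \<in> A"
      using long_division_closed(2)[OF carrier_is_subfield Ec[OF F] M(1)] pmod_degree[OF
          carrier_is_subfield Ec[OF F] M]
      by (simp add: A_def)
  qed
  have fib: "card {F \<in> S. mset_prod F pmod M = r} \<le> q ^ (m - pdeg M)" if r: "r \<in> A" for r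
  proof -
    have rc: "r \<in> carrier Px" using r by (simp add: A_def)
    have "card {F \<in> S. mset_prod F pmod M = r} \<le> card {E \<in> monics R m. M pdivides (E \<boxminus> r)}"
    proof (rule card_inj_on_le[where f = mset_prod])
      show "inj_on mset_prod {F \<in> S. mset_prod F pmod M = r}"
        using mset_prod_inj prim by (auto intro!: inj_onI)
      show "mset_prod ` {F \<in> S. mset_prod F pmod M = r} \<subseteq> {E \<in> monics R m. M pdivides (E \<boxminus> r)}"
      proof (rule image_subsetI)
        fix F assume "F \<in> {F \<in> S. mset_prod F pmod M = r}"
        then have F: "F \<in> S" "mset_prod F pmod M = r" by auto
        define u where "u = mset_prod F pdiv M"
        have u: "u \<in> carrier Px" unfolding u_def
            by (rule long_division_closed(1)[OF carrier_is_subfield Ec[OF F(1)] M(1)])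
        have e: "mset_prod F = M \<boxtimes> u \<boxplus> r"
          unfolding u_def F(2)[symmetric] by (rule pdiv_pmod[OF carrier_is_subfield Ec[OF F(1)] M(1)])
        have "mset_prod F \<boxminus> r = M \<boxtimes> u" unfolding e using M u rc by (intro add_diff_cancel_right) auto
        moreover have "mset_prod F \<in> monics R m" using mset_prod_monics[OF prim[OF F(1)]] F(1)
            by (simp add: S_def elems_def deg_def pdeg_def)
        ultimately show "mset_prod F \<in> {E \<in> monics R m. M pdivides (E \<boxminus> r)}" using u
            by (auto intro: pdividesI)
      qed
      have "finite (monics R m)" using card_monics[OF fin, of m] q_ge_2
          by (intro card_ge_0_finite) (simp add: q_def)
      then show "finite {E \<in> monics R m. M pdivides (E \<boxminus> r)}" by simp
    qed
    also have "\<dots> = q ^ (m - pdeg M)" unfolding q_def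
        by (rule card_monics_residue[OF fin M _ rc, folded pdeg_def]) (simp add: m_def)
    finally show ?thesis .
  qed
  have "card S = (\<Sum>r\<in>A. card {F \<in> S. mset_prod F pmod M = r})"
    using sum.group[OF finS finA im, of "\<lambda>_. 1 :: nat"] by simp
  also have "\<dots> \<le> (\<Sum>r\<in>A. q ^ (m - pdeg M))" by (intro sum_mono fib)
  also have "\<dots> = Phi R M * q ^ (m - pdeg M)" by (simp add: A_def Phi_def)
  finally have "real (card S) \<le> real (Phi R M * q ^ (m - pdeg M))" by (simp only: of_nat_le_iff)
  moreover have "real (card S) = real q ^ m * (\<Prod>p\<in>B. 1 - 1 / real q ^ pdeg p)"
    unfolding S_def by (rule card_elems_avoiding[OF B]) (simp add: m_def)
  moreover have "real q ^ m = real q ^ pdeg M * real q ^ (m - pdeg M)"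
    by (simp add: m_def flip: power_add)
  ultimately have "real q ^ (m - pdeg M) * (real q ^ pdeg M * (\<Prod>p\<in>B. 1 - 1 / real q ^ pdeg p))
      \<le> real q ^ (m - pdeg M) * real (Phi R M)"
    by (simp add: mult_ac)
  moreover have "real q ^ (m - pdeg M) > 0" using q_ge_2 by simp
  ultimately have "real q ^ pdeg M * (\<Prod>p\<in>B. 1 - 1 / real q ^ pdeg p) \<le> real (Phi R M)"
    by (simp only: mult_le_cancel_left_pos)
  then show ?thesis by (simp add: q_def B_def)
qed

text \<open>The conjunct \<open>set_mset F \<subseteq> mprimes\<close> is part of the predicate
  because \<open>ap_coprime\<close> speaks of all multisets, while \<open>mset_prod\<close> is
  controlled only on multisets of irreducibles.\<close>

lemma prime_system_ap_poly:
  assumes fin: "finite (carrier R)" and M: "M \<in> carrier Px" "M \<noteq> []"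
      and A: "A \<in> carrier Px" "poly_coprime R A M"
  shows "prime_system_ap mprimes pdeg (card (carrier R)) (prime_divisors M) (pdeg M) (\<lambda>F. set_mset F
      \<subseteq> mprimes \<and> poly_cong R M (mset_prod F) A)"
proof -
  interpret prime_system mprimes pdeg "card (carrier R)" by (rule prime_system_mprimes[OF fin])
  show ?thesis
  proof
    show "prime_divisors M \<subseteq> mprimes" by (auto simp: prime_divisors_def)
    show "pdeg p \<le> pdeg M" if "p \<in> prime_divisors M" for p using prime_divisors_degree[OF M that] .
  next
    fix D m assume D: "set_mset D \<subseteq> mprimes - prime_divisors M" and m: "pdeg M \<le> m"
    have D': "set_mset D \<subseteq> {p \<in> mprimes. \<not> p pdivides M}" using D by (auto simp: prime_divisors_def)
    have "{F \<in> elems m. set_mset (D + F) \<subseteq> mprimes \<and> poly_cong R M (mset_prod (D + F)) A}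
        = {F. set_mset F \<subseteq> mprimes \<and> (\<Sum>p\<in>#F. pdeg p) = m \<and> poly_cong R M (mset_prod (D + F)) A}"
      using D by (auto simp: elems_def deg_def)
    then show "card {F \<in> elems m. set_mset (D + F) \<subseteq> mprimes \<and> poly_cong R M (mset_prod (D + F)) A}
        = card (carrier R) ^ (m - pdeg M)"
      using card_ap_multiples[OF fin M _ A(1) D', of m, folded pdeg_def] m by simp
  next
    fix F assume "set_mset F \<subseteq> mprimes \<and> poly_cong R M (mset_prod F) A"
    then have F: "set_mset F \<subseteq> mprimes" "M pdivides (mset_prod F \<boxminus> A)" by (auto simp: poly_cong_def)
    show "set_mset F \<inter> prime_divisors M = {}"
    proof (rule ccontr)
      assume "set_mset F \<inter> prime_divisors M \<noteq> {}"
      then obtain p where p: "p \<in># F" "p \<in> mprimes" "p pdivides M" by (auto simp: prime_divisors_def)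
      note pc = mprimes_carrier[OF p(2)]
      have Ec: "mset_prod F \<in> carrier Px" using F mprimes_carrier by (intro mset_prod_closed) auto
      have "p pdivides mset_prod F" using mprime_divides_mset_prod[OF p(2) F(1)] p by simp
      moreover have "p pdivides (mset_prod F \<boxminus> A)" by (rule pdivides_trans[OF pc p(3) F(2)])
      ultimately have "p pdivides (mset_prod F \<boxminus> (mset_prod F \<boxminus> A))"
        by (rule pdivides_minus[rotated 3]) (use pc Ec A in auto)
      then have "p pdivides A" using diff_diff_left_cancel[OF Ec A(1)] by simp
      then have "p divides\<^bsub>Px\<^esub> \<one>\<^bsub>Px\<^esub>" using A(2) p(3) pc
          by (auto simp: poly_coprime_def isgcd_def pdivides_def)
      then have "p pdivides [\<one>]" by (simp add: pdivides_def Px_one)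
      then have "degree p \<le> 0"
        using pdivides_imp_degree_le[OF carrier_is_subring pc, of "[\<one>]"] by (auto simp: mem_Px)
      then show False using mprimes_degree_ge_1[OF p(2)] by simp
    qed
  qed
qed

end

section \<open>Transfer of the counting bounds to polynomials\<close>

context field
begin

lemma card_prime_divisors_deg: "card {p \<in> prime_divisors M. pdeg p = j} = num_irred_divisors R j M"
  unfolding num_irred_divisors_def
  by (rule arg_cong[where f=card]) (auto simp: mprimes_def monics_def prime_divisors_def pdeg_def)

lemma card_H_ge:
  assumes fin: "finite (carrier R)" and M: "M \<in> carrier Px" "M \<noteq> []"
      and A: "A \<in> carrier Px" "poly_coprime R A M"
    and b: "1 \<le> b" "2 * b \<le> n" "2 * pdeg M \<le> b"
  shows "real (card (carrier R)) ^ (n - pdeg M) / (4752 * (real b)\<^sup>2 * fact J) *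
      degree_sum (\<lambda>j. real (card {p \<in> mprimes - prime_divisors M. pdeg p
          = j}) / real (card (carrier R)) ^ j) J b
     \<le> real (card (H R n b A M))"
proof -
  interpret prime_system_ap mprimes pdeg "card (carrier R)" "prime_divisors M" "pdeg M"
    "\<lambda>F. set_mset F \<subseteq> mprimes \<and> poly_cong R M (mset_prod F) A"
    by (rule prime_system_ap_poly[OF fin M A])
  have "card (with_divisor n b) \<le> card (H R n b A M)"
  proof (rule card_inj_on_le[where f = mset_prod])
    show "inj_on mset_prod (with_divisor n b)"
      by (rule inj_onI) (auto simp: with_divisor_def intro: mset_prod_inj)
    show "mset_prod ` with_divisor n b \<subseteq> H R n b A M"
    proof (rule image_subsetI)
      fix F assume "F \<in> with_divisor n b"
      then obtain D where F: "F \<in> elems n" "set_mset F \<subseteq> mprimes" "poly_cong R M (mset_prod F) A"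
        and D: "D \<subseteq># F" "deg D = b" by (auto simp: with_divisor_def)
      have Fm: "mset_prod F \<in> monics R n"
        using mset_prod_monics[OF F(2)] F(1) by (simp add: elems_def deg_def pdeg_def)
      define G where "G = F - D"
      have FG: "F = D + G" using D by (simp add: G_def)
      have s: "set_mset D \<subseteq> mprimes" "set_mset G \<subseteq> mprimes" using F(2) by (auto simp: FG)
      then have c: "set_mset D \<subseteq> carrier Px" "set_mset G \<subseteq> carrier Px" using mprimes_carrier by blast+
      have "mset_prod D pdivides mset_prod F"
        unfolding FG using c mset_prod_closed
            by (intro pdividesI[of "mset_prod G"] mset_prod_union) auto
      moreover have "mset_prod D \<in> monics R b"
        using mset_prod_monics[OF s(1)] D(2) by (simp add: deg_def pdeg_def)
      ultimately show "mset_prod F \<in> H R n b A M"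
        using Fm F(3) by (auto simp: H_def monics_def)
    qed
    have "finite (monics R n)" using card_monics[OF fin, of n] q_ge_2 by (intro card_ge_0_finite) simp
    then show "finite (H R n b A M)" unfolding H_def by simp
  qed
  then show ?thesis
    using card_with_divisor_ge[OF b, of J] unfolding density_def[abs_def] by linarith
qed

text \<open>By \<open>1 - x >= exp (- 2 * x)\<close> for \<open>x <= 1/2\<close> it suffices to
  bound the sum of \<open>q^(- degree)\<close> over the prime divisors of \<open>M\<close>. Degree
  \<open>j\<close> contributes at most \<open>C / j^(1 + \<epsilon>)\<close>, and this series
  converges to a value free of \<open>q\<close> and \<open>M\<close>.\<close>

lemma Phi_ge_exp:
  assumes fin: "finite (carrier R)" and M: "M \<in> carrier Px" "M \<noteq> []" and C: "0 \<le> C" and \<epsilon>: "0 < \<epsilon>"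
    and irr: "\<And>j. 1 \<le> j \<Longrightarrow> real (num_irred_divisors R j M)
        \<le> C * (real (card (carrier R)) ^ j / real j powr (1 + \<epsilon>))"
  shows "real (Phi R M) \<ge> real (card (carrier R)) ^ pdeg M * exp (- 2 * (C
      * (\<Sum>j. 1 / real (Suc j) powr (1 + \<epsilon>))))"
proof -
  define q where "q = card (carrier R)"
  define Z where "Z = (\<Sum>j. 1 / real (Suc j) powr (1 + \<epsilon>))"
  define B where "B = prime_divisors M"
  interpret prime_system mprimes pdeg q unfolding q_def by (rule prime_system_mprimes[OF fin])
  have q0: "real q > 0" using q_ge_2 by simp
  have finB: "finite B" unfolding B_def by (rule finite_prime_divisors[OF fin M])
  have BP: "p \<in> mprimes" "pdeg p \<in> {1..pdeg M}" if "p \<in> B" for p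
    using that dg_ge_1[of p] prime_divisors_degree[OF M, of p] by (auto simp: B_def prime_divisors_def)
  have "summable (\<lambda>j. real j powr (- (1 + \<epsilon>)))" using \<epsilon> by (subst summable_real_powr_iff) auto
  then have "summable (\<lambda>j. real (Suc j) powr (- (1 + \<epsilon>)))" by (subst summable_Suc_iff)
  then have sm: "summable (\<lambda>j. 1 / real (Suc j) powr (1 + \<epsilon>))"
      by (simp only: powr_minus inverse_eq_divide)
  have "(\<Sum>p\<in>B. 1 / real q ^ pdeg p) = (\<Sum>j\<in>{1..pdeg M}. \<Sum>p\<in>{p\<in>B. pdeg p = j}. 1 / real q ^ pdeg p)"
    using BP finB by (intro sum.group[symmetric]) auto
  also have "\<dots> = (\<Sum>j\<in>{1..pdeg M}. real (num_irred_divisors R j M) / real q ^ j)"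
    by (rule sum.cong[OF refl]) (simp add: card_prime_divisors_deg[symmetric] B_def)
  also have "\<dots> \<le> (\<Sum>j\<in>{1..pdeg M}. C * (1 / real j powr (1 + \<epsilon>)))"
  proof (rule sum_mono)
    fix j assume "j \<in> {1..pdeg M}"
    then have "real (num_irred_divisors R j M) \<le> C * (1 / real j powr (1 + \<epsilon>)) * real q ^ j"
      using irr[of j] by (simp add: q_def)
    then show "real (num_irred_divisors R j M) / real q ^ j \<le> C * (1 / real j powr (1 + \<epsilon>))"
      using q0 by (subst pos_divide_le_eq) auto
  qed
  also have "\<dots> = C * (\<Sum>j<pdeg M. 1 / real (Suc j) powr (1 + \<epsilon>))"
    by (simp only: sum_distrib_left[symmetric] One_nat_def sum.atLeast1_atMost_eq)
  also have "\<dots> \<le> C * Z"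
    unfolding Z_def using sm C by (intro mult_left_mono sum_le_suminf) auto
  finally have sumB: "(\<Sum>p\<in>B. 1 / real q ^ pdeg p) \<le> C * Z" .
  have "exp (- 2 * (C * Z)) \<le> exp (\<Sum>p\<in>B. - 2 * (1 / real q ^ pdeg p))"
    using sumB by (simp only: sum_distrib_left[symmetric]) simp
  also have "\<dots> = (\<Prod>p\<in>B. exp (- 2 * (1 / real q ^ pdeg p)))" using finB by (rule exp_sum)
  also have "\<dots> \<le> (\<Prod>p\<in>B. 1 - 1 / real q ^ pdeg p)"
  proof (rule prod_mono, intro conjI)
    fix p assume p: "p \<in> B"
    have "(2::real) ^ 1 \<le> 2 ^ pdeg p" using BP(2)[OF p] by (intro power_increasing) auto
    also have "\<dots> \<le> real q ^ pdeg p" using q_ge_2 by (intro power_mono) auto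
    finally have "1 / real q ^ pdeg p \<le> 1 / 2" by (intro frac_le) auto
    then show "exp (- 2 * (1 / real q ^ pdeg p)) \<le> 1 - 1 / real q ^ pdeg p"
      using q0 by (intro exp_minus_double_le) auto
  qed simp
  finally have "real q ^ pdeg M * exp (- 2 * (C * Z))
      \<le> real q ^ pdeg M * (\<Prod>p\<in>B. 1 - 1 / real q ^ pdeg p)"
    using q0 by (intro mult_left_mono) auto
  also have "\<dots> \<le> real (Phi R M)" unfolding q_def B_def by (rule Phi_ge[OF fin M])
  finally show ?thesis by (simp only: q_def Z_def)
qed

text \<open>The irreducibles dividing \<open>M\<close> cost \<open>C / j^(1 + \<epsilon>)\<close>
  and the counting of irreducibles costs \<open>4 / j^2\<close>; the exponent
  \<open>1 + min \<epsilon> 1\<close> accommodates both.\<close>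

lemma density_bounds:
  assumes fin: "finite (carrier R)" and M: "M \<in> carrier Px" "M \<noteq> []" and C: "0 \<le> C" and j: "1 \<le> j"
    and irr: "real (num_irred_divisors R j M) \<le> C * (real (card (carrier R)) ^ j / real j powr (1 + \<epsilon>))"
  shows "1 / real j - (C + 4) / real j powr (1 + min \<epsilon> 1)
           \<le> real (card {p \<in> mprimes - prime_divisors M. pdeg p = j}) / real (card (carrier R)) ^ j"
    and "real (card {p \<in> mprimes - prime_divisors M. pdeg p = j}) / real (card (carrier R)) ^ j
        \<le> 1 / real j"
proof -
  define q where "q = card (carrier R)"
  interpret prime_system mprimes pdeg q unfolding q_def by (rule prime_system_mprimes[OF fin])
  have q0: "real q > 0" using q_ge_2 by simp
  have "{p \<in> mprimes - prime_divisors M. pdeg p = j} = {p \<in> mprimes. pdeg p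
      = j} - {p \<in> prime_divisors M. pdeg p = j}"
    by auto
  moreover have "{p \<in> prime_divisors M. pdeg p = j} \<subseteq> {p \<in> mprimes. pdeg p = j}"
      by (auto simp: prime_divisors_def)
  ultimately have "real (card {p \<in> mprimes - prime_divisors M. pdeg p = j})
      = real (num_primes j) - real (num_irred_divisors R j M)"
    using finite_primes_deg[of j] unfolding card_prime_divisors_deg[symmetric] num_primes_def
    by (simp add: card_Diff_subset finite_subset of_nat_diff card_mono)
  then have eq: "real (card {p \<in> mprimes - prime_divisors M. pdeg p = j}) / real q ^ j
      = real (num_primes j) / real q ^ j - real (num_irred_divisors R j M) / real q ^ j"
    by (simp add: diff_divide_distrib)
  have "real (num_irred_divisors R j M) \<le> C * (1 / real j powr (1 + \<epsilon>)) * real q ^ j" using irr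
      by (simp add: q_def)
  then have i1: "real (num_irred_divisors R j M) / real q ^ j \<le> C * (1 / real j powr (1 + \<epsilon>))"
    using q0 by (subst pos_divide_le_eq) auto
  have "real j powr (1 + min \<epsilon> 1) \<le> real j powr (1 + \<epsilon>)" using j by (intro powr_mono) auto
  then have "C * (1 / real j powr (1 + \<epsilon>)) \<le> C * (1 / real j powr (1 + min \<epsilon> 1))"
    using C j by (intro mult_left_mono frac_le) auto
  moreover have "real j powr (1 + min \<epsilon> 1) \<le> real j powr 2" using j by (intro powr_mono) auto
  then have "4 / real j ^ 2 \<le> 4 / real j powr (1 + min \<epsilon> 1)" using j
      by (intro frac_le) (auto simp: powr_numeral)
  ultimately show "1 / real j - (C + 4) / real j powr (1 + min \<epsilon> 1)
           \<le> real (card {p \<in> mprimes - prime_divisors M. pdeg p = j}) / real (card (carrier R)) ^ j"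
    using num_primes_density_ge[OF j] i1 unfolding eq[unfolded q_def]
        by (simp add: q_def add_divide_distrib)
  show "real (card {p \<in> mprimes - prime_divisors M. pdeg p = j}) / real (card (carrier R)) ^ j
      \<le> 1 / real j"
  proof -
    have "0 \<le> real (num_irred_divisors R j M) / real q ^ j" by simp
    then show ?thesis using num_primes_density_le[OF j] eq unfolding q_def by linarith
  qed
qed

end

theorem theorem1p2:
  fixes \<epsilon> C :: real
  assumes "\<epsilon> > 0" and "C > 0"
  shows "\<exists>c X0 :: real. c > 0 \<and>
    (\<forall>(R :: nat ring) (q :: nat) (n :: nat) (b :: nat) (M :: nat list) (A :: nat list).
       field R \<longrightarrow> finite (carrier R) \<longrightarrow> q = card (carrier R) \<longrightarrow>
       2 \<le> n \<longrightarrow> 1 \<le> b \<longrightarrow> real b \<le> real n / 2 \<longrightarrow>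
       M \<in> carrier (poly_ring R) \<longrightarrow> A \<in> carrier (poly_ring R) \<longrightarrow>
       M \<noteq> \<zero>\<^bsub>poly_ring R\<^esub> \<longrightarrow> poly_coprime R A M \<longrightarrow>
       real (Polynomials.degree M) \<le> (1/2 - \<epsilon>) * real b \<longrightarrow>
       (\<forall>j::nat. 1 \<le> j \<longrightarrow>
          real (num_irred_divisors R j M) \<le> C * (real q ^ j / real j powr (1 + \<epsilon>))) \<longrightarrow>
       X0 \<le> real q ^ n \<longrightarrow>
       real (card (H R n b A M)) \<ge>
         c * (1 / real (Phi R M)) *
         (real q ^ n / (real b powr delta * (1 + ln (real b)) powr (3/2))))"
proof -
  obtain c0 where c0: "c0 > 0" and core: "\<And>b \<rho>. b \<ge> 1 \<Longrightarrow>
     (\<forall>j\<ge>1. 1 / real j - (C + 4) / real j powr (1 + min \<epsilon> 1) \<le> \<rho> j \<and> 0 \<le> \<rho> j \<and> \<rho> j \<le> 1 / real j) \<Longrightarrow>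
     \<exists>J. degree_sum \<rho> J b
        \<ge> c0 * fact J * (real b powr (2 - delta) / (1 + ln (real b)) powr (3/2))"
    using divisor_degree_sum_ge[of "min \<epsilon> 1" "C + 4"] assms by auto
  define \<eta> where "\<eta> = exp (- 2 * (C * (\<Sum>j. 1 / real (Suc j) powr (1 + \<epsilon>))))"
  \<comment> \<open>\<open>4752\<close> is the loss in \<open>card_with_divisor_ge\<close>, and
    \<open>\<eta>\<close> is the lower bound for \<open>Phi R M\<close> divided by \<open>q\<close>
    to the degree of \<open>M\<close>.\<close>
  define c where "c = c0 / 4752 * \<eta>"
  have \<eta>: "\<eta> > 0" by (simp add: \<eta>_def)
  show ?thesis
  proof (intro exI[of _ c] exI[of _ "0::real"] conjI allI impI)
    show "c > 0" using c0 \<eta> by (simp add: c_def)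
    fix R :: "nat ring" and q n b :: nat and M A :: "nat list"
    assume R: "field R" and fin: "finite (carrier R)" and q: "q = card (carrier R)"
      and n: "2 \<le> n" and b: "1 \<le> b" "real b \<le> real n / 2"
      and M: "M \<in> carrier (poly_ring R)" and A: "A \<in> carrier (poly_ring R)"
      and M0: "M \<noteq> \<zero>\<^bsub>poly_ring R\<^esub>" and AM: "poly_coprime R A M"
      and degM: "real (Polynomials.degree M) \<le> (1/2 - \<epsilon>) * real b"
      and irr: "\<forall>j::nat. 1 \<le> j \<longrightarrow> real (num_irred_divisors R j M)
          \<le> C * (real q ^ j / real j powr (1 + \<epsilon>))"
    interpret field R by (rule R)
    have Mn: "M \<noteq> []" using M0 by (simp add: univ_poly_zero)
    define m where "m = pdeg M"
    have q2: "q \<ge> 2" unfolding q by (rule card_carrier_ge_2[OF fin])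
    have nb: "2 * b \<le> n" using b(2) by linarith
    have mb: "2 * m \<le> b"
    proof -
      have "(1/2 - \<epsilon>) * real b \<le> 1/2 * real b" using assms by (intro mult_right_mono) auto
      then show ?thesis using degM unfolding m_def pdeg_def by linarith
    qed
    define \<rho> where "\<rho> j = real (card {p \<in> mprimes - prime_divisors M. pdeg p = j}) / real q ^ j" for j
    have irr': "real (num_irred_divisors R j M)
        \<le> C * (real (card (carrier R)) ^ j / real j powr (1 + \<epsilon>))" if "1 \<le> j" for j
      using irr that unfolding q by blast
    have "\<forall>j\<ge>1. 1 / real j - (C + 4) / real j powr (1 + min \<epsilon> 1) \<le> \<rho> j \<and> 0 \<le> \<rho> j \<and> \<rho> j \<le> 1 / real j"
      using density_bounds[OF fin M Mn _ _ irr'] assms unfolding \<rho>_def q by auto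
    from core[OF b(1) this] obtain J where
      J: "degree_sum \<rho> J b
        \<ge> c0 * fact J * (real b powr (2 - delta) / (1 + ln (real b)) powr (3/2))" by blast
    define Y where "Y = (1 + ln (real b)) powr (3/2)"
    have "ln (real b) \<ge> 0" using b(1) by simp
    then have "1 + ln (real b) > 0" by linarith
    then have Y: "Y > 0" by (simp add: Y_def)
    have qp: "real q > 0" using q2 by simp
    have bp: "real b > 0" using b(1) by simp
    have Phi: "real q ^ m * \<eta> \<le> real (Phi R M)"
      unfolding \<eta>_def m_def q by (rule Phi_ge_exp[OF fin M Mn _ _ irr']) (use assms in auto)
    moreover have "0 < real q ^ m * \<eta>" using qp \<eta> by simp
    ultimately have Php: "0 < real (Phi R M)" by linarith
    have "\<eta> / real (Phi R M) \<le> 1 / real q ^ m"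
      using Phi Php qp by (simp add: divide_simps mult_ac)
    then have "c0 / 4752 * (real q ^ n / (real b powr delta * Y)) * (\<eta> / real (Phi R M))
        \<le> c0 / 4752 * (real q ^ n / (real b powr delta * Y)) * (1 / real q ^ m)"
      using c0 Y by (intro mult_left_mono) auto
    also have "real q ^ n = real q ^ m * real q ^ (n - m)" using mb nb by (simp flip: power_add)
    \<comment> \<open>The factor \<open>b^2\<close> lost to \<open>p\<close> and to the sieve turns
      \<open>b^(2 - delta)\<close> into \<open>b^(- delta)\<close>, and \<open>J!\<close>
      cancels.\<close>
    also have "c0 / 4752 * (real q ^ m * real q ^ (n - m) / (real b powr delta * Y)) * (1 / real q ^ m)
        = real q ^ (n - m) / (4752 * (real b)\<^sup>2 * fact J) * (c0 * fact J * (real b powr (2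
            - delta) / Y))"
    proof -
      have "real b powr (2 - delta) = (real b)\<^sup>2 / real b powr delta" using bp
          by (simp add: powr_diff powr_numeral)
      then show ?thesis using qp bp Y by (simp add: field_simps)
    qed
    also have "\<dots> \<le> real q ^ (n - m) / (4752 * (real b)\<^sup>2 * fact J) *
       degree_sum \<rho> J b"
      using J unfolding Y_def by (intro mult_left_mono) auto
    also have "\<dots> \<le> real (card (H R n b A M))"
      unfolding m_def \<rho>_def[abs_def] q by (rule card_H_ge[OF fin M Mn A AM b(1) nb]) (use mb in \<open>simp
          add: m_def\<close>)
    finally show "c * (1 / real (Phi R M)) * (real q ^ n / (real b powr delta * (1
        + ln (real b)) powr (3/2)))
        \<le> real (card (H R n b A M))"
      using mb nb by (simp add: c_def Y_def mult_ac flip: power_add)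
  qed
qed

end
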